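(* Let $X$ be a real stationary GeRF over $\mathbb{R}^{d}$ with spectral measure $\mu_{X}$. Let $g:\mathbb{R}^{d}\to\mathbb{C}$ be a symbol function and let $\mathcal{L}_{g}=\mathscr{F}^{-1}(g\,\mathscr{F}(\cdot))$ be the associated operator. Then there exists a real stationary GeRF $U$ over $\mathbb{R}^d$ satisfying $$\mathcal{L}_{g}U \stackrel{2nd\ o.}{=} X \qquad (\ast)$$ if and only if there exists $N\in\mathbb{N}$ such that $$\int_{\mathbb{R}^{d}} \frac{d\mu_{X}(\xi)}{|g(\xi)|^{2}(1+|\xi|^{2})^{N}} < \infty .$$ In this case, the measure $d\mu_{U}(\xi)=|g(\xi)|^{-2}d\mu_{X}(\xi)$ is a spectral measure (i.e. an even measure in $\mathcal{M}_{SG}^{+}(\mathbb{R}^{d})$), and any real stationary GeRF with spectral measure $\mu_{U}$ solves $(\ast)$. Moreover, $\mu_{U}$ is the unique solution $\mu\in\mathcal{M}_{SG}^{+}(\mathbb{R}^{d})$ of the equation $|g|^{2}\mu=\mu_{X}$ if and only if $|g|>0$ on $\mathbb{R}^{d}$.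
   Context: Conventions: $\mathbb{N}=\{0,1,2,\dots\}$. $\mathcal{S}(\mathbb{R}^d)$ is the (complex) Schwartz space and $\mathcal{S}'(\mathbb{R}^d)$ the space of tempered distributions. The Fourier transform is $\mathscr{F}(\varphi)(\xi)=(2\pi)^{-d/2}\int_{\mathbb{R}^d} e^{-i\xi^T x}\varphi(x)dx$ on $\mathcal{S}(\mathbb{R}^d)$, extended to $\mathcal{S}'(\mathbb{R}^d)$ by $\langle\mathscr{F}(T),\varphi\rangle=\langle T,\mathscr{F}(\varphi)\rangle$. In integrals involving $1/|g|^2$, the value $1/0$ is $+\infty$. Measures: $\mathcal{M}_{SG}(\mathbb{R}^d)$ is the set of slow-growing measures, i.e. complex Radon measures $\mu$ on $\mathbb{R}^d$ (defined at least on bounded Borel sets) such that $\int_{\mathbb{R}^d}(1+|x|^2)^{-N}d|\mu|(x)<\infty$ for some $N\in\mathbb{N}$, where $|\mu|$ is the total variation measure; $\mathcal{M}^+_{SG}(\mathbb{R}^d)$ is the subset of positive measures. Each $\mu \in\mathcal{M}_{SG}(\mathbb{R}^d)$ is identified with the tempered distribution $\varphi\mapsto\int\varphi\,d\mu$. A spectral measure is an even measure in $\mathcal{M}_{SG}^+(\mathbb{R}^d)$. For $f$ continuous and polynomially bounded and $\mu\in\mathcal{M}_{SG}$, $f\mu$ is the measure $A\mapsto\int_A f\,d\mu$. Symbol functions: a symbol function over $\mathbb{R}^d$ is a continuous, polynomially bounded function $g:\mathbb{R}^d\to\mathbb{C}$ that is Hermitian-symmetric: $g(x)=\overline{g(-x)}$.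 Random fields: a GeRF (generalized random field) $Z$ is a continuous linear map $\varphi\mapsto\langle Z,\varphi\rangle$ from $\mathcal{S}(\mathbb{R}^d)$ to $L^2(\Omega,\mathcal{F},\mathbb{P})$ for some probability space (complex-valued square-integrable random variables); it is real if $\langle Z,\varphi\rangle$ is real for real $\varphi$. All GeRFs are assumed to have zero mean. The covariance distribution $C_Z\in\mathcal{S}'(\mathbb{R}^d\times\mathbb{R}^d)$ is determined by $\mathbb{C}ov(\langle Z,\varphi\rangle,\langle Z,\phi\rangle)=\mathbb{E}(\langle Z,\varphi\rangle\overline{\langle Z,\phi\rangle})=\langle C_Z,\varphi\otimes\overline{\phi}\rangle$. A real GeRF $Z$ is (second order) stationary if there is a real even $\rho_Z\in\mathcal{S}'(\mathbb{R}^d)$ with $\langle C_Z,\varphi\otimes\overline{\phi}\rangle=\langle\rho_Z,\varphi\ast\check{\overline{\phi}}\rangle$ for all $\varphi,\phi\in\mathcal{S}(\mathbb{R}^d)$, where $\check{\phi}(x)=\phi(-x)$; $\rho_Z$ is its covariance distribution. By the Bochner–Schwartz theorem there is a unique even $\mu_Z\in\mathcal{M}^+_{SG}(\mathbb{R}^d)$ with $\rho_Z=\mathscr{F}(\mu_Z)$, called the spectral measure of $Z$. The operator on GeRFs: for a GeRF $Z$, $\mathscr{F}(Z)$ and $\mathscr{F}^{-1}(Z)$ are defined by $\langle\mathscr{F}^{\pm1}(Z),\varphi\rangle=\langle Z,\mathscr{F}^{\pm1}(\varphi)\rangle$. If $U$ is a real stationary GeRF, then $M=\mathscr{F}(U)$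 satisfies $\mathbb{E}(\langle M,\varphi\rangle\overline{\langle M,\phi\rangle})=(2\pi)^{d/2}\int\varphi\overline{\phi}\,d\mu_U$, and $gM$ is the GeRF $\langle gM,\varphi\rangle:=\langle M,g\varphi\rangle$, where $\langle M,f\rangle$, for a continuous $f$ with $\sup_x(1+|x|^2)^k|f(x)|<\infty$ for all $k\in\mathbb{N}$, is the $L^2$-limit of $\langle M,f_n\rangle$ for any $f_n\in\mathcal{S}(\mathbb{R}^d)$ with $\|(1+|x|^2)^k(f_n-f)\|_\infty\to0$ for every $k\in\mathbb{N}$. Then $\mathcal{L}_gU:=\mathscr{F}^{-1}(g\,\mathscr{F}(U))$. Second order equality: $\mathcal{L}_gU\stackrel{2nd\ o.}{=}X$ means that $\mathcal{L}_gU$ and $X$ have the same covariance distribution ($U$ and $X$ need not be defined on the same probability space). *)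

theory Defs
  imports "HOL-Probability.Probability"
begin

section \<open>Schwartz functions and tempered distributions\<close>

primrec partial_derivs :: "'a list \<Rightarrow> ('a::euclidean_space \<Rightarrow> complex) \<Rightarrow> 'a \<Rightarrow> complex" where
  "partial_derivs [] f = f"
| "partial_derivs (b # bs) f = (\<lambda>x. frechet_derivative (partial_derivs bs f) (at x) b)"

text \<open>Multi-indices are represented by lists of standard basis vectors. Differentiability of
  all iterated partial derivatives is smoothness.\<close>

definition schwartz :: "('a::euclidean_space \<Rightarrow> complex) set" where
  "schwartz = {f. \<forall>bs. set bs \<subseteq> Basis \<longrightarrow>
     (\<forall>x. partial_derivs bs f differentiable (at x)) \<and>
     (\<forall>k::nat. bounded (range (\<lambda>x. (1 + (norm x)\<^sup>2) ^ k *\<^sub>R partial_derivs bs f x)))}"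

definition schwartz_seminorm :: "nat \<Rightarrow> 'a list \<Rightarrow> ('a::euclidean_space \<Rightarrow> complex) \<Rightarrow> real" where
  "schwartz_seminorm k bs f = (SUP x. (1 + (norm x)\<^sup>2) ^ k * cmod (partial_derivs bs f x))"

definition schwartz_topology :: "('a::euclidean_space \<Rightarrow> complex) topology" where
  "schwartz_topology = topology_generated_by
     {{f \<in> schwartz. schwartz_seminorm k bs (\<lambda>x. f x - f0 x) < e} | f0 k bs e.
        f0 \<in> schwartz \<and> set bs \<subseteq> Basis \<and> e > 0}"

text \<open>Distributions are functions on all of \<^typ>\<open>'a \<Rightarrow> complex\<close>; only their values on
  \<^const>\<open>schwartz\<close> are meaningful.\<close>

type_synonym 'a distribution = "('a \<Rightarrow> complex) \<Rightarrow> complex"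

definition tempered :: "'a::euclidean_space distribution \<Rightarrow> bool" where
  "tempered T \<longleftrightarrow>
     (\<forall>f\<in>schwartz. \<forall>h\<in>schwartz. \<forall>a b. T (\<lambda>x. a * f x + b * h x) = a * T f + b * T h) \<and>
     continuous_map schwartz_topology euclidean T"

definition reflect :: "('a::euclidean_space \<Rightarrow> complex) \<Rightarrow> 'a \<Rightarrow> complex" where
  "reflect f = (\<lambda>x. f (- x))"

definition real_valued_distribution :: "'a::euclidean_space distribution \<Rightarrow> bool" where
  "real_valued_distribution T \<longleftrightarrow> (\<forall>f\<in>schwartz. (\<forall>x. f x \<in> \<real>) \<longrightarrow> T f \<in> \<real>)"

definition even_distribution :: "'a::euclidean_space distribution \<Rightarrow> bool" where
  "even_distribution T \<longleftrightarrow> (\<forall>f\<in>schwartz. T (reflect f) = T f)"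

definition tensor :: "('a \<Rightarrow> complex) \<Rightarrow> ('b \<Rightarrow> complex) \<Rightarrow> 'a \<times> 'b \<Rightarrow> complex" where
  "tensor f h = (\<lambda>(x, y). f x * h y)"

definition convolve ::
  "('a::euclidean_space \<Rightarrow> complex) \<Rightarrow> ('a \<Rightarrow> complex) \<Rightarrow> 'a \<Rightarrow> complex" where
  "convolve f h = (\<lambda>x. LINT y|lborel. f y * h (x - y))"

definition fourier :: "('a::euclidean_space \<Rightarrow> complex) \<Rightarrow> 'a \<Rightarrow> complex" where
  "fourier f = (\<lambda>\<xi>. complex_of_real ((2 * pi) powr (- real DIM('a) / 2)) *
     (LINT x|lborel. exp (- \<i> * complex_of_real (\<xi> \<bullet> x)) * f x))"

definition fourier_inv :: "('a::euclidean_space \<Rightarrow> complex) \<Rightarrow> 'a \<Rightarrow> complex" where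
  "fourier_inv = inv_into schwartz fourier"

definition fourier_distribution :: "'a::euclidean_space distribution \<Rightarrow> 'a distribution" where
  "fourier_distribution T = (\<lambda>f. T (fourier f))"


section \<open>Slow-growing and spectral measures\<close>

text \<open>Positive slow-growing measures. A Borel measure satisfying the integrability condition is
  finite on bounded sets, hence Radon.\<close>

definition slow_growing :: "'a::euclidean_space measure \<Rightarrow> bool" where
  "slow_growing \<mu> \<longleftrightarrow> sets \<mu> = sets borel \<and>
     (\<exists>N::nat. (\<integral>\<^sup>+ x. ennreal (1 / (1 + (norm x)\<^sup>2) ^ N) \<partial>\<mu>) < \<infinity>)"

definition even_measure :: "'a::euclidean_space measure \<Rightarrow> bool" where
  "even_measure \<mu> \<longleftrightarrow> distr \<mu> borel uminus = \<mu>"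

definition spectral_measure :: "'a::euclidean_space measure \<Rightarrow> bool" where
  "spectral_measure \<mu> \<longleftrightarrow> slow_growing \<mu> \<and> even_measure \<mu>"

definition measure_distribution :: "'a::euclidean_space measure \<Rightarrow> 'a distribution" where
  "measure_distribution \<mu> = (\<lambda>f. LINT x|\<mu>. f x)"


section \<open>Square-integrable random variables\<close>

definition square_integrable :: "'w measure \<Rightarrow> ('w \<Rightarrow> complex) \<Rightarrow> bool" where
  "square_integrable P Y \<longleftrightarrow>
     Y \<in> borel_measurable P \<and> integrable P (\<lambda>\<omega>. (cmod (Y \<omega>))\<^sup>2)"

definition l2_norm :: "'w measure \<Rightarrow> ('w \<Rightarrow> complex) \<Rightarrow> real" where
  "l2_norm P Y = sqrt (LINT \<omega>|P. (cmod (Y \<omega>))\<^sup>2)"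

text \<open>Random variables are not quotiented by almost sure equality, so this topology is only
  pseudometrizable; almost surely equal variables are topologically indistinguishable.\<close>

definition l2_topology :: "'w measure \<Rightarrow> ('w \<Rightarrow> complex) topology" where
  "l2_topology P = topology_generated_by
     {{Y. square_integrable P Y \<and> l2_norm P (\<lambda>\<omega>. Y \<omega> - Y0 \<omega>) < e} | Y0 e.
        square_integrable P Y0 \<and> e > 0}"


section \<open>Generalized random fields\<close>

type_synonym ('a, 'w) random_field = "('a \<Rightarrow> complex) \<Rightarrow> 'w \<Rightarrow> complex"

text \<open>A sample space large enough for all generalized random fields over \<^typ>\<open>'a\<close>: a field
  \<open>Z\<close> over an arbitrary probability space is carried to it, with the same joint distributions,
  by \<open>\<omega> \<mapsto> (\<phi> \<mapsto> Z \<phi> \<omega>)\<close>. Existence of a field on some probability space can therefore be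
  expressed as existence on this type.\<close>

type_synonym 'a path = "('a \<Rightarrow> complex) \<Rightarrow> complex"

definition gerf :: "'w measure \<Rightarrow> ('a::euclidean_space, 'w) random_field \<Rightarrow> bool" where
  "gerf P Z \<longleftrightarrow> prob_space P \<and>
     (\<forall>f\<in>schwartz. \<forall>h\<in>schwartz. \<forall>a b.
        AE \<omega> in P. Z (\<lambda>x. a * f x + b * h x) \<omega> = a * Z f \<omega> + b * Z h \<omega>) \<and>
     continuous_map schwartz_topology (l2_topology P) Z \<and>
     (\<forall>f\<in>schwartz. (LINT \<omega>|P. Z f \<omega>) = 0)"

definition real_gerf :: "'w measure \<Rightarrow> ('a::euclidean_space, 'w) random_field \<Rightarrow> bool" where
  "real_gerf P Z \<longleftrightarrow> gerf P Z \<and>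
     (\<forall>f\<in>schwartz. (\<forall>x. f x \<in> \<real>) \<longrightarrow> (AE \<omega> in P. Z f \<omega> \<in> \<real>))"

definition has_covariance_distribution ::
  "'w measure \<Rightarrow> ('a::euclidean_space, 'w) random_field \<Rightarrow> ('a \<times> 'a) distribution \<Rightarrow> bool" where
  "has_covariance_distribution P Z C \<longleftrightarrow> gerf P Z \<and> tempered C \<and>
     (\<forall>f\<in>schwartz. \<forall>h\<in>schwartz.
        (LINT \<omega>|P. Z f \<omega> * cnj (Z h \<omega>)) = C (tensor f (\<lambda>x. cnj (h x))))"

definition second_order_eq ::
  "'w measure \<Rightarrow> ('a::euclidean_space, 'w) random_field \<Rightarrow>
   'v measure \<Rightarrow> ('a, 'v) random_field \<Rightarrow> bool" where
  "second_order_eq P Z Q W \<longleftrightarrow>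
     (\<exists>C. has_covariance_distribution P Z C \<and> has_covariance_distribution Q W C)"

definition has_stationary_covariance ::
  "'w measure \<Rightarrow> ('a::euclidean_space, 'w) random_field \<Rightarrow> 'a distribution \<Rightarrow> bool" where
  "has_stationary_covariance P Z \<rho> \<longleftrightarrow>
     tempered \<rho> \<and> real_valued_distribution \<rho> \<and> even_distribution \<rho> \<and>
     (\<exists>C. has_covariance_distribution P Z C \<and>
        (\<forall>f\<in>schwartz. \<forall>h\<in>schwartz.
           C (tensor f (\<lambda>x. cnj (h x))) = \<rho> (convolve f (reflect (\<lambda>x. cnj (h x))))))"

definition real_stationary_gerf ::
  "'w measure \<Rightarrow> ('a::euclidean_space, 'w) random_field \<Rightarrow> bool" where
  "real_stationary_gerf P Z \<longleftrightarrow> real_gerf P Z \<and> (\<exists>\<rho>. has_stationary_covariance P Z \<rho>)"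

definition has_spectral_measure ::
  "'w measure \<Rightarrow> ('a::euclidean_space, 'w) random_field \<Rightarrow> 'a measure \<Rightarrow> bool" where
  "has_spectral_measure P Z \<mu> \<longleftrightarrow> spectral_measure \<mu> \<and>
     (\<exists>\<rho>. has_stationary_covariance P Z \<rho> \<and>
        (\<forall>f\<in>schwartz. \<rho> f = fourier_distribution (measure_distribution \<mu>) f))"


section \<open>Operators defined by a symbol\<close>

definition symbol_function :: "('a::euclidean_space \<Rightarrow> complex) \<Rightarrow> bool" where
  "symbol_function g \<longleftrightarrow> continuous_on UNIV g \<and>
     (\<exists>C k. \<forall>x. cmod (g x) \<le> C * (1 + (norm x)\<^sup>2) ^ (k::nat)) \<and>
     (\<forall>x. g x = cnj (g (- x)))"

definition fourier_field :: "('a::euclidean_space, 'w) random_field \<Rightarrow> ('a, 'w) random_field" where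
  "fourier_field Z = (\<lambda>f. Z (fourier f))"

definition fourier_inv_field ::
  "('a::euclidean_space, 'w) random_field \<Rightarrow> ('a, 'w) random_field" where
  "fourier_inv_field Z = (\<lambda>f. Z (fourier_inv f))"

definition rapid_limit :: "(nat \<Rightarrow> 'a::euclidean_space \<Rightarrow> complex) \<Rightarrow> ('a \<Rightarrow> complex) \<Rightarrow> bool" where
  "rapid_limit F f \<longleftrightarrow> (\<forall>k::nat. uniform_limit UNIV
     (\<lambda>n x. (1 + (norm x)\<^sup>2) ^ k *\<^sub>R F n x) (\<lambda>x. (1 + (norm x)\<^sup>2) ^ k *\<^sub>R f x) sequentially)"

text \<open>The value of a field at a continuous rapidly decreasing function, as the \<open>L\<^sup>2\<close>-limit along
  approximating Schwartz functions. The choice operator selects a version of this limit.\<close>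

definition extend_field ::
  "'w measure \<Rightarrow> ('a::euclidean_space, 'w) random_field \<Rightarrow> ('a, 'w) random_field" where
  "extend_field P M = (\<lambda>f. SOME Y. square_integrable P Y \<and>
     (\<forall>F. (\<forall>n. F n \<in> schwartz) \<and> rapid_limit F f \<longrightarrow>
        (\<lambda>n. l2_norm P (\<lambda>\<omega>. M (F n) \<omega> - Y \<omega>)) \<longlonglongrightarrow> 0))"

definition mult_field ::
  "'w measure \<Rightarrow> ('a::euclidean_space \<Rightarrow> complex) \<Rightarrow> ('a, 'w) random_field \<Rightarrow> ('a, 'w) random_field"
  where "mult_field P g M = (\<lambda>f. extend_field P M (\<lambda>x. g x * f x))"

definition symbol_operator ::
  "'w measure \<Rightarrow> ('a::euclidean_space \<Rightarrow> complex) \<Rightarrow> ('a, 'w) random_field \<Rightarrow> ('a, 'w) random_field"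
  where "symbol_operator P g U = fourier_inv_field (mult_field P g (fourier_field U))"

text \<open>In \<^typ>\<open>ennreal\<close>, \<open>inverse 0 = \<infinity>\<close>.\<close>

definition divide_measure ::
  "'a::euclidean_space measure \<Rightarrow> ('a \<Rightarrow> complex) \<Rightarrow> 'a measure" where
  "divide_measure \<mu> g = density \<mu> (\<lambda>\<xi>. inverse (ennreal ((cmod (g \<xi>))\<^sup>2)))"

definition symbol_integrable :: "'a::euclidean_space measure \<Rightarrow> ('a \<Rightarrow> complex) \<Rightarrow> bool" where
  "symbol_integrable \<mu> g \<longleftrightarrow>
     (\<exists>N::nat. (\<integral>\<^sup>+ \<xi>. inverse (ennreal ((cmod (g \<xi>))\<^sup>2 * (1 + (norm \<xi>)\<^sup>2) ^ N)) \<partial>\<mu>) < \<infinity>)"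

end

theory Submission
  imports Defs
begin

text \<open>For a real stationary field \<open>U\<close>, \<open>E|\<F>(U)(f)|\<^sup>2 = T(|f|\<^sup>2)\<close> with \<open>T\<close> tempered and non-negative on squares,
  hence of order zero. This gives the extension of \<open>\<F>(U)\<close> to continuous rapidly decreasing functions and,
  if \<open>U\<close> solves the equation, the inequality \<open>\<integral>|\<psi>|\<^sup>2 d\<mu>\<^sub>X \<le> K sup (1 + |x|\<^sup>2)\<^sup>2\<^sup>N |g \<psi>|\<^sup>2\<close>. Inserting regularizations
  of \<open>\<psi> = |g|\<^sup>-\<^sup>1 (1 + |x|\<^sup>2)\<^sup>-\<^sup>N\<close> and applying Fatou's lemma yields the integrability condition, without
  a spectral representation of \<open>U\<close>. Conversely, a field with spectral measure \<open>|g|\<^sup>-\<^sup>2 \<mu>\<^sub>X\<close> is realized as a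
  random plane wave, and its covariance is computed through \<open>L\<^sup>2\<close>-limits. Non-uniqueness for vanishing \<open>g\<close>
  comes from adding a Dirac mass at a zero.\<close>

section \<open>Families of functions with polynomially weighted derivative bounds\<close>

text \<open>The definition of a stationary field supplies a tempered \<open>\<rho>\<close>, not a
  measure, so for an unknown solution there is no spectral integral to compute with. Its substitute
  is the estimate \<open>l2_norm P (M f) \<le> K * s\<close> whenever \<open>jap ^ N * |f|\<close>
  stays below \<open>s\<close>. It makes the L2 limits behind \<open>extend_field\<close> exist,
  passes to the extended field, and becomes an inequality for \<open>\<mu>\<^sub>X\<close> once the
  covariances of both sides are equated. The exponent \<open>2 * N\<close> in the final integral is
  this \<open>N\<close>, doubled because the test function is squared. The constant
  \<open>spconst\<close> is the (2 pi)^(d/2) that the convolution theorem produces under the unitary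
  normalization of the transform. Values of \<open>extend_field\<close> come from a choice and are
  known only up to null sets; hence the detour through \<open>l2_limit\<close> and almost sure
  statements. Both topologies are given by generating sets. Continuity is therefore first turned
  into inequalities between the norms \<open>gauge_norm\<close>, and all analysis happens there.
  Second order equality leaves the law of the field free, so one random frequency and one random
  phase suffice for existence.\<close>

definition jap :: "'a::euclidean_space \<Rightarrow> real" where
  "jap x = 1 + (norm x)\<^sup>2"

lemma jap_ge_1: "1 \<le> jap x"
  by (simp add: jap_def)

lemma jap_pos: "0 < jap x"
  using jap_ge_1[of x] by linarith

lemma jap_powr_mono: "v \<le> w \<Longrightarrow> jap x powr v \<le> jap x powr w"
  using jap_ge_1 by (intro powr_mono)

lemma jap_powr_minus_nat: "jap x powr (- real k) = 1 / jap x ^ k"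
  using jap_pos[of x] by (simp add: powr_minus powr_realpow divide_inverse)

lemma jap_minus: "jap (- x) = jap x"
  by (simp add: jap_def)

text \<open>\<open>jap\<close> is the square of the usual Japanese bracket, so polynomial degree m
  costs exponent m/2. A coordinate thus has weight 1/2, and the exponent
  \<open>- real DIM('a)\<close> means decay of order twice the dimension, which is
  integrable.\<close>

lemma norm_le_jap: "norm x \<le> jap x powr (1/2)"
proof -
  have "jap x powr (1/2) = sqrt (jap x)"
    using jap_pos[of x] by (simp add: powr_half_sqrt)
  then show ?thesis
    by (simp add: jap_def real_le_rsqrt)
qed

lemma continuous_jap [continuous_intros]: "continuous_on S jap"
  unfolding jap_def by (intro continuous_intros)

lemma borel_jap [measurable]: "jap \<in> borel_measurable borel"
  by (intro borel_measurable_continuous_onI continuous_jap)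

text \<open>Bounds are stated for families: one calculus then gives both membership in the Schwartz space
  and seminorm estimates uniform in a parameter.\<close>

primrec dbound :: "nat \<Rightarrow> 'i set \<Rightarrow> real \<Rightarrow> ('i \<Rightarrow> 'a::euclidean_space \<Rightarrow> complex) \<Rightarrow> bool" where
  "dbound 0 I w F \<longleftrightarrow> (\<exists>C. \<forall>i\<in>I. \<forall>x. cmod (F i x) \<le> C * jap x powr w)"
| "dbound (Suc n) I w F \<longleftrightarrow> (\<exists>C. \<forall>i\<in>I. \<forall>x. cmod (F i x) \<le> C * jap x powr w) \<and>
     (\<forall>i\<in>I. \<forall>x. F i differentiable (at x)) \<and>
     (\<forall>b\<in>Basis. dbound n I w (\<lambda>i x. frechet_derivative (F i) (at x) b))"

abbreviation pdbound :: "nat \<Rightarrow> 'i set \<Rightarrow> ('i \<Rightarrow> 'a::euclidean_space \<Rightarrow> complex) \<Rightarrow> bool" where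
  "pdbound n I F \<equiv> \<exists>w. dbound n I w F"

lemma dbound_0: "dbound n I w F \<Longrightarrow> dbound 0 I w F"
  by (cases n) auto

lemma dbound_E:
  assumes "dbound n I w F"
  obtains C where "C > 0" "\<And>i x. i \<in> I \<Longrightarrow> cmod (F i x) \<le> C * jap x powr w"
proof -
  obtain C where C: "\<And>i x. i \<in> I \<Longrightarrow> cmod (F i x) \<le> C * jap x powr w"
    using dbound_0[OF assms] by auto
  show ?thesis
  proof (rule that[of "\<bar>C\<bar> + 1"])
    show "cmod (F i x) \<le> (\<bar>C\<bar> + 1) * jap x powr w" if "i \<in> I" for i x
      using C[OF that, of x] by (rule order_trans) (intro mult_right_mono, auto)
  qed auto
qed

lemma dbound_cong:
  "(\<And>i. i \<in> I \<Longrightarrow> F i = G i) \<Longrightarrow> dbound n I w F \<longleftrightarrow> dbound n I w G"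
proof (induction n arbitrary: F G)
  case 0
  then show ?case by simp
next
  case (Suc n)
  have "dbound n I w (\<lambda>i x. frechet_derivative (F i) (at x) b)
      = dbound n I w (\<lambda>i x. frechet_derivative (G i) (at x) b)" for b
    using Suc.prems by (intro Suc.IH) simp
  with Suc.prems show ?case by simp
qed

lemma dbound_weaken: "dbound n I v F \<Longrightarrow> v \<le> w \<Longrightarrow> dbound n I w F"
proof (induction n arbitrary: F)
  have base: "\<exists>C. \<forall>i\<in>I. \<forall>x. cmod (F i x) \<le> C * jap x powr w" if "dbound n I v F" "v \<le> w" for n F
  proof -
    obtain C where C: "C > 0" "\<And>i x. i \<in> I \<Longrightarrow> cmod (F i x) \<le> C * jap x powr v"
      using \<open>dbound n I v F\<close> dbound_E by blast
    have "cmod (F i x) \<le> C * jap x powr w" if "i \<in> I" for i x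
      using C(2)[OF that, of x] jap_powr_mono[OF \<open>v \<le> w\<close>, of x] C(1)
      by (meson mult_left_mono order.trans less_imp_le)
    then show ?thesis by auto
  qed
  {
    case 0
    then show ?case using base[OF 0] by simp
  next
    case (Suc n)
    then show ?case using base[OF Suc.prems] by auto
  }
qed

lemma dbound_Suc_D: "dbound (Suc n) I w F \<Longrightarrow> dbound n I w F"
  by (induction n arbitrary: F) auto

lemma dbound_reindex: "dbound n I w F \<Longrightarrow> (\<And>j. j \<in> J \<Longrightarrow> g j \<in> I) \<Longrightarrow> dbound n J w (\<lambda>j. F (g j))"
proof (induction n arbitrary: F)
  case 0
  then show ?case by auto
next
  case (Suc n)
  from Suc.prems(1) have "dbound n J w (\<lambda>j x. frechet_derivative (F (g j)) (at x) b)" if "b \<in> Basis" for b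
    using Suc.IH[of "\<lambda>i x. frechet_derivative (F i) (at x) b"] Suc.prems(2) that by auto
  moreover obtain C where "\<And>i x. i \<in> I \<Longrightarrow> cmod (F i x) \<le> C * jap x powr w"
    using Suc.prems(1) dbound_E by blast
  ultimately show ?case using Suc.prems by (auto intro!: exI[of _ C])
qed

text \<open>By uniqueness of the derivative, any explicit derivative \<open>D\<close> may stand in
  for the chosen \<open>frechet_derivative\<close> of the recursion.\<close>

lemma dbound_SucI:
  assumes "dbound 0 I w F"
    and D: "\<And>i x. i \<in> I \<Longrightarrow> (F i has_derivative D i x) (at x)"
    and "\<And>b. b \<in> Basis \<Longrightarrow> dbound n I w (\<lambda>i x. D i x b)"
  shows "dbound (Suc n) I w F"
proof -
  have eq: "frechet_derivative (F i) (at x) = D i x" if "i \<in> I" for i x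
    using D[OF that, of x] by (metis frechet_derivative_at)
  have "dbound n I w (\<lambda>i x. frechet_derivative (F i) (at x) b)" if "b \<in> Basis" for b
    using assms(3)[OF that] by (subst dbound_cong[where G="\<lambda>i x. D i x b"]) (simp_all add: eq)
  then show ?thesis
    using assms(1) D by (auto simp: differentiable_def)
qed

lemma dbound_SucD:
  assumes "dbound (Suc n) I w F"
  shows "\<And>i x. i \<in> I \<Longrightarrow> (F i has_derivative frechet_derivative (F i) (at x)) (at x)"
    and "\<And>b. b \<in> Basis \<Longrightarrow> dbound n I w (\<lambda>i x. frechet_derivative (F i) (at x) b)"
  using assms by (auto simp: frechet_derivative_works)

section \<open>Algebra of weighted derivative bounds\<close>

lemma dbound_add:
  "dbound n I w F \<Longrightarrow> dbound n I w G \<Longrightarrow> dbound n I w (\<lambda>i x. F i x + G i x)"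
proof (induction n arbitrary: F G)
  have base: "dbound 0 I w (\<lambda>i x. F i x + G i x)" if "dbound n I w F" "dbound n I w G" for n F G
  proof -
    obtain C where C: "\<And>i x. i \<in> I \<Longrightarrow> cmod (F i x) \<le> C * jap x powr w"
      using \<open>dbound n I w F\<close> dbound_E by blast
    obtain D where D: "\<And>i x. i \<in> I \<Longrightarrow> cmod (G i x) \<le> D * jap x powr w"
      using \<open>dbound n I w G\<close> dbound_E by blast
    have "cmod (F i x + G i x) \<le> (C + D) * jap x powr w" if "i \<in> I" for i x
      using C[OF that, of x] D[OF that, of x] norm_triangle_ineq[of "F i x" "G i x"]
      by (simp add: algebra_simps)
    then show ?thesis by auto
  qed
  {
    case 0
    then show ?case by (rule base)
  next
    case (Suc n)
    show ?case
      by (rule dbound_SucI[OF base[OF Suc.prems], where D="\<lambda>i x h. frechet_derivative (F i) (at x) h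
            + frechet_derivative (G i) (at x) h"])
         (auto intro!: has_derivative_add dbound_SucD Suc.IH Suc.prems)
  }
qed

text \<open>Derivatives carry the same weight as the function, so both terms of the product rule
  have weight \<open>v + w\<close> again and the induction closes.\<close>

lemma dbound_mult:
  "dbound n I v F \<Longrightarrow> dbound n I w G \<Longrightarrow> dbound n I (v + w) (\<lambda>i x. F i x * G i x)"
proof (induction n arbitrary: F G)
  have base: "dbound 0 I (v + w) (\<lambda>i x. F i x * G i x)" if "dbound n I v F" "dbound n I w G" for n F G
  proof -
    obtain C where C: "C > 0" "\<And>i x. i \<in> I \<Longrightarrow> cmod (F i x) \<le> C * jap x powr v"
      using \<open>dbound n I v F\<close> dbound_E by blast
    obtain D where D: "D > 0" "\<And>i x. i \<in> I \<Longrightarrow> cmod (G i x) \<le> D * jap x powr w"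
      using \<open>dbound n I w G\<close> dbound_E by blast
    have "cmod (F i x * G i x) \<le> (C * D) * jap x powr (v + w)" if "i \<in> I" for i x
    proof -
      have "cmod (F i x) * cmod (G i x) \<le> (C * jap x powr v) * (D * jap x powr w)"
        using C D that by (intro mult_mono) auto
      then show ?thesis by (simp add: norm_mult powr_add mult_ac)
    qed
    then show ?thesis by auto
  qed
  {
    case 0
    then show ?case by (rule base)
  next
    case (Suc n)
    show ?case
      by (rule dbound_SucI[OF base[OF Suc.prems], where D="\<lambda>i x h. F i x * frechet_derivative (G i) (at x) h
            + frechet_derivative (F i) (at x) h * G i x"])
         (auto intro!: has_derivative_mult dbound_SucD dbound_add Suc.IH Suc.prems dbound_Suc_D[OF Suc.prems(1)] dbound_Suc_D[OF Suc.prems(2)])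
  }
qed

lemma dbound_coeff:
  assumes "\<And>i. i \<in> I \<Longrightarrow> cmod (c i) \<le> C"
  shows "dbound n I 0 (\<lambda>i x. c i)"
  using assms
proof (induction n arbitrary: c C)
  case 0
  then show ?case using jap_pos[THEN less_imp_neq] by (auto intro!: exI[of _ C])
next
  case (Suc n)
  have "dbound 0 I 0 (\<lambda>i x::'b. c i)"
    using Suc.prems by (auto intro!: exI[of _ C] simp: jap_pos[THEN less_imp_neq, symmetric])
  then show ?case
    by (rule dbound_SucI[where D="\<lambda>i x h. 0"]) (auto intro!: Suc.IH[of _ 0])
qed

lemma dbound_const: "dbound n I 0 (\<lambda>i x. c)"
  by (rule dbound_coeff[of _ _ "cmod c"]) simp

lemma dbound_cmult: "dbound n I w F \<Longrightarrow> dbound n I w (\<lambda>i x. c * F i x)"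
  using dbound_mult[OF dbound_const, of n I w F c] by simp

lemma dbound_uminus: "dbound n I w F \<Longrightarrow> dbound n I w (\<lambda>i x. - F i x)"
  using dbound_cmult[of n I w F "-1"] by simp

lemma dbound_diff:
  "dbound n I w F \<Longrightarrow> dbound n I w G \<Longrightarrow> dbound n I w (\<lambda>i x. F i x - G i x)"
  using dbound_add[OF _ dbound_uminus, of n I w F G] by simp

lemma has_derivative_coord:
  "((\<lambda>x::'a::euclidean_space. complex_of_real (x \<bullet> b)) has_derivative (\<lambda>h. complex_of_real (h \<bullet> b))) (at x)"
  by (intro has_derivative_of_real) (auto intro!: derivative_eq_intros)

lemma dbound_coord:
  assumes "b \<in> Basis"
  shows "dbound n I (1/2) (\<lambda>i x. complex_of_real (x \<bullet> b))"
proof -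
  have 0: "dbound 0 I (1/2) (\<lambda>i x. complex_of_real (x \<bullet> b))"
  proof -
    have "\<bar>x \<bullet> b\<bar> \<le> 1 * jap x powr (1/2)" for x
      using Basis_le_norm[OF assms, of x] norm_le_jap[of x] by linarith
    then show ?thesis by (auto intro!: exI[of _ 1])
  qed
  show ?thesis
  proof (cases n)
    case (Suc m)
    show ?thesis unfolding Suc using 0
      by (rule dbound_SucI[where D="\<lambda>i x h. complex_of_real (h \<bullet> b)"])
         (auto intro!: has_derivative_coord dbound_weaken[OF dbound_const])
  qed (use 0 in simp)
qed

lemma jap_has_derivative:
  "(jap has_derivative (\<lambda>h. 2 * (x \<bullet> h))) (at x)"
  unfolding jap_def power2_norm_eq_inner
  by (auto intro!: derivative_eq_intros simp: inner_commute)

text \<open>A derivative lowers the exponent by 1 and produces a coordinate of weight 1/2. The gain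
  of 1/2 is given away, so that one weight \<open>s\<close> serves all levels.\<close>

lemma dbound_jap_powr: "dbound n I s (\<lambda>i x. complex_of_real (jap x powr s))"
proof (induction n arbitrary: s)
  case 0
  show ?case by (auto intro!: exI[of _ 1])
next
  case (Suc n)
  have "dbound 0 I s (\<lambda>i x. complex_of_real (jap x powr s))"
    by (auto intro!: exI[of _ 1])
  then show ?case
  proof (rule dbound_SucI[where D="\<lambda>i x h. complex_of_real (s * jap x powr (s - 1) * (2 * (x \<bullet> h)))"])
    show "((\<lambda>x. complex_of_real (jap x powr s)) has_derivative
        (\<lambda>h. complex_of_real (s * jap x powr (s - 1) * (2 * (x \<bullet> h))))) (at x)" for x :: 'b
      using jap_pos[of x]
      by (intro has_derivative_of_real) (auto intro!: derivative_eq_intros jap_has_derivative simp: powr_diff field_simps)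
    show "dbound n I s (\<lambda>i x. complex_of_real (s * jap x powr (s - 1) * (2 * (x \<bullet> b))))"
      if "b \<in> Basis" for b :: 'b
    proof -
      have "dbound n I (s - 1 + 1/2) (\<lambda>i x. complex_of_real (2 * s) *
          (complex_of_real (jap x powr (s - 1)) * complex_of_real (x \<bullet> b)))"
        by (intro dbound_cmult dbound_mult Suc dbound_coord that)
      then have "dbound n I s (\<lambda>i x. complex_of_real (2 * s) *
          (complex_of_real (jap x powr (s - 1)) * complex_of_real (x \<bullet> b)))"
        by (rule dbound_weaken) simp
      then show ?thesis
        by (simp add: mult_ac)
    qed
  qed
qed

section \<open>Bounds of unspecified weight, reciprocal roots and Gaussians\<close>

lemma pdbound_add:
  assumes "pdbound n I F" "pdbound n I G"
  shows "pdbound n I (\<lambda>i x. F i x + G i x)"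
proof -
  obtain v w where "dbound n I v F" "dbound n I w G" using assms by blast
  then have "dbound n I (max v w) F" "dbound n I (max v w) G"
    by (auto elim: dbound_weaken)
  then show ?thesis using dbound_add by blast
qed

lemma pdbound_mult:
  assumes "pdbound n I F" "pdbound n I G"
  shows "pdbound n I (\<lambda>i x. F i x * G i x)"
  using assms dbound_mult by blast

lemma pdbound_cmult: "pdbound n I F \<Longrightarrow> pdbound n I (\<lambda>i x. c * F i x)"
  using dbound_cmult by blast

text \<open>Each partial derivative may bring its own weight. The basis is finite, so the largest
  weight serves all of them.\<close>

lemma pdbound_SucI:
  assumes "pdbound 0 I F"
    and D: "\<And>i x. i \<in> I \<Longrightarrow> (F i has_derivative D i x) (at x)"
    and "\<And>b. b \<in> Basis \<Longrightarrow> pdbound n I (\<lambda>i x. D i x b)"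
  shows "pdbound (Suc n) I F"
proof -
  obtain w0 where w0: "dbound 0 I w0 F" using assms(1) by blast
  obtain w where w: "\<And>b. b \<in> Basis \<Longrightarrow> dbound n I (w b) (\<lambda>i x. D i x b)"
    using assms(3) by metis
  define W where "W = Max (insert w0 (w ` Basis))"
  have W: "w0 \<le> W" "\<And>b. b \<in> Basis \<Longrightarrow> w b \<le> W"
    unfolding W_def by (rule Max_ge; simp)+
  have "dbound (Suc n) I W F"
    by (rule dbound_SucI[OF dbound_weaken[OF w0 W(1)] D dbound_weaken[OF w W(2)]])
  then show ?thesis by blast
qed

lemma frechet_derivative_of_real:
  fixes h :: "'a::euclidean_space \<Rightarrow> real"
  assumes "(\<lambda>x. complex_of_real (h x)) differentiable (at x)"
  shows "(h has_derivative frechet_derivative h (at x)) (at x)"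
    and "frechet_derivative (\<lambda>x. complex_of_real (h x)) (at x) v
      = complex_of_real (frechet_derivative h (at x) v)"
proof -
  have "(\<lambda>x. Re (complex_of_real (h x))) differentiable (at x)"
    using assms has_derivative_Re unfolding differentiable_def by blast
  then show 1: "(h has_derivative frechet_derivative h (at x)) (at x)"
    by (simp add: frechet_derivative_works)
  show "frechet_derivative (\<lambda>x. complex_of_real (h x)) (at x) v
      = complex_of_real (frechet_derivative h (at x) v)"
    using frechet_derivative_at[OF has_derivative_of_real[OF 1, where 'a=complex]] by metis
qed

text \<open>Write r for the reciprocal root. Its derivative is -1/2 h' r^3, a product of r and a
  derivative of h, so the induction closes on r itself; the lower bound on h gives level 0. The root
  of h is recovered later as h times r.\<close>

lemma pdbound_rsqrt:
  fixes h :: "'i \<Rightarrow> 'a::euclidean_space \<Rightarrow> real"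
  assumes h: "\<And>n. pdbound n I (\<lambda>i x. complex_of_real (h i x))"
    and "c > 0" and lower: "\<And>i x. i \<in> I \<Longrightarrow> c * jap x powr m \<le> h i x"
  shows "pdbound n I (\<lambda>i x. complex_of_real (1 / sqrt (h i x)))"
proof (induction n)
  have pos: "h i x > 0" if "i \<in> I" for i x
    using lower[OF that, of x] \<open>c > 0\<close> jap_pos[of x]
    by (smt (verit) mult_pos_pos powr_gt_zero)
  have "1 / sqrt (h i x) \<le> (1 / sqrt c) * jap x powr (- m / 2)" if "i \<in> I" for i x
  proof -
    have "sqrt (c * jap x powr m) \<le> sqrt (h i x)"
      using lower[OF that] by simp
    moreover have "sqrt (c * jap x powr m) = sqrt c * jap x powr (m / 2)"
      using jap_pos[of x] by (simp add: real_sqrt_mult powr_half_sqrt_powr)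
    moreover have "sqrt c * jap x powr (m / 2) > 0"
      using \<open>c > 0\<close> jap_pos[of x] by simp
    ultimately have "1 / sqrt (h i x) \<le> 1 / (sqrt c * jap x powr (m / 2))"
      by (intro divide_left_mono mult_pos_pos) (auto simp: pos[OF that] \<open>c > 0\<close>)
    then show ?thesis by (simp add: powr_minus field_simps)
  qed
  then have 0: "dbound 0 I (- m / 2) (\<lambda>i x. complex_of_real (1 / sqrt (h i x)))"
    using pos by (auto intro!: exI[of _ "1 / sqrt c"] simp: norm_divide less_imp_le abs_of_pos)
  then show "pdbound 0 I (\<lambda>i x. complex_of_real (1 / sqrt (h i x)))"
    by blast
  fix n
  assume IH: "pdbound n I (\<lambda>i x. complex_of_real (1 / sqrt (h i x)))" (is "pdbound n I ?r")
  have diff: "(\<lambda>x. complex_of_real (h i x)) differentiable (at x)" if "i \<in> I" for i x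
    using h[of "Suc 0"] that by auto
  show "pdbound (Suc n) I (\<lambda>i x. complex_of_real (1 / sqrt (h i x)))"
  proof (rule pdbound_SucI[where D="\<lambda>i x v. - (1/2) * (complex_of_real (frechet_derivative (h i) (at x) v)
        * (?r i x * (?r i x * ?r i x)))"])
    show "pdbound 0 I ?r" using 0 by blast
    show "(?r i has_derivative (\<lambda>v. - (1/2) * (complex_of_real (frechet_derivative (h i) (at x) v)
        * (?r i x * (?r i x * ?r i x))))) (at x)" if "i \<in> I" for i x
    proof -
      have "((\<lambda>x. 1 / sqrt (h i x)) has_derivative (\<lambda>v. - (1/2) * (frechet_derivative (h i) (at x) v
        * ((1 / sqrt (h i x)) * ((1 / sqrt (h i x)) * (1 / sqrt (h i x))))))) (at x)"
        using pos[OF that, of x]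
        by (auto intro!: derivative_eq_intros frechet_derivative_of_real(1)[OF diff[OF that]]
            simp: field_simps)
      from has_derivative_of_real[OF this, where 'a=complex] show ?thesis
        by (simp only: of_real_mult of_real_minus of_real_divide of_real_1 of_real_numeral)
    qed
    show "pdbound n I (\<lambda>i x. - (1/2) * (complex_of_real (frechet_derivative (h i) (at x) b)
        * (?r i x * (?r i x * ?r i x))))" if "b \<in> Basis" for b
    proof (intro pdbound_cmult pdbound_mult IH)
      obtain w where "dbound (Suc n) I w (\<lambda>i x. complex_of_real (h i x))"
        using h by blast
      from dbound_SucD(2)[OF this that]
      have "dbound n I w (\<lambda>i x. frechet_derivative (\<lambda>x. complex_of_real (h i x)) (at x) b)" .
      then show "pdbound n I (\<lambda>i x. complex_of_real (frechet_derivative (h i) (at x) b))"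
        by (subst (asm) dbound_cong[where G="\<lambda>i x. complex_of_real (frechet_derivative (h i) (at x) b)"])
           (auto simp: frechet_derivative_of_real(2)[OF diff])
    qed
  qed
qed

lemma gauss_has_derivative:
  fixes x :: "'a::euclidean_space"
  shows "((\<lambda>x. complex_of_real (exp (- d * (norm x)\<^sup>2))) has_derivative
     (\<lambda>v. complex_of_real (- 2 * d) * (complex_of_real (x \<bullet> v) * complex_of_real (exp (- d * (norm x)\<^sup>2))))) (at x)"
proof -
  have "((\<lambda>x. exp (- d * (norm x)\<^sup>2)) has_derivative
     (\<lambda>v. - 2 * d * ((x \<bullet> v) * exp (- d * (norm x)\<^sup>2)))) (at x)"
    unfolding power2_norm_eq_inner
    by (auto intro!: derivative_eq_intros simp: inner_commute algebra_simps)
  from has_derivative_of_real[OF this, where 'a=complex] show ?thesis by simp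
qed

lemma pdbound_coord: "b \<in> Basis \<Longrightarrow> pdbound n I (\<lambda>i x. complex_of_real (x \<bullet> b))"
  using dbound_coord by blast

text \<open>The bounds are uniform in the parameter down to 0, where the Gaussian ceases to decay;
  each derivative brings a coordinate, so the weight may grow with the level. For a fixed positive
  parameter \<open>dbound_gauss\<close> gives arbitrary decay, but with constants that depend on
  it.\<close>

lemma pdbound_gauss:
  assumes "\<And>i. i \<in> I \<Longrightarrow> 0 \<le> d i \<and> d i \<le> 1"
  shows "pdbound n I (\<lambda>i x. complex_of_real (exp (- d i * (norm x)\<^sup>2)))"
proof (induction n)
  have "dbound 0 I 0 (\<lambda>i x::'b. complex_of_real (exp (- d i * (norm x)\<^sup>2)))"
    using assms by (auto intro!: exI[of _ 1] simp: jap_pos[THEN less_imp_neq, symmetric])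
  then show 0: "pdbound 0 I (\<lambda>i x::'b. complex_of_real (exp (- d i * (norm x)\<^sup>2)))"
    by blast
  fix n
  assume IH: "pdbound n I (\<lambda>i x::'b. complex_of_real (exp (- d i * (norm x)\<^sup>2)))"
  have "pdbound n I (\<lambda>i x::'b. complex_of_real (- 2 * d i))"
    using dbound_coeff[of I "\<lambda>i. complex_of_real (- 2 * d i)" 2] assms by fastforce
  then show "pdbound (Suc n) I (\<lambda>i x::'b. complex_of_real (exp (- d i * (norm x)\<^sup>2)))"
    by (intro pdbound_SucI[OF 0 gauss_has_derivative] pdbound_mult pdbound_coord IH)
qed

text \<open>This is what allows Gaussian damping to be removed at rate d. By 1 - exp (-t) \<le> t
  the quotient is at most |x|^2, and differentiation cancels the denominator, leaving a coordinate
  times a Gaussian with bounds uniform in d.\<close>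

lemma pdbound_gauss_diff:
  assumes "\<And>i. i \<in> I \<Longrightarrow> 0 < d i \<and> d i \<le> 1"
  shows "pdbound n I (\<lambda>i x. complex_of_real ((1 - exp (- d i * (norm x)\<^sup>2)) / d i))"
proof -
  have "cmod (complex_of_real ((1 - exp (- d i * (norm x)\<^sup>2)) / d i)) \<le> 1 * jap x powr 1"
    if "i \<in> I" for i and x :: 'b
  proof -
    have "1 + (- d i * (norm x)\<^sup>2) \<le> exp (- d i * (norm x)\<^sup>2)"
      by (rule exp_ge_add_one_self)
    moreover have "exp (- d i * (norm x)\<^sup>2) \<le> 1"
      using assms[OF that] by simp
    ultimately have "\<bar>(1 - exp (- d i * (norm x)\<^sup>2)) / d i\<bar> \<le> (norm x)\<^sup>2"
      using assms[OF that] by (simp add: field_simps)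
    then show ?thesis
      using jap_pos[of x] by (simp only: norm_of_real) (simp add: jap_def)
  qed
  then have "dbound 0 I 1 (\<lambda>i x::'b. complex_of_real ((1 - exp (- d i * (norm x)\<^sup>2)) / d i))"
    unfolding dbound.simps by blast
  then have 0: "pdbound 0 I (\<lambda>i x::'b. complex_of_real ((1 - exp (- d i * (norm x)\<^sup>2)) / d i))"
    by blast
  show ?thesis
  proof (cases n)
    case (Suc m)
    have der: "((\<lambda>x. complex_of_real ((1 - exp (- d i * (norm x)\<^sup>2)) / d i)) has_derivative
      (\<lambda>v. 2 * (complex_of_real (x \<bullet> v) * complex_of_real (exp (- d i * (norm x)\<^sup>2))))) (at x)"
      if "i \<in> I" for i and x :: 'b
    proof -
      have "((\<lambda>x. (1 - exp (- d i * (norm x)\<^sup>2)) / d i) has_derivative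
         (\<lambda>v. 2 * ((x \<bullet> v) * exp (- d i * (norm x)\<^sup>2)))) (at x)"
        using assms[OF that] unfolding power2_norm_eq_inner
        by (auto intro!: derivative_eq_intros simp: inner_commute field_simps)
      from has_derivative_of_real[OF this, where 'a=complex] show ?thesis by simp
    qed
    have g: "pdbound m I (\<lambda>i x::'b. complex_of_real (exp (- d i * (norm x)\<^sup>2)))"
      using assms by (intro pdbound_gauss) (auto intro: less_imp_le)
    show ?thesis unfolding Suc
      by (rule pdbound_SucI[OF 0 der]) (assumption, intro pdbound_cmult pdbound_mult pdbound_coord g)
  qed (use 0 in simp)
qed

lemma gauss_decay:
  assumes "d > 0"
  obtains C where "C > 0" "\<And>x::'a::euclidean_space. exp (- d * (norm x)\<^sup>2) \<le> C * jap x powr w"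
proof -
  obtain k0 :: nat where k0: "- w \<le> real k0" using real_arch_simple by blast
  define k where "k = Suc k0"
  \<comment> \<open>With y = d jap x / k, the inequality y^k \<le> exp (k y) gives exp (- d jap x)
    \<le> (k / d)^k / jap x^k; the factor exp d changes |x|^2 into \<open>jap x\<close>. Taking
    \<open>k\<close> as a successor keeps the division by \<open>k\<close> meaningful.\<close>
  define A where "A = exp d * (real k / d) ^ k"
  have "A > 0" using assms by (simp add: A_def k_def)
  have "exp (- d * (norm x)\<^sup>2) \<le> A * jap x powr w" for x :: 'a
  proof -
    define y where "y = d * jap x / real k"
    have y: "y > 0" using assms jap_pos[of x] by (simp add: y_def k_def)
    have "y \<le> exp y" using exp_ge_add_one_self[of y] by linarith
    then have "y ^ k \<le> exp y ^ k"
      using y by (intro power_mono) auto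
    also have "exp y ^ k = exp (real k * y)"
      by (simp add: exp_of_nat_mult)
    also have "real k * y = d * jap x"
      by (simp add: y_def k_def)
    finally have "exp (- (d * jap x)) \<le> 1 / y ^ k"
      using y by (simp add: exp_minus field_simps)
    moreover have "exp (- d * (norm x)\<^sup>2) = exp d * exp (- (d * jap x))"
      by (simp add: jap_def exp_add[symmetric] algebra_simps)
    ultimately have "exp (- d * (norm x)\<^sup>2) \<le> exp d * (1 / y ^ k)"
      by (metis mult_left_mono exp_ge_zero)
    also have "\<dots> = A * jap x powr (- real k)"
      by (simp add: jap_powr_minus_nat power_mult_distrib A_def y_def power_divide)
    also have "\<dots> \<le> A * jap x powr w"
      using k0 \<open>A > 0\<close> by (intro mult_left_mono jap_powr_mono) (auto simp: k_def)
    finally show ?thesis .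
  qed
  with \<open>A > 0\<close> show ?thesis using that by blast
qed

text \<open>The weight is arbitrary in the induction: the coordinate produced by a derivative is
  absorbed by asking for weight \<open>w - 1/2\<close> one level below.\<close>

lemma dbound_gauss:
  assumes "d > 0"
  shows "dbound n I w (\<lambda>i x::'b::euclidean_space. complex_of_real (exp (- d * (norm x)\<^sup>2)))"
proof (induction n arbitrary: w)
  have base: "dbound 0 I w (\<lambda>i x::'b. complex_of_real (exp (- d * (norm x)\<^sup>2)))" for w
  proof -
    obtain C where "C > 0" "\<And>x::'b. exp (- d * (norm x)\<^sup>2) \<le> C * jap x powr w"
      using gauss_decay[OF assms] by blast
    then show ?thesis by (auto intro!: exI[of _ C])
  qed
  {
    case 0
    show ?case by (rule base)
  next
    case (Suc n)
    have "dbound n I (1/2 + (w - 1/2)) (\<lambda>i x::'b. complex_of_real (x \<bullet> b) * complex_of_real (exp (- d * (norm x)\<^sup>2)))"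
      if "b \<in> Basis" for b
      by (intro dbound_mult dbound_coord that Suc)
    then show ?case
      by (intro dbound_SucI[OF base gauss_has_derivative]) (rule dbound_cmult, simp)
  }
qed

text \<open>\<open>dbound\<close> differentiates the function and then recurses, while
  \<open>partial_derivs\<close> applies the head of its list last. Splitting off the last entry
  makes the two recursions agree.\<close>

lemma partial_derivs_snoc:
  "partial_derivs (bs @ [b]) f = partial_derivs bs (\<lambda>x. frechet_derivative f (at x) b)"
  by (induction bs) auto

text \<open>The bridge between the recursive bounds and the multi-indices of the seminorms.
  Differentiability is restricted to lists shorter than \<open>n\<close>, since level
  \<open>n\<close> bounds derivatives of order \<open>n\<close> without differentiating them
  again.\<close>

lemma dbound_iff_partial_derivs:
  "dbound n I w F \<longleftrightarrow> (\<forall>bs. set bs \<subseteq> Basis \<and> length bs \<le> n \<longrightarrow>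
      (\<exists>C. \<forall>i\<in>I. \<forall>x. cmod (partial_derivs bs (F i) x) \<le> C * jap x powr w) \<and>
      (length bs < n \<longrightarrow> (\<forall>i\<in>I. \<forall>x. partial_derivs bs (F i) differentiable (at x))))"
  (is "_ \<longleftrightarrow> ?R n F")
proof (induction n arbitrary: F)
  case 0
  show ?case by auto
next
  case (Suc n)
  show ?case
  proof
    assume L: "dbound (Suc n) I w F"
    show "?R (Suc n) F"
    proof (intro allI impI)
      fix bs :: "'b list" assume bs: "set bs \<subseteq> Basis \<and> length bs \<le> Suc n"
      show "(\<exists>C. \<forall>i\<in>I. \<forall>x. cmod (partial_derivs bs (F i) x) \<le> C * jap x powr w) \<and>
          (length bs < Suc n \<longrightarrow> (\<forall>i\<in>I. \<forall>x. partial_derivs bs (F i) differentiable (at x)))"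
      proof (cases bs rule: rev_exhaust)
        case Nil
        then show ?thesis using L by simp
      next
        case (snoc cs b)
        then have "dbound n I w (\<lambda>i x. frechet_derivative (F i) (at x) b)"
          using L bs by simp
        then show ?thesis
          using bs snoc Suc.IH by (simp add: partial_derivs_snoc)
      qed
    qed
  next
    assume R: "?R (Suc n) F"
    have "?R n (\<lambda>i x. frechet_derivative (F i) (at x) b)" if "b \<in> Basis" for b
    proof (intro allI impI)
      fix bs :: "'b list" assume bs: "set bs \<subseteq> Basis \<and> length bs \<le> n"
      then show "(\<exists>C. \<forall>i\<in>I. \<forall>x. cmod (partial_derivs bs (\<lambda>x. frechet_derivative (F i) (at x) b) x) \<le> C * jap x powr w) \<and>
          (length bs < n \<longrightarrow> (\<forall>i\<in>I. \<forall>x. partial_derivs bs (\<lambda>x. frechet_derivative (F i) (at x) b) differentiable (at x)))"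
        using R[rule_format, of "bs @ [b]"] that by (auto simp: partial_derivs_snoc)
    qed
    then show "dbound (Suc n) I w F"
      using R[rule_format, of "[]"] Suc.IH by auto
  qed
qed

section \<open>The Schwartz space described by weighted bounds\<close>

abbreviation single :: "('a::euclidean_space \<Rightarrow> complex) \<Rightarrow> unit \<Rightarrow> 'a \<Rightarrow> complex" where
  "single f \<equiv> \<lambda>_. f"

text \<open>Real weights of either sign are allowed, so that exponents can later be shifted freely;
  a natural number above \<open>- w\<close> leads back to the powers in the definition.\<close>

lemma schwartz_iff_dbound: "f \<in> schwartz \<longleftrightarrow> (\<forall>n w. dbound n UNIV w (single f))"
proof
  assume f: "f \<in> schwartz"
  show "\<forall>n w. dbound n UNIV w (single f)"
  proof (intro allI)
    fix n w
    obtain k :: nat where k: "- w \<le> real k" using real_arch_simple by blast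
    have "\<exists>C. \<forall>x. cmod (partial_derivs bs f x) \<le> C * jap x powr w" if "set bs \<subseteq> Basis" for bs
    proof -
      have "bounded (range (\<lambda>x. jap x ^ k *\<^sub>R partial_derivs bs f x))"
        using f that by (simp add: schwartz_def jap_def)
      then obtain C where C: "\<And>x. cmod (jap x ^ k *\<^sub>R partial_derivs bs f x) \<le> C"
        by (auto simp: bounded_iff)
      have "C \<ge> 0" using C[of 0] norm_ge_zero order_trans by blast
      have "cmod (partial_derivs bs f x) \<le> C * jap x powr w" for x
      proof -
        have "cmod (partial_derivs bs f x) \<le> C * jap x powr (- real k)"
          using C[of x] jap_pos[of x] by (simp add: jap_powr_minus_nat field_simps)
        also have "\<dots> \<le> C * jap x powr w"
          using k \<open>C \<ge> 0\<close> by (intro mult_left_mono jap_powr_mono) auto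
        finally show ?thesis .
      qed
      then show ?thesis by blast
    qed
    moreover have "\<forall>x. partial_derivs bs f differentiable (at x)" if "set bs \<subseteq> Basis" for bs
      using f that by (simp add: schwartz_def)
    ultimately show "dbound n UNIV w (single f)"
      unfolding dbound_iff_partial_derivs by simp
  qed
next
  assume R: "\<forall>n w. dbound n UNIV w (single f)"
  show "f \<in> schwartz"
    unfolding schwartz_def jap_def[symmetric]
  proof (safe)
    fix bs :: "'a list" and x assume bs: "set bs \<subseteq> Basis"
    show "partial_derivs bs f differentiable (at x)"
      using R[rule_format, of "Suc (length bs)" 0] bs unfolding dbound_iff_partial_derivs by auto
  next
    fix bs :: "'a list" and k :: nat assume bs: "set bs \<subseteq> Basis"
    have "\<exists>C. \<forall>i\<in>UNIV :: unit set. \<forall>x. cmod (partial_derivs bs f x) \<le> C * jap x powr (- real k)"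
      using R[rule_format, of "length bs" "- real k"] bs unfolding dbound_iff_partial_derivs by blast
    then obtain C where C: "\<And>x. cmod (partial_derivs bs f x) \<le> C * jap x powr (- real k)"
      by auto
    have "norm (jap x ^ k *\<^sub>R partial_derivs bs f x) \<le> C" for x
      using C[of x] jap_pos[of x] by (simp add: jap_powr_minus_nat field_simps)
    then show "bounded (range (\<lambda>x. jap x ^ k *\<^sub>R partial_derivs bs f x))"
      by (auto simp: bounded_iff)
  qed
qed

lemma schwartzD: "f \<in> schwartz \<Longrightarrow> dbound n I w (\<lambda>i. f)"
  using dbound_reindex[of n UNIV w "single f" I "\<lambda>_. ()"] by (simp add: schwartz_iff_dbound)

text \<open>The growth \<open>v\<close> of the multiplier is known first; then decay of weight
  \<open>w - v\<close> is demanded of \<open>f\<close>.\<close>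

lemma schwartz_mult:
  assumes "f \<in> schwartz" "\<And>n. pdbound n UNIV (single h)"
  shows "(\<lambda>x. f x * h x) \<in> schwartz"
  unfolding schwartz_iff_dbound
proof (intro allI)
  fix n w
  obtain v where v: "dbound n UNIV v (single h)" using assms by blast
  have "dbound n UNIV ((w - v) + v) (single (\<lambda>x. f x * h x))"
    by (intro dbound_mult v schwartzD assms)
  then show "dbound n UNIV w (single (\<lambda>x. f x * h x))" by simp
qed

lemma schwartz_pdbound: "f \<in> schwartz \<Longrightarrow> pdbound n I (\<lambda>i. f)"
  using schwartzD by blast

lemma schwartz_mult_schwartz: "f \<in> schwartz \<Longrightarrow> h \<in> schwartz \<Longrightarrow> (\<lambda>x. f x * h x) \<in> schwartz"
  by (intro schwartz_mult schwartz_pdbound)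

lemma schwartz_add: "f \<in> schwartz \<Longrightarrow> h \<in> schwartz \<Longrightarrow> (\<lambda>x. f x + h x) \<in> schwartz"
  by (simp add: schwartz_iff_dbound dbound_add)

lemma schwartz_cmult: "f \<in> schwartz \<Longrightarrow> (\<lambda>x. c * f x) \<in> schwartz"
  by (simp add: schwartz_iff_dbound dbound_cmult)

lemma schwartz_diff: "f \<in> schwartz \<Longrightarrow> h \<in> schwartz \<Longrightarrow> (\<lambda>x. f x - h x) \<in> schwartz"
  by (simp add: schwartz_iff_dbound dbound_diff)

lemma schwartz_0: "(\<lambda>x. 0) \<in> schwartz"
  unfolding schwartz_iff_dbound
proof (intro allI)
  fix n w
  \<comment> \<open>Zero is taken as 0 times a Gaussian, for which every weight is
    available.\<close>
  show "dbound n UNIV w (single (\<lambda>x. 0))"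
    using dbound_cmult[OF dbound_gauss[OF zero_less_one], of n UNIV w 0] by simp
qed

lemma schwartz_coord: "f \<in> schwartz \<Longrightarrow> b \<in> Basis \<Longrightarrow> (\<lambda>x. f x * complex_of_real (x \<bullet> b)) \<in> schwartz"
  by (intro schwartz_mult pdbound_coord)

lemma schwartz_derivative:
  assumes "f \<in> schwartz"
  shows "(f has_derivative frechet_derivative f (at x)) (at x)"
    and "b \<in> Basis \<Longrightarrow> (\<lambda>x. frechet_derivative f (at x) b) \<in> schwartz"
proof -
  have *: "dbound n UNIV w (single f)" for n w
    using assms schwartzD by blast
  show "(f has_derivative frechet_derivative f (at x)) (at x)"
    by (rule dbound_SucD(1)[OF *]) simp
  show "(\<lambda>x. frechet_derivative f (at x) b) \<in> schwartz" if "b \<in> Basis"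
    unfolding schwartz_iff_dbound using dbound_SucD(2)[OF * that] by blast
qed

lemma schwartz_continuous: "f \<in> schwartz \<Longrightarrow> continuous_on S f"
  by (rule has_derivative_continuous_on[OF has_derivative_at_withinI[OF schwartz_derivative(1)]])

lemma schwartz_borel [measurable_dest]: "f \<in> schwartz \<Longrightarrow> f \<in> borel_measurable borel"
  by (intro borel_measurable_continuous_onI schwartz_continuous)

lemma schwartz_decay:
  assumes "f \<in> schwartz"
  obtains C where "C > 0" "\<And>x. cmod (f x) \<le> C * jap x powr w"
proof -
  have "dbound 0 UNIV w (single f)" using assms schwartzD by blast
  then show ?thesis by (rule dbound_E) (use that in auto)
qed

section \<open>Seminorms and tempered distributions\<close>

lemma jap_power_abs: "\<bar>jap x ^ k\<bar> = jap x ^ k"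
  using jap_pos[of x] by simp

lemma jap_weight_iff: "jap x ^ k * a \<le> C \<longleftrightarrow> a \<le> C * jap x powr (- real k)"
  using jap_pos[of x] by (simp add: jap_powr_minus_nat field_simps)

lemma partial_derivs_lincomb:
  assumes "f \<in> schwartz" "h \<in> schwartz" "set bs \<subseteq> Basis"
  shows "partial_derivs bs (\<lambda>x. a * f x + b * h x) = (\<lambda>x. a * partial_derivs bs f x + b * partial_derivs bs h x)"
  using assms(3)
proof (induction bs)
  case (Cons c bs)
  have d: "partial_derivs bs f differentiable (at x)" "partial_derivs bs h differentiable (at x)" for x
    using assms Cons.prems by (auto simp: schwartz_def)
  have "((\<lambda>x. a * partial_derivs bs f x + b * partial_derivs bs h x) has_derivative
      (\<lambda>v. a * frechet_derivative (partial_derivs bs f) (at x) v + b * frechet_derivative (partial_derivs bs h) (at x) v)) (at x)" for x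
    using d[of x] unfolding frechet_derivative_works by (auto intro!: derivative_eq_intros)
  note eq = frechet_derivative_at[OF this, symmetric]
  show ?case
    using Cons by (simp add: eq)
qed simp

lemma schwartz_lincomb: "f \<in> schwartz \<Longrightarrow> h \<in> schwartz \<Longrightarrow> (\<lambda>x. a * f x + b * h x) \<in> schwartz"
  by (intro schwartz_add schwartz_cmult)

text \<open>A real \<open>SUP\<close> is informative only over a set that is bounded above;
  membership in \<open>schwartz\<close> supplies that bound.\<close>

lemma seminorm_upper:
  assumes "f \<in> schwartz" "set bs \<subseteq> Basis"
  shows "jap x ^ k * cmod (partial_derivs bs f x) \<le> schwartz_seminorm k bs f"
proof -
  have "bounded (range (\<lambda>x. jap x ^ k *\<^sub>R partial_derivs bs f x))"
    using assms by (simp add: schwartz_def jap_def)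
  then obtain C where C: "\<And>x. norm (jap x ^ k *\<^sub>R partial_derivs bs f x) \<le> C"
    by (auto simp: bounded_iff)
  have "bdd_above (range (\<lambda>x. jap x ^ k * cmod (partial_derivs bs f x)))"
    using C by (intro bdd_aboveI2[of _ _ C]) (simp add: jap_power_abs)
  then show ?thesis
    unfolding schwartz_seminorm_def jap_def[symmetric] by (intro cSUP_upper) auto
qed

lemma seminorm_least:
  "(\<And>x. jap x ^ k * cmod (partial_derivs bs f x) \<le> a) \<Longrightarrow> schwartz_seminorm k bs f \<le> a"
  unfolding schwartz_seminorm_def jap_def[symmetric] by (intro cSUP_least) auto

lemma seminorm_nonneg:
  assumes "f \<in> schwartz" "set bs \<subseteq> Basis"
  shows "0 \<le> schwartz_seminorm k bs f"
  by (rule order_trans[OF _ seminorm_upper[OF assms, of 0]]) (simp add: jap_def)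

lemma seminorm_lincomb:
  assumes "f \<in> schwartz" "h \<in> schwartz" "set bs \<subseteq> Basis"
  shows "schwartz_seminorm k bs (\<lambda>x. a * f x + b * h x)
    \<le> cmod a * schwartz_seminorm k bs f + cmod b * schwartz_seminorm k bs h"
proof (rule seminorm_least)
  fix x
  have "jap x ^ k * cmod (a * partial_derivs bs f x + b * partial_derivs bs h x)
      \<le> jap x ^ k * (cmod a * cmod (partial_derivs bs f x) + cmod b * cmod (partial_derivs bs h x))"
    using jap_pos[of x] by (intro mult_left_mono norm_triangle_le) (auto simp: norm_mult)
  also have "\<dots> = cmod a * (jap x ^ k * cmod (partial_derivs bs f x)) + cmod b * (jap x ^ k * cmod (partial_derivs bs h x))"
    by (simp add: algebra_simps)
  also have "\<dots> \<le> cmod a * schwartz_seminorm k bs f + cmod b * schwartz_seminorm k bs h"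
    using assms by (intro add_mono mult_left_mono seminorm_upper) auto
  finally show "jap x ^ k * cmod (partial_derivs bs (\<lambda>x. a * f x + b * h x) x)
      \<le> cmod a * schwartz_seminorm k bs f + cmod b * schwartz_seminorm k bs h"
    by (simp add: partial_derivs_lincomb[OF assms])
qed

section \<open>Gauge norms: directed finite sums of seminorms\<close>

definition multi_indices :: "nat \<Rightarrow> 'a::euclidean_space list set" where
  "multi_indices n = {bs. set bs \<subseteq> Basis \<and> length bs \<le> n}"

lemma finite_multi_indices: "finite (multi_indices n)"
  unfolding multi_indices_def by (intro finite_lists_length_le finite_Basis)

text \<open>All derivatives up to order \<open>n\<close> with weight \<open>k\<close>, collected in
  one norm. Being monotone in both indices, these norms are directed, so continuity of a linear map
  amounts to a single inequality.\<close>

definition gauge_norm :: "nat \<Rightarrow> nat \<Rightarrow> ('a::euclidean_space \<Rightarrow> complex) \<Rightarrow> real" where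
  "gauge_norm n k f = (\<Sum>bs\<in>multi_indices n. schwartz_seminorm k bs f)"

lemma gauge_norm_nonneg: "f \<in> schwartz \<Longrightarrow> 0 \<le> gauge_norm n k f"
  unfolding gauge_norm_def by (intro sum_nonneg seminorm_nonneg) (auto simp: multi_indices_def)

lemma gauge_norm_lincomb:
  assumes "f \<in> schwartz" "h \<in> schwartz"
  shows "gauge_norm n k (\<lambda>x. a * f x + b * h x) \<le> cmod a * gauge_norm n k f + cmod b * gauge_norm n k h"
  unfolding gauge_norm_def sum_distrib_left sum.distrib[symmetric]
  by (intro sum_mono seminorm_lincomb assms) (auto simp: multi_indices_def)

lemma gauge_norm_cmult:
  "f \<in> schwartz \<Longrightarrow> gauge_norm n k (\<lambda>x. a * f x) \<le> cmod a * gauge_norm n k f"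
  using gauge_norm_lincomb[of f f n k a 0] by simp

lemma seminorm_le_gauge_norm:
  assumes "f \<in> schwartz" "set bs \<subseteq> Basis" "length bs \<le> n"
  shows "schwartz_seminorm k bs f \<le> gauge_norm n k f"
  unfolding gauge_norm_def
  by (rule member_le_sum) (use assms in \<open>auto simp: multi_indices_def intro: seminorm_nonneg finite_multi_indices[unfolded multi_indices_def]\<close>)

lemma seminorm_mono:
  assumes "f \<in> schwartz" "set bs \<subseteq> Basis" "k \<le> l"
  shows "schwartz_seminorm k bs f \<le> schwartz_seminorm l bs f"
proof (rule seminorm_least)
  fix x
  have "jap x ^ k * cmod (partial_derivs bs f x) \<le> jap x ^ l * cmod (partial_derivs bs f x)"
    using jap_ge_1[of x] assms by (intro mult_right_mono power_increasing) auto
  also have "\<dots> \<le> schwartz_seminorm l bs f"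
    using assms by (intro seminorm_upper)
  finally show "jap x ^ k * cmod (partial_derivs bs f x) \<le> schwartz_seminorm l bs f" .
qed

lemma gauge_norm_mono:
  assumes "f \<in> schwartz" "n \<le> m" "k \<le> l"
  shows "gauge_norm n k f \<le> gauge_norm m l f"
proof -
  have "gauge_norm n k f \<le> gauge_norm n l f"
    unfolding gauge_norm_def using assms by (intro sum_mono seminorm_mono) (auto simp: multi_indices_def)
  also have "\<dots> \<le> gauge_norm m l f"
    unfolding gauge_norm_def using assms
    by (intro sum_mono2 finite_multi_indices) (auto simp: multi_indices_def intro: seminorm_nonneg)
  finally show ?thesis .
qed

text \<open>A gauge ball is regarded as a family indexed by its own members. Together with
  \<open>gauge_norm_bounded\<close> this lets the calculus of \<open>dbound\<close> produce
  constants uniform over the ball.\<close>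

lemma dbound_gauge_ball:
  "dbound n {f\<in>schwartz. gauge_norm n k f \<le> r} (- real k) (\<lambda>f::'a::euclidean_space \<Rightarrow> complex. f)"
  unfolding dbound_iff_partial_derivs
proof (intro allI impI conjI ballI)
  fix bs :: "'a list" assume bs: "set bs \<subseteq> Basis \<and> length bs \<le> n"
  have "cmod (partial_derivs bs f x) \<le> r * jap x powr (- real k)"
    if "f \<in> schwartz" "gauge_norm n k f \<le> r" for f x
  proof -
    have "jap x ^ k * cmod (partial_derivs bs f x) \<le> r"
      using seminorm_upper[of f bs x k] seminorm_le_gauge_norm[of f bs n k] bs that by linarith
    then show ?thesis by (simp add: jap_weight_iff)
  qed
  then show "\<exists>C. \<forall>f\<in>{f\<in>schwartz. gauge_norm n k f \<le> r}. \<forall>x. cmod (partial_derivs bs f x) \<le> C * jap x powr (- real k)"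
    by auto
next
  fix bs :: "'a list" and f :: "'a \<Rightarrow> complex" and x
  assume "set bs \<subseteq> Basis \<and> length bs \<le> n" "f \<in> {f\<in>schwartz. gauge_norm n k f \<le> r}"
  then show "partial_derivs bs f differentiable (at x)"
    by (auto simp: schwartz_def)
qed

lemma gauge_norm_bounded:
  assumes "dbound n I (- real k) F"
  obtains C where "\<And>i. i \<in> I \<Longrightarrow> gauge_norm n k (F i) \<le> C"
proof -
  have "\<exists>C. \<forall>i\<in>I. schwartz_seminorm k bs (F i) \<le> C" if bs: "bs \<in> multi_indices n" for bs
  proof -
    obtain C where C: "\<And>i x. i \<in> I \<Longrightarrow> cmod (partial_derivs bs (F i) x) \<le> C * jap x powr (- real k)"
      using assms bs unfolding dbound_iff_partial_derivs multi_indices_def by blast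
    have "schwartz_seminorm k bs (F i) \<le> C" if "i \<in> I" for i
      by (rule seminorm_least) (use C[OF that] in \<open>simp add: jap_weight_iff\<close>)
    then show ?thesis by blast
  qed
  then obtain C where "\<And>bs i. bs \<in> multi_indices n \<Longrightarrow> i \<in> I \<Longrightarrow> schwartz_seminorm k bs (F i) \<le> C bs"
    by metis
  then have "gauge_norm n k (F i) \<le> sum C (multi_indices n)" if "i \<in> I" for i
    using that unfolding gauge_norm_def by (intro sum_mono)
  then show ?thesis using that by blast
qed

text \<open>Homogeneity scales a bound on the unit ball to all functions. A function of gauge norm 0
  has all its positive multiples in the ball, which forces \<open>N f\<close> to be
  non-positive.\<close>

lemma homogeneous_gauge_bound:
  fixes N :: "('a::euclidean_space \<Rightarrow> complex) \<Rightarrow> real"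
  assumes hom: "\<And>f t. f \<in> schwartz \<Longrightarrow> t > 0 \<Longrightarrow> N (\<lambda>x. complex_of_real t * f x) = t * N f"
    and bound: "\<And>f. f \<in> schwartz \<Longrightarrow> gauge_norm n k f \<le> 1 \<Longrightarrow> N f \<le> C"
    and f: "f \<in> schwartz"
  shows "N f \<le> C * gauge_norm n k f"
proof -
  have *: "t * N f \<le> C" if "t > 0" "t * gauge_norm n k f \<le> 1" for t
  proof -
    have "gauge_norm n k (\<lambda>x. complex_of_real t * f x) \<le> 1"
      using gauge_norm_cmult[OF f, of n k "complex_of_real t"] that by simp
    then show ?thesis
      using bound[OF schwartz_cmult[OF f]] hom[OF f that(1)] by metis
  qed
  show ?thesis
  proof (cases "gauge_norm n k f = 0")
    case True
    have "N f \<le> 0"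
    proof (rule ccontr)
      assume "\<not> N f \<le> 0"
      then have N: "N f > 0" by simp
      \<comment> \<open>This multiple is chosen to give \<open>N\<close> the value |C| + 1, which
        exceeds \<open>C\<close>.\<close>
      have "((\<bar>C\<bar> + 1) / N f) * N f \<le> C"
        using N by (intro *) (auto simp: True)
      then show False using N by simp
    qed
    then show ?thesis by (simp add: True)
  next
    case False
    then have "gauge_norm n k f > 0" using gauge_norm_nonneg[OF f, of n k] by linarith
    then show ?thesis using *[of "1 / gauge_norm n k f"] by (simp add: field_simps)
  qed
qed

section \<open>The generated topology and continuous functionals\<close>

lemma topspace_schwartz_topology: "topspace schwartz_topology = schwartz"
proof -
  have "f \<in> \<Union>{{f \<in> schwartz. schwartz_seminorm k bs (\<lambda>x. f x - f0 x) < e} | f0 k bs e.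
        f0 \<in> schwartz \<and> set bs \<subseteq> Basis \<and> e > 0}" if "f \<in> schwartz" for f :: "'a \<Rightarrow> complex"
  proof -
    have "schwartz_seminorm 0 [] (\<lambda>x. f x - f x) < 1"
      by (simp add: schwartz_seminorm_def)
    moreover have "{h \<in> schwartz. schwartz_seminorm 0 [] (\<lambda>x. h x - f x) < 1} \<in>
        {{f \<in> schwartz. schwartz_seminorm k bs (\<lambda>x. f x - f0 x) < e} | f0 k bs e.
          f0 \<in> schwartz \<and> set bs \<subseteq> Basis \<and> e > 0}"
      by (rule CollectI, rule exI[of _ f], rule exI[of _ 0], rule exI[of _ "[]"], rule exI[of _ 1])
         (use that in simp)
    ultimately show ?thesis using that by blast
  qed
  then show ?thesis
    unfolding schwartz_topology_def topology_generated_by_topspace by (intro equalityI subsetI) auto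
qed

lemma gauge_ball_nhd:
  assumes "f0 \<in> schwartz" "e > 0"
  obtains U where "openin schwartz_topology U" "f0 \<in> U"
    "\<And>f. f \<in> U \<Longrightarrow> f \<in> schwartz \<and> gauge_norm n k (\<lambda>x. f x - f0 x) < e"
proof -
  let ?M = "multi_indices n :: 'a list set"
  \<comment> \<open>The gauge norm sums \<open>card ?M\<close> seminorms, each below
    \<open>d\<close>; the added 1 makes the total strictly smaller than \<open>e\<close>.\<close>
  define d where "d = e / (real (card ?M) + 1)"
  have d: "d > 0" using assms by (simp add: d_def)
  define S where "S bs = {f \<in> schwartz. schwartz_seminorm k bs (\<lambda>x. f x - f0 x) < d}" for bs
  have S: "openin schwartz_topology (S bs)" if "bs \<in> ?M" for bs
    unfolding schwartz_topology_def S_def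
    by (rule topology_generated_by_Basis) (use that assms d in \<open>auto simp: multi_indices_def\<close>)
  have "[] \<in> ?M" by (simp add: multi_indices_def)
  show ?thesis
  proof (rule that[of "\<Inter>bs\<in>?M. S bs"])
    show "openin schwartz_topology (\<Inter>bs\<in>?M. S bs)"
      using S \<open>[] \<in> ?M\<close> by (intro openin_INT2 finite_multi_indices) auto
    have "schwartz_seminorm k bs (\<lambda>x. f0 x - f0 x) < d" if "bs \<in> ?M" for bs
      using seminorm_lincomb[OF assms(1) assms(1), of bs k 0 0] d that by (auto simp: multi_indices_def)
    then show "f0 \<in> (\<Inter>bs\<in>?M. S bs)"
      using assms by (auto simp: S_def)
    fix f assume f: "f \<in> (\<Inter>bs\<in>?M. S bs)"
    then have "gauge_norm n k (\<lambda>x. f x - f0 x) \<le> (\<Sum>bs\<in>?M. d)"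
      unfolding gauge_norm_def by (intro sum_mono) (auto simp: S_def less_imp_le)
    also have "\<dots> = real (card ?M) * d" by simp
    also have "\<dots> < e"
      using \<open>e > 0\<close> by (simp add: d_def field_simps)
    finally show "f \<in> schwartz \<and> gauge_norm n k (\<lambda>x. f x - f0 x) < e"
      using f \<open>[] \<in> ?M\<close> by (auto simp: S_def)
  qed
qed

text \<open>Generating sets are balls of one seminorm about arbitrary centres. The triangle
  inequality recentres such a ball at a given point, and directedness of the gauge norms handles
  intersections; the rest is induction on the generation of open sets.\<close>

lemma openin_schwartz_gauge_ball:
  assumes "openin schwartz_topology U" "f0 \<in> U"
  shows "\<exists>n k e. e > 0 \<and> (\<forall>f\<in>schwartz. gauge_norm n k (\<lambda>x. f x - f0 x) < e \<longrightarrow> f \<in> U)"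
proof -
  let ?P = "\<lambda>U f0. \<exists>n k e. e > 0 \<and> (\<forall>f\<in>schwartz. gauge_norm n k (\<lambda>x. f x - f0 x) < e \<longrightarrow> f \<in> U)"
  have "generate_topology_on {{f \<in> schwartz. schwartz_seminorm k bs (\<lambda>x. f x - f0 x) < e} | f0 k bs e.
        f0 \<in> schwartz \<and> set bs \<subseteq> Basis \<and> e > 0} U"
    using assms(1) unfolding schwartz_topology_def openin_topology_generated_by_iff .
  then have "\<forall>f0\<in>U. f0 \<in> schwartz \<longrightarrow> ?P U f0"
  proof induction
    case (Int A B)
    show ?case
    proof (intro ballI impI)
      fix f0 :: "'a \<Rightarrow> complex" assume f0: "f0 \<in> A \<inter> B" "f0 \<in> schwartz"
      from Int.IH(1)[rule_format, OF IntD1[OF f0(1)] f0(2)]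
      obtain n k e where A: "e > 0" "\<forall>f\<in>schwartz. gauge_norm n k (\<lambda>x. f x - f0 x) < e \<longrightarrow> f \<in> A"
        by (elim exE conjE)
      from Int.IH(2)[rule_format, OF IntD2[OF f0(1)] f0(2)]
      obtain m l d where B: "d > 0" "\<forall>f\<in>schwartz. gauge_norm m l (\<lambda>x. f x - f0 x) < d \<longrightarrow> f \<in> B"
        by (elim exE conjE)
      have "f \<in> A \<inter> B" if f: "f \<in> schwartz" "gauge_norm (max n m) (max k l) (\<lambda>x. f x - f0 x) < min d e" for f
      proof
        have "gauge_norm n k (\<lambda>x. f x - f0 x) < e"
          using gauge_norm_mono[OF schwartz_diff[OF f(1) f0(2)], of n "max n m" k "max k l"] f(2) by simp
        then show "f \<in> A" using A(2) f(1) by simp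
        have "gauge_norm m l (\<lambda>x. f x - f0 x) < d"
          using gauge_norm_mono[OF schwartz_diff[OF f(1) f0(2)], of m "max n m" l "max k l"] f(2) by simp
        then show "f \<in> B" using B(2) f(1) by simp
      qed
      moreover have "min d e > 0" using A(1) B(1) by simp
      ultimately have "min d e > 0 \<and> (\<forall>f\<in>schwartz. gauge_norm (max n m) (max k l) (\<lambda>x. f x - f0 x) < min d e \<longrightarrow> f \<in> A \<inter> B)"
        by blast
      then show "?P (A \<inter> B) f0" by (intro exI)
    qed
  next
    case (UN K)
    show ?case
    proof (intro ballI impI)
      fix f0 :: "'a \<Rightarrow> complex" assume "f0 \<in> \<Union>K" "f0 \<in> schwartz"
      then obtain A where "A \<in> K" "f0 \<in> A" by blast
      from UN.IH[rule_format, OF this \<open>f0 \<in> schwartz\<close>]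
      obtain n k e where A: "e > 0" "\<forall>f\<in>schwartz. gauge_norm n k (\<lambda>x. f x - f0 x) < e \<longrightarrow> f \<in> A"
        by (elim exE conjE)
      with \<open>A \<in> K\<close> have "e > 0 \<and> (\<forall>f\<in>schwartz. gauge_norm n k (\<lambda>x. f x - f0 x) < e \<longrightarrow> f \<in> \<Union>K)"
        by blast
      then show "?P (\<Union>K) f0" by (intro exI)
    qed
  next
    case (Basis s)
    then obtain h k bs e where s: "s = {f \<in> schwartz. schwartz_seminorm k bs (\<lambda>x. f x - h x) < e}"
      and h: "h \<in> schwartz" "set bs \<subseteq> Basis" by (elim CollectE exE conjE)
    show ?case
    proof (intro ballI impI)
      fix f0 assume f0: "f0 \<in> s" "f0 \<in> schwartz"
      define d where "d = e - schwartz_seminorm k bs (\<lambda>x. f0 x - h x)"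
      have d: "d > 0" using f0 by (simp add: s d_def)
      have "f \<in> s" if f: "f \<in> schwartz" "gauge_norm (length bs) k (\<lambda>x. f x - f0 x) < d" for f
      proof -
        have "schwartz_seminorm k bs (\<lambda>x. f x - h x)
            \<le> schwartz_seminorm k bs (\<lambda>x. f x - f0 x) + schwartz_seminorm k bs (\<lambda>x. f0 x - h x)"
          using seminorm_lincomb[OF schwartz_diff[OF f(1) f0(2)] schwartz_diff[OF f0(2) h(1)] h(2), of k 1 1] by simp
        then show ?thesis
          using seminorm_le_gauge_norm[OF schwartz_diff[OF f(1) f0(2)] h(2), of "length bs" k] f
          by (simp add: s d_def)
      qed
      then have "d > 0 \<and> (\<forall>f\<in>schwartz. gauge_norm (length bs) k (\<lambda>x. f x - f0 x) < d \<longrightarrow> f \<in> s)"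
        using d by blast
      then show "?P s f0" by (intro exI)
    qed
  next
    case Empty
    show ?case by simp
  qed
  moreover have "f0 \<in> schwartz"
    using openin_subset[OF assms(1)] assms(2) topspace_schwartz_topology by blast
  ultimately show ?thesis using assms(2) by blast
qed

definition schwartz_linear :: "(('a::euclidean_space \<Rightarrow> complex) \<Rightarrow> complex) \<Rightarrow> bool" where
  "schwartz_linear T \<longleftrightarrow>
     (\<forall>f\<in>schwartz. \<forall>h\<in>schwartz. \<forall>a b. T (\<lambda>x. a * f x + b * h x) = a * T f + b * T h)"

lemma schwartz_linearD:
  assumes "schwartz_linear T" "f \<in> schwartz" "h \<in> schwartz"
  shows "T (\<lambda>x. a * f x + b * h x) = a * T f + b * T h"
    and "T (\<lambda>x. f x - h x) = T f - T h"
    and "T (\<lambda>x. f x + h x) = T f + T h"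
    and "T (\<lambda>x. a * f x) = a * T f"
proof -
  show *: "T (\<lambda>x. a * f x + b * h x) = a * T f + b * T h" for a b
    using assms by (simp add: schwartz_linear_def)
  show "T (\<lambda>x. f x - h x) = T f - T h" using *[of 1 "-1"] by simp
  show "T (\<lambda>x. f x + h x) = T f + T h" using *[of 1 1] by simp
  show "T (\<lambda>x. a * f x) = a * T f" using *[of a 0] by simp
qed

lemma temperedI:
  assumes lin: "schwartz_linear T"
    and bound: "\<And>f. f \<in> schwartz \<Longrightarrow> cmod (T f) \<le> C * gauge_norm n k f"
  shows "tempered T"
  unfolding tempered_def
proof
  show "\<forall>f\<in>schwartz. \<forall>h\<in>schwartz. \<forall>a b. T (\<lambda>x. a * f x + b * h x) = a * T f + b * T h"
    using lin by (simp add: schwartz_linear_def)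
  show "continuous_map schwartz_topology euclidean T"
    unfolding continuous_map_def
  proof (intro conjI allI impI)
    show "T \<in> topspace schwartz_topology \<rightarrow> topspace euclidean" by simp
    fix V :: "complex set" assume "openin euclidean V"
    then have V: "open V" by simp
    show "openin schwartz_topology {f \<in> topspace schwartz_topology. T f \<in> V}"
    proof (subst openin_subopen, intro ballI)
      fix f0 assume f0: "f0 \<in> {f \<in> topspace schwartz_topology. T f \<in> V}"
      then have f0S: "f0 \<in> schwartz" by (simp add: topspace_schwartz_topology)
      obtain e where e: "e > 0" "ball (T f0) e \<subseteq> V"
        using V f0 open_contains_ball by blast
      obtain U where U: "openin schwartz_topology U" "f0 \<in> U"
        "\<And>f. f \<in> U \<Longrightarrow> f \<in> schwartz \<and> gauge_norm n k (\<lambda>x. f x - f0 x) < e / (\<bar>C\<bar> + 1)"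
        using gauge_ball_nhd[OF f0S, of "e / (\<bar>C\<bar> + 1)" n k] e(1) by auto
      have "T f \<in> V" if "f \<in> U" for f
      proof -
        have fS: "f \<in> schwartz" using U(3) that by blast
        have "cmod (T f - T f0) = cmod (T (\<lambda>x. f x - f0 x))"
          using schwartz_linearD(2)[OF lin fS f0S] by simp
        also have "\<dots> \<le> C * gauge_norm n k (\<lambda>x. f x - f0 x)"
          by (intro bound schwartz_diff fS f0S)
        also have "\<dots> \<le> (\<bar>C\<bar> + 1) * gauge_norm n k (\<lambda>x. f x - f0 x)"
          by (intro mult_right_mono gauge_norm_nonneg schwartz_diff fS f0S) auto
        also have "\<dots> < e"
          using U(3)[OF that] by (simp add: field_simps)
        finally show ?thesis using e(2) by (auto simp: dist_norm norm_minus_commute)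
      qed
      then show "\<exists>U. openin schwartz_topology U \<and> f0 \<in> U \<and> U \<subseteq> {f \<in> topspace schwartz_topology. T f \<in> V}"
        using U by (auto simp: topspace_schwartz_topology)
    qed
  qed
qed

text \<open>The preimage of the unit disc contains a gauge ball of some radius e about 0. Scaling
  the unit gauge ball by e/2 stays strictly inside it, whence the constant 2/e.\<close>

lemma tempered_gauge_bound:
  assumes "tempered T"
  shows "\<exists>n k C. \<forall>f\<in>schwartz. cmod (T f) \<le> C * gauge_norm n k f"
proof -
  have lin: "schwartz_linear T" using assms by (simp add: tempered_def schwartz_linear_def)
  have T0: "T (\<lambda>x. 0) = 0" using schwartz_linearD(4)[OF lin schwartz_0 schwartz_0, of 0] by simp
  have "openin schwartz_topology {f \<in> topspace schwartz_topology. T f \<in> ball 0 1}"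
    using assms unfolding tempered_def
    by (intro openin_continuous_map_preimage[of _ euclidean]) simp_all
  moreover have "(\<lambda>x. 0) \<in> {f \<in> topspace schwartz_topology. T f \<in> ball 0 1}"
    by (simp add: topspace_schwartz_topology schwartz_0 T0)
  ultimately have "\<exists>n k e. e > 0 \<and> (\<forall>f\<in>schwartz. gauge_norm n k (\<lambda>x. f x - 0) < e \<longrightarrow>
      f \<in> {f \<in> topspace schwartz_topology. T f \<in> ball 0 1})"
    by (rule openin_schwartz_gauge_ball)
  then obtain n k e where e: "e > 0" "\<forall>f\<in>schwartz. gauge_norm n k (\<lambda>x. f x - 0) < e \<longrightarrow>
      f \<in> {f \<in> topspace schwartz_topology. T f \<in> ball 0 1}"
    by (elim exE conjE)
  have "cmod (T f) \<le> (2 / e) * gauge_norm n k f" if "f \<in> schwartz" for f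
  proof (rule homogeneous_gauge_bound[OF _ _ that])
    show "cmod (T (\<lambda>x. complex_of_real t * f x)) = t * cmod (T f)" if "f \<in> schwartz" "t > 0" for f t
      using schwartz_linearD(4)[OF lin that(1) that(1)] that(2) by (simp add: norm_mult)
    show "cmod (T f) \<le> 2 / e" if f: "f \<in> schwartz" "gauge_norm n k f \<le> 1" for f
    proof -
      have "gauge_norm n k (\<lambda>x. complex_of_real (e / 2) * f x) < e"
      proof (rule le_less_trans[OF gauge_norm_cmult[OF f(1)]])
        show "cmod (complex_of_real (e / 2)) * gauge_norm n k f < e"
          using mult_left_mono[OF f(2), of "e / 2"] e(1) by (simp del: mult_le_cancel_left_pos)
      qed
      then have "cmod (T (\<lambda>x. complex_of_real (e / 2) * f x)) < 1"
        using e(2)[rule_format, OF schwartz_cmult[OF f(1)], of "complex_of_real (e / 2)"] by simp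
      then show ?thesis
        using e(1) by (simp only: schwartz_linearD(4)[OF lin f(1) f(1)]) (simp add: norm_mult field_simps)
    qed
  qed
  then show ?thesis by blast
qed

section \<open>The Fourier transform on the Schwartz space\<close>

interpretation lborel_product: product_sigma_finite "\<lambda>_. lborel :: real measure" ..

lemma
  fixes f :: "'a::euclidean_space \<Rightarrow> real \<Rightarrow> complex"
  assumes "\<And>b. b \<in> Basis \<Longrightarrow> integrable lborel (f b)"
  shows integrable_lborel_prod: "integrable lborel (\<lambda>x::'a. \<Prod>b\<in>Basis. f b (x \<bullet> b))"
    and integral_lborel_prod: "(LINT x|lborel. (\<Prod>b\<in>Basis. f b (x \<bullet> b))) = (\<Prod>b\<in>Basis. LINT t|lborel. f b t)"
proof -
  let ?S = "\<lambda>y. \<Sum>b\<in>Basis. y b *\<^sub>R b :: 'a"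
  have eq: "lborel = distr (\<Pi>\<^sub>M b\<in>Basis. lborel) borel ?S"
    by (rule lborel_eq)
  have m[measurable]: "?S \<in> (\<Pi>\<^sub>M b\<in>Basis. lborel) \<rightarrow>\<^sub>M borel"
    by measurable
  have [measurable]: "f b \<in> borel_measurable borel" if "b \<in> Basis" for b
    using assms[OF that] by auto
  have fm[measurable]: "(\<lambda>x::'a. \<Prod>b\<in>Basis. f b (x \<bullet> b)) \<in> borel_measurable borel"
    by measurable
  have comp: "(\<Prod>b\<in>Basis. f b (?S y \<bullet> b)) = (\<Prod>b\<in>Basis. f b (y b))" for y
    by (intro prod.cong) simp_all
  show "integrable lborel (\<lambda>x::'a. \<Prod>b\<in>Basis. f b (x \<bullet> b))"
    unfolding eq by (subst integrable_distr_eq[OF m fm], unfold comp)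
      (intro lborel_product.product_integrable_prod assms finite_Basis)
  show "(LINT x|lborel. (\<Prod>b\<in>Basis. f b (x \<bullet> b))) = (\<Prod>b\<in>Basis. LINT t|lborel. f b t)"
    by (subst eq, subst integral_distr[OF m fm], unfold comp)
      (intro lborel_product.product_integral_prod assms finite_Basis)
qed

lemma integrable_inverse_1_plus_square': "integrable lborel (\<lambda>t::real. inverse (1 + t\<^sup>2))"
  using integrable_inverse_1_plus_square by (simp add: set_integrable_def einterval_def)

lemma prod_le_jap_power: "(\<Prod>b\<in>Basis. 1 + (x \<bullet> b)\<^sup>2) \<le> jap (x::'a::euclidean_space) ^ DIM('a)"
proof -
  have "(\<Prod>b\<in>Basis. 1 + (x \<bullet> b)\<^sup>2) \<le> (\<Prod>b\<in>(Basis::'a set). jap x)"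
  proof (intro prod_mono conjI)
    fix b :: 'a assume b: "b \<in> Basis"
    have "(x \<bullet> b)\<^sup>2 \<le> (norm x)\<^sup>2"
      using Basis_le_norm[OF b, of x] by (simp add: abs_le_square_iff[symmetric])
    then show "1 + (x \<bullet> b)\<^sup>2 \<le> jap x" by (simp add: jap_def)
  qed simp
  then show ?thesis by simp
qed

text \<open>Each 1 / (1 + t^2) is integrable on the line. Their product over the coordinates
  dominates the given power, because each factor 1 + x_b^2 is at most \<open>jap x\<close>.\<close>

lemma integrable_jap: "integrable lborel (\<lambda>x::'a::euclidean_space. jap x powr (- real DIM('a)))"
proof -
  have "integrable lborel (\<lambda>x::'a. \<Prod>b\<in>Basis. complex_of_real (inverse (1 + (x \<bullet> b)\<^sup>2)))"
    by (intro integrable_lborel_prod[where f="\<lambda>b t. complex_of_real (inverse (1 + t\<^sup>2))"]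
        integrable_of_real integrable_inverse_1_plus_square')
  then show ?thesis
  proof (rule Bochner_Integration.integrable_bound)
    show "AE x::'a in lborel. norm (jap x powr (- real DIM('a))) \<le> norm (\<Prod>b\<in>Basis. complex_of_real (inverse (1 + (x \<bullet> b)\<^sup>2)))"
    proof (rule AE_I2)
      fix x :: 'a
      have pos: "1 + (x \<bullet> b)\<^sup>2 > 0" for b by (smt (verit) zero_le_power2)
      have "norm (\<Prod>b\<in>Basis. complex_of_real (inverse (1 + (x \<bullet> b)\<^sup>2))) = (\<Prod>b\<in>Basis. inverse (1 + (x \<bullet> b)\<^sup>2))"
        unfolding prod_norm[symmetric] using pos by (intro prod.cong) (auto simp: abs_of_pos norm_inverse simp flip: of_real_inverse)
      also have "\<dots> = inverse (\<Prod>b\<in>Basis. 1 + (x \<bullet> b)\<^sup>2)"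
        by (simp add: prod_inversef[symmetric] o_def)
      also have "\<dots> \<ge> inverse (jap x ^ DIM('a))"
        using pos by (intro le_imp_inverse_le prod_le_jap_power prod_pos) auto
      finally have "inverse (jap x ^ DIM('a)) \<le> norm (\<Prod>b\<in>Basis. complex_of_real (inverse (1 + (x \<bullet> b)\<^sup>2)))" .
      then show "norm (jap x powr (- real DIM('a))) \<le> norm (\<Prod>b\<in>Basis. complex_of_real (inverse (1 + (x \<bullet> b)\<^sup>2)))"
        using jap_pos[of x] by (simp add: jap_powr_minus_nat divide_inverse)
    qed
  qed measurable
qed

lemma integrable_decay:
  fixes f :: "'a::euclidean_space \<Rightarrow> complex"
  assumes "f \<in> borel_measurable borel" "\<And>x. cmod (f x) \<le> C * jap x powr (- real DIM('a))"
  shows "integrable lborel f"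
proof (rule Bochner_Integration.integrable_bound[OF integrable_mult_right[OF integrable_jap, of C]])
  show "AE x in lborel. cmod (f x) \<le> norm (C * jap x powr (- real DIM('a)))"
    using assms(2) by (intro AE_I2) (simp add: order_trans[OF _ abs_ge_self])
qed (use assms in simp)

lemma integral_decay_bound:
  fixes f :: "'a::euclidean_space \<Rightarrow> complex"
  assumes "f \<in> borel_measurable borel" "\<And>x. cmod (f x) \<le> C * jap x powr (- real DIM('a))"
  shows "cmod (LINT x|lborel. f x) \<le> C * (LINT x::'a|lborel. jap x powr (- real DIM('a)))"
proof -
  have "cmod (LINT x|lborel. f x) \<le> (LINT x|lborel. cmod (f x))"
    by (rule integral_norm_bound)
  also have "\<dots> \<le> (LINT x::'a|lborel. C * jap x powr (- real DIM('a)))"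
    by (intro integral_mono integrable_norm[OF integrable_decay[OF assms]] integrable_mult_right[OF integrable_jap])
       (use assms(2) in auto)
  finally show ?thesis by simp
qed

lemma schwartz_integrable:
  fixes f :: "'a::euclidean_space \<Rightarrow> complex"
  assumes "f \<in> schwartz"
  shows "integrable lborel f"
proof -
  obtain C where "\<And>x. cmod (f x) \<le> C * jap x powr (- real DIM('a))"
    using schwartz_decay[OF assms] by blast
  then show ?thesis by (rule integrable_decay[OF schwartz_borel[OF assms]])
qed

lemma schwartz_integrable_moment:
  fixes f :: "'a::euclidean_space \<Rightarrow> complex"
  assumes f: "f \<in> schwartz"
  shows "integrable lborel (\<lambda>x. norm x ^ m * cmod (f x))"
proof -
  obtain C where C: "C > 0" "\<And>x. cmod (f x) \<le> C * jap x powr (- real DIM('a) - real m / 2)"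
    using schwartz_decay[OF f] by blast
  note [measurable] = schwartz_borel[OF f]
  have "integrable lborel (\<lambda>x. complex_of_real (norm x ^ m) * f x)"
  proof (rule integrable_decay)
    fix x :: 'a
    have "norm x ^ m \<le> (jap x powr (1/2)) ^ m"
      by (intro power_mono norm_le_jap) simp
    also have "\<dots> = jap x powr (real m / 2)"
      using jap_pos[of x] by (simp add: powr_power mult.commute)
    finally have "norm x ^ m * cmod (f x) \<le> jap x powr (real m / 2) * (C * jap x powr (- real DIM('a) - real m / 2))"
      by (intro mult_mono C) auto
    also have "\<dots> = C * jap x powr (- real DIM('a))"
      by (simp add: powr_add[symmetric] mult_ac)
    finally show "cmod (complex_of_real (norm x ^ m) * f x) \<le> C * jap x powr (- real DIM('a))"
      by (simp add: norm_mult norm_power)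
  qed simp
  from integrable_norm[OF this] show ?thesis
    by (simp add: norm_mult norm_power)
qed

text \<open>A Peetre inequality for short shifts. It turns decay at a nearby point into decay at
  \<open>x\<close>, which dominates difference quotients uniformly in the step.\<close>

lemma jap_shift_le: "norm v \<le> 1 \<Longrightarrow> jap x \<le> 3 * jap (x + v)"
proof -
  assume v: "norm v \<le> 1"
  have "norm x \<le> norm (x + v) + norm v"
    using norm_triangle_ineq4[of "x + v" v] by simp
  then have "(norm x)\<^sup>2 \<le> (norm (x + v) + 1)\<^sup>2"
    using v by (intro power_mono) auto
  also have "\<dots> \<le> 2 * (norm (x + v))\<^sup>2 + 2"
    using sum_squares_bound[of "norm (x + v)" 1] by (simp add: power2_sum)
  also have "\<dots> \<le> 2 + 3 * (norm (x + v))\<^sup>2" by simp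
  finally show ?thesis by (simp add: jap_def)
qed

lemma integral_lborel_translate:
  fixes f :: "'a::euclidean_space \<Rightarrow> complex"
  assumes [measurable]: "f \<in> borel_measurable borel"
  shows "(LINT x|lborel. f (v + x)) = (LINT x|lborel. f x)"
proof -
  have "(LINT x|lborel. f x) = (LINT x|distr lborel borel ((+) v). f x)"
    by (simp only: lborel_distr_plus)
  also have "\<dots> = (LINT x|lborel. f (v + x))"
    by (subst integral_distr) auto
  finally show ?thesis ..
qed

text \<open>By translation invariance every difference quotient has integral 0, and dominated
  convergence carries this to the derivative. This is integration by parts in the form needed
  below.\<close>

lemma integral_schwartz_derivative:
  fixes h :: "'a::euclidean_space \<Rightarrow> complex"
  assumes h: "h \<in> schwartz" and b: "b \<in> Basis"
  shows "(LINT x|lborel. frechet_derivative h (at x) b) = 0"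
proof -
  let ?D = "\<lambda>x. frechet_derivative h (at x) b"
  note D = schwartz_derivative(2)[OF h b]
  note [measurable] = schwartz_borel[OF h] schwartz_borel[OF D]
  let ?d = "real DIM('a)"
  obtain C where C: "C > 0" "\<And>x. cmod (?D x) \<le> C * jap x powr (- ?d)"
    using schwartz_decay[OF D] by blast
  define s where "s n x = of_real (real (Suc n)) * (h (x + (1 / real (Suc n)) *\<^sub>R b) - h x)" for n x
  \<comment> \<open>The mean value inequality moves the increment to a derivative at an intermediate
    point at distance at most 1, where \<open>jap_shift_le\<close> gives an integrable bound in
    terms of \<open>x\<close> alone.\<close>
  have shift: "cmod (h (x + t *\<^sub>R b) - h x) \<le> t * (C * 3 powr ?d * jap x powr (- ?d))"
    if t: "0 < t" "t \<le> 1" for x t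
  proof -
    have der: "((\<lambda>r. h (x + r *\<^sub>R b)) has_derivative (\<lambda>v. frechet_derivative h (at (x + r *\<^sub>R b)) (v *\<^sub>R b))) (at r)" for r
      by (rule has_derivative_compose[OF _ schwartz_derivative(1)[OF h], where f="\<lambda>r. x + r *\<^sub>R b", unfolded o_def])
         (auto intro!: derivative_eq_intros)
    have "\<exists>r\<in>{0<..<t}. cmod (h (x + t *\<^sub>R b) - h (x + 0 *\<^sub>R b)) \<le> cmod (frechet_derivative h (at (x + r *\<^sub>R b)) ((t - 0) *\<^sub>R b))"
      by (rule mvt_general[OF t(1)]) (use der in \<open>auto intro!: continuous_on_compose2[OF schwartz_continuous[OF h, of UNIV]] continuous_intros\<close>)
    then obtain r where r: "0 < r" "r < t"
      "cmod (h (x + t *\<^sub>R b) - h x) \<le> cmod (frechet_derivative h (at (x + r *\<^sub>R b)) (t *\<^sub>R b))"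
      by auto
    have lin: "linear (frechet_derivative h (at (x + r *\<^sub>R b)))"
      using schwartz_derivative(1)[OF h] has_derivative_linear by blast
    have "cmod (frechet_derivative h (at (x + r *\<^sub>R b)) (t *\<^sub>R b)) = t * cmod (?D (x + r *\<^sub>R b))"
      using t by (simp add: linear_scale[OF lin])
    also have "\<dots> \<le> t * (C * jap (x + r *\<^sub>R b) powr (- ?d))"
      using t by (intro mult_left_mono C) auto
    also have "jap (x + r *\<^sub>R b) powr (- ?d) \<le> (jap x / 3) powr (- ?d)"
    proof (rule powr_mono2')
      show "jap x / 3 \<le> jap (x + r *\<^sub>R b)"
        using jap_shift_le[of "r *\<^sub>R b" x] r t b by simp
    qed (use jap_pos[of x] in auto)
    also have "(jap x / 3) powr (- ?d) = 3 powr ?d * jap x powr (- ?d)"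
      using jap_pos[of x] by (simp add: powr_divide powr_minus field_simps)
    finally show ?thesis
      using r(3) t C(1) by (simp add: mult_ac)
  qed
  have "(\<lambda>n. LINT x|lborel. s n x) \<longlonglongrightarrow> (LINT x|lborel. ?D x)"
  proof (rule integral_dominated_convergence[where w="\<lambda>x. (C * 3 powr ?d) * jap x powr (- ?d)"])
    show "integrable lborel (\<lambda>x::'a. (C * 3 powr ?d) * jap x powr (- ?d))"
      by (intro integrable_mult_right integrable_jap)
    show "s n \<in> borel_measurable lborel" for n
      unfolding s_def by measurable
    show "AE x in lborel. (\<lambda>n. s n x) \<longlonglongrightarrow> ?D x"
    proof (rule AE_I2)
      fix x
      let ?y = "\<lambda>n. x + (1 / real (Suc n)) *\<^sub>R b"
      have lin: "linear (frechet_derivative h (at x))"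
        using schwartz_derivative(1)[OF h] has_derivative_linear by blast
      have "(\<lambda>n. 1 / real (Suc n)) \<longlonglongrightarrow> 0"
        using LIMSEQ_Suc[OF lim_1_over_n] by simp
      then have "?y \<longlonglongrightarrow> x + 0 *\<^sub>R b"
        by (intro tendsto_intros)
      moreover have "b \<noteq> 0" using b by auto
      ultimately have "filterlim ?y (at x) sequentially"
        unfolding filterlim_at by simp
      moreover have "((\<lambda>y. (1 / norm (y - x)) *\<^sub>R (h y - (h x + frechet_derivative h (at x) (y - x)))) \<longlongrightarrow> 0) (at x)"
        using schwartz_derivative(1)[OF h, of x] by (simp add: has_derivative_within)
      ultimately have "(\<lambda>n. (1 / norm (?y n - x)) *\<^sub>R (h (?y n) - (h x + frechet_derivative h (at x) (?y n - x)))) \<longlonglongrightarrow> 0"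
        by (rule filterlim_compose[rotated])
      moreover have "(1 / norm (?y n - x)) *\<^sub>R (h (?y n) - (h x + frechet_derivative h (at x) (?y n - x))) = s n x - ?D x" for n
        using b by (simp add: s_def linear_scale[OF lin] scaleR_conv_of_real algebra_simps del: of_nat_Suc)
      ultimately have "(\<lambda>n. s n x - ?D x) \<longlonglongrightarrow> 0" by simp
      then show "(\<lambda>n. s n x) \<longlonglongrightarrow> ?D x" by (simp add: LIM_zero_iff)
    qed
    show "AE x in lborel. norm (s n x) \<le> (C * 3 powr ?d) * jap x powr (- ?d)" for n
    proof (rule AE_I2)
      fix x
      show "norm (s n x) \<le> (C * 3 powr ?d) * jap x powr (- ?d)"
      proof -
        have "norm (s n x) = real (Suc n) * cmod (h (x + (1 / real (Suc n)) *\<^sub>R b) - h x)"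
          by (simp add: s_def norm_mult del: of_nat_Suc)
        also have "\<dots> \<le> real (Suc n) * ((1 / real (Suc n)) * (C * 3 powr ?d * jap x powr (- ?d)))"
          by (intro mult_left_mono shift) auto
        finally show ?thesis by (simp del: of_nat_Suc)
      qed
    qed
  qed simp
  moreover have "(LINT x|lborel. s n x) = 0" for n
  proof -
    have i: "integrable lborel (\<lambda>x. h (x + v))" for v
    proof -
      have "integrable (distr lborel borel ((+) v)) h"
        using schwartz_integrable[OF h] by (simp only: lborel_distr_plus)
      then have "integrable lborel (\<lambda>x. h (v + x))"
        by (subst (asm) integrable_distr_eq) auto
      then show ?thesis by (simp add: add.commute)
    qed
    have "(LINT x|lborel. h (x + v)) = (LINT x|lborel. h x)" for v
      using integral_lborel_translate[of h v] by (simp add: add.commute)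
    then show ?thesis
      unfolding s_def by (simp add: i schwartz_integrable[OF h] Bochner_Integration.integral_diff)
  qed
  ultimately have "(\<lambda>n. 0) \<longlonglongrightarrow> (LINT x|lborel. ?D x)" by simp
  then show ?thesis by (rule LIMSEQ_unique) (rule tendsto_const)
qed

section \<open>The Fourier kernel and derivatives of the transform\<close>

definition fker :: "'a::euclidean_space \<Rightarrow> 'a \<Rightarrow> complex" where
  "fker \<xi> x = exp (- \<i> * complex_of_real (\<xi> \<bullet> x))"

abbreviation fconst :: "'a::euclidean_space itself \<Rightarrow> real" where
  "fconst _ \<equiv> (2 * pi) powr (- real DIM('a) / 2)"

lemma fourier_eq: "fourier f \<xi> = complex_of_real (fconst TYPE('a)) * (LINT x|lborel. fker \<xi> x * f x)"
  for \<xi> :: "'a::euclidean_space"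
  by (simp add: fourier_def fker_def)

lemma norm_fker [simp]: "cmod (fker \<xi> x) = 1"
  by (simp add: fker_def)

lemma continuous_fker: "continuous_on S (fker \<xi>)"
  unfolding fker_def by (intro continuous_intros)

lemma fker_commute: "fker \<xi> x = fker x \<xi>"
  by (simp add: fker_def inner_commute)

lemma borel_fker [measurable]: "fker \<xi> \<in> borel_measurable borel"
  by (intro borel_measurable_continuous_onI continuous_fker)

lemma borel_fker_pair [measurable]: "(\<lambda>(\<xi>, x). fker \<xi> x) \<in> borel_measurable (borel \<Otimes>\<^sub>M borel)"
  unfolding fker_def by measurable

lemma fker_add: "fker (\<xi> + \<eta>) x = fker \<xi> x * fker \<eta> x"
  by (simp add: fker_def inner_add_left exp_add[symmetric] algebra_simps)

lemma cnj_fker: "cnj (fker \<xi> x) = fker (- \<xi>) x"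
  by (simp add: fker_def exp_cnj)

lemma fker_0 [simp]: "fker 0 x = 1" "fker \<xi> 0 = 1"
  by (simp_all add: fker_def)

lemma fker_minus_minus: "fker (- \<xi>) x = fker \<xi> (- x)"
  by (simp add: fker_def)

lemma fker_has_derivative:
  "(fker \<xi> has_derivative (\<lambda>v. - \<i> * (complex_of_real (\<xi> \<bullet> v) * fker \<xi> x))) (at x)"
proof -
  have "((\<lambda>x. - \<i> * complex_of_real (\<xi> \<bullet> x)) has_derivative (\<lambda>v. - \<i> * complex_of_real (\<xi> \<bullet> v))) (at x)"
    by (intro has_derivative_mult_right has_derivative_of_real) (auto intro!: derivative_eq_intros)
  from has_derivative_compose[OF this DERIV_exp[unfolded has_field_derivative_def]]
  moreover have "fker \<xi> = (\<lambda>x. exp (- \<i> * complex_of_real (\<xi> \<bullet> x)))"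
    by (simp add: fun_eq_iff fker_def)
  ultimately show ?thesis by (simp add: mult_ac)
qed

text \<open>The frequency is fixed, so its size goes into the constants. A derivative of the kernel
  is a multiple of the kernel, and the weight stays 0.\<close>

lemma dbound_fker: "dbound n I 0 (\<lambda>i. fker \<xi>)"
proof (induction n)
  have base: "dbound 0 I 0 (\<lambda>i. fker \<xi>)"
    by (auto intro!: exI[of _ 1] simp: jap_pos[THEN less_imp_neq, symmetric])
  {
    case 0
    show ?case by (rule base)
  next
    case (Suc n)
    show ?case
      by (rule dbound_SucI[OF base fker_has_derivative])
         (intro dbound_cmult Suc)
  }
qed

lemma schwartz_fker: "f \<in> schwartz \<Longrightarrow> (\<lambda>x. f x * fker \<xi> x) \<in> schwartz"
  by (rule schwartz_mult) (assumption, rule exI, rule dbound_fker)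

lemma integrable_fker:
  assumes "integrable lborel f"
  shows "integrable lborel (\<lambda>x. fker \<xi> x * f x)"
proof (rule Bochner_Integration.integrable_bound[OF assms])
  have [measurable]: "f \<in> borel_measurable borel"
    using borel_measurable_integrable[OF assms] by simp
  show "(\<lambda>x. fker \<xi> x * f x) \<in> borel_measurable lborel" by measurable
qed (simp add: norm_mult)

lemma fourier_lincomb:
  assumes "f \<in> schwartz" "h \<in> schwartz"
  shows "fourier (\<lambda>x. a * f x + b * h x) = (\<lambda>\<xi>. a * fourier f \<xi> + b * fourier h \<xi>)"
proof
  fix \<xi>
  have "(LINT x|lborel. fker \<xi> x * (a * f x + b * h x))
      = (LINT x|lborel. a * (fker \<xi> x * f x) + b * (fker \<xi> x * h x))"
    by (simp add: algebra_simps)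
  also have "\<dots> = a * (LINT x|lborel. fker \<xi> x * f x) + b * (LINT x|lborel. fker \<xi> x * h x)"
    using assms by (simp add: integrable_fker schwartz_integrable)
  finally show "fourier (\<lambda>x. a * f x + b * h x) \<xi> = a * fourier f \<xi> + b * fourier h \<xi>"
    by (simp add: fourier_eq algebra_simps)
qed

lemma fourier_cmult: "fourier (\<lambda>x. a * f x) \<xi> = a * fourier f \<xi>"
proof -
  have "(LINT x|lborel. fker \<xi> x * (a * f x)) = a * (LINT x|lborel. fker \<xi> x * f x)"
    by (simp flip: integral_mult_right_zero add: mult_ac)
  then show ?thesis by (simp add: fourier_eq mult_ac)
qed

lemma fourier_bound:
  fixes f :: "'a::euclidean_space \<Rightarrow> complex"
  assumes "f \<in> borel_measurable borel" "\<And>x. cmod (f x) \<le> C * jap x powr (- real DIM('a))"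
  shows "cmod (fourier f \<xi>) \<le> fconst TYPE('a) * (C * (LINT x::'a|lborel. jap x powr (- real DIM('a))))"
proof -
  have "cmod (LINT x|lborel. fker \<xi> x * f x) \<le> C * (LINT x::'a|lborel. jap x powr (- real DIM('a)))"
    by (rule integral_decay_bound) (use assms in \<open>auto simp: norm_mult\<close>)
  then show ?thesis
    by (simp add: fourier_eq norm_mult mult_left_mono)
qed

text \<open>Differentiation under the integral with an explicit remainder: the Taylor error of exp
  at order one is at most half the square of \<open>v \<bullet> x\<close>, so the error of the
  transform is |v|^2 times a second moment of \<open>f\<close>.\<close>

lemma fourier_has_derivative:
  fixes f :: "'a::euclidean_space \<Rightarrow> complex"
  assumes f: "f \<in> schwartz"
  shows "(fourier f has_derivative (\<lambda>v. fourier (\<lambda>x. - \<i> * complex_of_real (v \<bullet> x) * f x) \<xi>)) (at \<xi>)"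
proof (rule has_derivativeI_sandwich[of 1])
  note [measurable] = schwartz_borel[OF f]
  let ?c = "fconst TYPE('a)"
  define K where "K = (LINT x|lborel. norm x ^ 2 * cmod (f x))"
  let ?D = "\<lambda>v. fourier (\<lambda>x. - \<i> * complex_of_real (v \<bullet> x) * f x) \<xi>"
  have int1: "integrable lborel (\<lambda>x. fker \<xi> x * (- \<i> * complex_of_real (v \<bullet> x) * f x))" for v
  proof (rule Bochner_Integration.integrable_bound[OF integrable_mult_right[OF schwartz_integrable_moment[OF f, of 1], of "norm v"]])
    show "AE x in lborel. cmod (fker \<xi> x * (- \<i> * complex_of_real (v \<bullet> x) * f x)) \<le> norm (norm v * (norm x ^ 1 * cmod (f x)))"
      using Cauchy_Schwarz_ineq2[of v]
      by (intro AE_I2) (auto simp: norm_mult mult.assoc[symmetric] intro!: mult_right_mono)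
  qed measurable
  have int2: "integrable lborel (\<lambda>x. fker \<eta> x * f x)" for \<eta>
    by (intro integrable_fker schwartz_integrable f)
  show "bounded_linear ?D"
  proof (rule linear_conv_bounded_linear[THEN iffD1], rule linearI)
    fix u v :: 'a and r :: real
    have "(LINT x|lborel. fker \<xi> x * (- \<i> * complex_of_real ((u + v) \<bullet> x) * f x))
      = (LINT x|lborel. fker \<xi> x * (- \<i> * complex_of_real (u \<bullet> x) * f x) + fker \<xi> x * (- \<i> * complex_of_real (v \<bullet> x) * f x))"
      by (simp add: inner_add_left algebra_simps)
    also have "\<dots> = (LINT x|lborel. fker \<xi> x * (- \<i> * complex_of_real (u \<bullet> x) * f x)) + (LINT x|lborel. fker \<xi> x * (- \<i> * complex_of_real (v \<bullet> x) * f x))"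
      by (intro Bochner_Integration.integral_add int1)
    finally show "?D (u + v) = ?D u + ?D v"
      by (simp only: fourier_eq distrib_left)
    have "(\<lambda>x. - \<i> * complex_of_real ((r *\<^sub>R v) \<bullet> x) * f x) = (\<lambda>x. of_real r * (- \<i> * complex_of_real (v \<bullet> x) * f x))"
      by (simp add: fun_eq_iff)
    then show "?D (r *\<^sub>R v) = r *\<^sub>R ?D v"
      by (simp only: fourier_cmult scaleR_conv_of_real)
  qed
  show "(0::real) < 1" by simp
  show "((\<lambda>\<eta>. ?c * K / 2 * norm (\<eta> - \<xi>)) \<longlongrightarrow> 0) (at \<xi>)"
    by (auto intro!: tendsto_eq_intros)
  fix \<eta> assume "\<eta> \<noteq> \<xi>"
  define v where "v = \<eta> - \<xi>"
  have v: "v \<noteq> 0" "\<eta> = \<xi> + v" using \<open>\<eta> \<noteq> \<xi>\<close> by (auto simp: v_def)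
  have *: "fourier f \<eta> - fourier f \<xi> - ?D v
      = ?c * (LINT x|lborel. fker \<xi> x * f x * (fker v x - 1 + \<i> * complex_of_real (v \<bullet> x)))"
  proof -
    have "(LINT x|lborel. fker \<xi> x * f x * (fker v x - 1 + \<i> * complex_of_real (v \<bullet> x)))
      = (LINT x|lborel. (fker \<eta> x * f x - fker \<xi> x * f x) - fker \<xi> x * (- \<i> * complex_of_real (v \<bullet> x) * f x))"
      by (simp add: v(2) fker_add algebra_simps)
    also have "\<dots> = (LINT x|lborel. fker \<eta> x * f x) - (LINT x|lborel. fker \<xi> x * f x)
        - (LINT x|lborel. fker \<xi> x * (- \<i> * complex_of_real (v \<bullet> x) * f x))"
      by (subst Bochner_Integration.integral_diff[OF Bochner_Integration.integrable_diff[OF int2 int2] int1])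
         (simp only: Bochner_Integration.integral_diff[OF int2 int2])
    finally show ?thesis by (simp only: fourier_eq right_diff_distrib)
  qed
  have taylor: "cmod (fker v x - 1 + \<i> * complex_of_real (v \<bullet> x)) \<le> (norm v)\<^sup>2 / 2 * (norm x)\<^sup>2" for x
  proof -
    have "cmod (fker v x - 1 + \<i> * complex_of_real (v \<bullet> x)) \<le> \<bar>- (v \<bullet> x)\<bar>\<^sup>2 / 2"
      using iexp_approx1[of "- (v \<bullet> x)" 1] by (simp add: fker_def numeral_2_eq_2 algebra_simps)
    also have "\<dots> \<le> (norm v * norm x)\<^sup>2 / 2"
      using Cauchy_Schwarz_ineq2[of v x] by (intro divide_right_mono power_mono) auto
    finally show ?thesis by (simp add: power_mult_distrib)
  qed
  have "cmod (LINT x|lborel. fker \<xi> x * f x * (fker v x - 1 + \<i> * complex_of_real (v \<bullet> x)))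
      \<le> (LINT x|lborel. (norm v)\<^sup>2 / 2 * (norm x ^ 2 * cmod (f x)))"
  proof (rule Bochner_Integration.integral_norm_bound_integral)
    show int: "integrable lborel (\<lambda>x. (norm v)\<^sup>2 / 2 * (norm x ^ 2 * cmod (f x)))"
      by (intro integrable_mult_right schwartz_integrable_moment f)
    show le: "cmod (fker \<xi> x * f x * (fker v x - 1 + \<i> * complex_of_real (v \<bullet> x))) \<le> (norm v)\<^sup>2 / 2 * (norm x ^ 2 * cmod (f x))" for x
      using mult_right_mono[OF taylor[of x], of "cmod (f x)"] by (simp add: norm_mult mult_ac)
    show "integrable lborel (\<lambda>x. fker \<xi> x * f x * (fker v x - 1 + \<i> * complex_of_real (v \<bullet> x)))"
      by (rule Bochner_Integration.integrable_bound[OF int])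
         (measurable, intro AE_I2 order_trans[OF le], simp)
  qed
  also have "\<dots> = (norm v)\<^sup>2 / 2 * K" by (simp add: K_def)
  finally have "cmod (fourier f \<eta> - fourier f \<xi> - ?D v) \<le> ?c * ((norm v)\<^sup>2 / 2 * K)"
    unfolding * by (simp add: norm_mult mult_left_mono)
  then have "cmod (fourier f \<eta> - fourier f \<xi> - ?D v) / norm v \<le> ?c * ((norm v)\<^sup>2 / 2 * K) / norm v"
    by (rule divide_right_mono) simp
  also have "\<dots> = ?c * K / 2 * norm v"
    using v by (simp add: power2_eq_square)
  finally show "cmod (fourier f \<eta> - fourier f \<xi> - ?D (\<eta> - \<xi>)) / norm (\<eta> - \<xi>) \<le> ?c * K / 2 * norm (\<eta> - \<xi>)"
    by (simp add: v_def)
qed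

text \<open>The derivative of f times the kernel integrates to 0; the product rule splits this
  integral into the two sides.\<close>

lemma fourier_of_derivative:
  assumes f: "f \<in> schwartz" and b: "b \<in> Basis"
  shows "fourier (\<lambda>x. frechet_derivative f (at x) b) \<xi> = \<i> * complex_of_real (\<xi> \<bullet> b) * fourier f \<xi>"
proof -
  let ?h = "\<lambda>x. f x * fker \<xi> x"
  have "(?h has_derivative (\<lambda>v. f x * (- \<i> * (complex_of_real (\<xi> \<bullet> v) * fker \<xi> x))
      + frechet_derivative f (at x) v * fker \<xi> x)) (at x)" for x
    by (intro has_derivative_mult schwartz_derivative f fker_has_derivative)
  note D = frechet_derivative_at[OF this, symmetric]
  have "0 = (LINT x|lborel. frechet_derivative ?h (at x) b)"
    using integral_schwartz_derivative[OF schwartz_fker[OF f] b] by simp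
  also have "\<dots> = (LINT x|lborel. fker \<xi> x * frechet_derivative f (at x) b - \<i> * complex_of_real (\<xi> \<bullet> b) * (fker \<xi> x * f x))"
    by (simp add: D mult_ac)
  also have "\<dots> = (LINT x|lborel. fker \<xi> x * frechet_derivative f (at x) b) - \<i> * complex_of_real (\<xi> \<bullet> b) * (LINT x|lborel. fker \<xi> x * f x)"
    using f schwartz_derivative(2)[OF f b]
    by (simp add: integrable_fker schwartz_integrable)
  finally show ?thesis
    by (simp add: fourier_eq)
qed

section \<open>Decay and continuity of the Fourier transform\<close>

lemma jap_eq_sum: "complex_of_real (jap \<xi>) = 1 + (\<Sum>b\<in>Basis. (complex_of_real (\<xi> \<bullet> b))\<^sup>2)"
proof -
  have "jap \<xi> = 1 + (\<Sum>b\<in>Basis. (\<xi> \<bullet> b)\<^sup>2)"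
    unfolding jap_def power2_norm_eq_inner by (subst euclidean_inner) (simp add: power2_eq_square)
  then show ?thesis by simp
qed

text \<open>Multiplying the transform by \<open>jap \<xi>\<close> amounts to transforming f minus
  its Laplacian. Every power of \<open>jap\<close> thus costs two derivatives, hence
  \<open>2 * k\<close>, while the weight \<open>- real DIM('a)\<close> keeps all those derivatives
  integrable.\<close>

lemma fourier_dbound_0:
  fixes F :: "'i \<Rightarrow> 'a::euclidean_space \<Rightarrow> complex"
  assumes "\<And>i. i \<in> I \<Longrightarrow> F i \<in> schwartz" "dbound (2 * k) I (- real DIM('a)) F"
  shows "dbound 0 I (- real k) (\<lambda>i. fourier (F i))"
  using assms
proof (induction k arbitrary: F)
  case 0
  then obtain C where C: "C > 0" "\<And>i x. i \<in> I \<Longrightarrow> cmod (F i x) \<le> C * jap x powr (- real DIM('a))"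
    using dbound_E by blast
  have "cmod (fourier (F i) \<xi>) \<le> fconst TYPE('a) * (C * (LINT x::'a|lborel. jap x powr (- real DIM('a))))"
    if "i \<in> I" for i \<xi>
    by (rule fourier_bound) (use 0 C that schwartz_borel in auto)
  then show ?case
    by (auto simp: jap_pos[THEN less_imp_neq, symmetric])
next
  case (Suc k)
  let ?D = "\<lambda>b i x. frechet_derivative (F i) (at x) b"
  let ?D2 = "\<lambda>b i x. frechet_derivative (?D b i) (at x) b"
  have D: "?D b i \<in> schwartz" "?D2 b i \<in> schwartz" if "i \<in> I" "b \<in> Basis" for i b
    using schwartz_derivative(2) Suc.prems(1) that by blast+
  have b0: "dbound (Suc (Suc (2 * k))) I (- real DIM('a)) F"
    using Suc.prems(2) by simp
  have "dbound 0 I (- real k) (\<lambda>i. fourier (F i))"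
    using Suc.prems(1) dbound_Suc_D[OF dbound_Suc_D[OF b0]] by (rule Suc.IH)
  then obtain C0 where C0: "\<And>i \<xi>. i \<in> I \<Longrightarrow> cmod (fourier (F i) \<xi>) \<le> C0 * jap \<xi> powr (- real k)"
    by auto
  have "dbound 0 I (- real k) (\<lambda>i. fourier (?D2 b i))" if "b \<in> Basis" for b
    using D(2)[OF _ that] dbound_SucD(2)[OF dbound_SucD(2)[OF b0 that] that] by (rule Suc.IH)
  then have "\<exists>C. \<forall>i\<in>I. \<forall>\<xi>. cmod (fourier (?D2 b i) \<xi>) \<le> C * jap \<xi> powr (- real k)" if "b \<in> Basis" for b
    using that by simp
  then obtain C where C: "\<And>b i \<xi>. b \<in> Basis \<Longrightarrow> i \<in> I \<Longrightarrow> cmod (fourier (?D2 b i) \<xi>) \<le> C b * jap \<xi> powr (- real k)"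
    by metis
  have D2: "fourier (?D2 b i) \<xi> = - (complex_of_real (\<xi> \<bullet> b))\<^sup>2 * fourier (F i) \<xi>"
    if "b \<in> Basis" "i \<in> I" for b i \<xi>
    using fourier_of_derivative[OF D(1)[OF that(2,1)] that(1)] fourier_of_derivative[OF Suc.prems(1)[OF that(2)] that(1)]
    by (simp add: power2_eq_square mult_ac)
  have "cmod (fourier (F i) \<xi>) \<le> (C0 + sum C Basis) * jap \<xi> powr (- real (Suc k))" if i: "i \<in> I" for i \<xi>
  proof -
    have "complex_of_real (jap \<xi>) * fourier (F i) \<xi> = fourier (F i) \<xi> - (\<Sum>b\<in>Basis. fourier (?D2 b i) \<xi>)"
      using i by (simp add: D2 jap_eq_sum sum_negf distrib_right flip: sum_distrib_right)
    then have "jap \<xi> * cmod (fourier (F i) \<xi>) = cmod (fourier (F i) \<xi> - (\<Sum>b\<in>Basis. fourier (?D2 b i) \<xi>))"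
      using jap_pos[of \<xi>] by (metis norm_mult norm_of_real abs_of_pos)
    also have "\<dots> \<le> cmod (fourier (F i) \<xi>) + (\<Sum>b\<in>Basis. cmod (fourier (?D2 b i) \<xi>))"
      by (rule order_trans[OF norm_triangle_ineq4]) (intro add_left_mono norm_sum)
    also have "\<dots> \<le> C0 * jap \<xi> powr (- real k) + (\<Sum>b\<in>Basis. C b * jap \<xi> powr (- real k))"
      using i by (intro add_mono sum_mono C C0)
    also have "\<dots> = (C0 + sum C Basis) * jap \<xi> powr (- real k)"
      by (simp add: distrib_right sum_distrib_right)
    finally have "cmod (fourier (F i) \<xi>) \<le> (C0 + sum C Basis) * jap \<xi> powr (- real k) / jap \<xi>"
      using jap_pos[of \<xi>] by (simp add: field_simps)
    also have "\<dots> = (C0 + sum C Basis) * jap \<xi> powr (- real (Suc k))"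
      by (simp only: jap_powr_minus_nat) simp
    finally show ?thesis .
  qed
  then show ?case by auto
qed

text \<open>A derivative of the transform is the transform of a coordinate multiple. That costs
  weight 1/2; a whole unit per derivative is reserved so that the exponents remain integers.\<close>

lemma fourier_dbound:
  fixes F :: "'i \<Rightarrow> 'a::euclidean_space \<Rightarrow> complex"
  assumes "\<And>i. i \<in> I \<Longrightarrow> F i \<in> schwartz" "dbound (2 * k) I (- real DIM('a) - real n) F"
  shows "dbound n I (- real k) (\<lambda>i. fourier (F i))"
  using assms
proof (induction n arbitrary: F)
  case 0
  then show ?case by (intro fourier_dbound_0) auto
next
  case (Suc n)
  have *: "dbound (2 * k) I (- real DIM('a)) F"
    using Suc.prems(2) by (rule dbound_weaken) simp
  have "dbound 0 I (- real k) (\<lambda>i. fourier (F i))"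
    by (rule fourier_dbound_0[OF Suc.prems(1) *])
  then show ?case
  proof (rule dbound_SucI)
    show "(fourier (F i) has_derivative (\<lambda>v. fourier (\<lambda>x. - \<i> * complex_of_real (v \<bullet> x) * F i x) \<xi>)) (at \<xi>)"
      if "i \<in> I" for i \<xi>
      by (rule fourier_has_derivative[OF Suc.prems(1)[OF that]])
    fix b :: 'a assume b: "b \<in> Basis"
    have eq: "(\<lambda>x. - \<i> * complex_of_real (b \<bullet> x) * F i x) = (\<lambda>x. - \<i> * (F i x * complex_of_real (x \<bullet> b)))" for i
      by (simp add: mult_ac inner_commute)
    have "dbound n I (- real k) (\<lambda>i. fourier (\<lambda>x. - \<i> * (F i x * complex_of_real (x \<bullet> b))))"
    proof (rule Suc.IH)
      show "(\<lambda>x. - \<i> * (F i x * complex_of_real (x \<bullet> b))) \<in> schwartz" if "i \<in> I" for i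
        by (intro schwartz_cmult schwartz_coord Suc.prems(1) that b)
      have "dbound (2 * k) I ((- real DIM('a) - real (Suc n)) + 1/2) (\<lambda>i x. F i x * complex_of_real (x \<bullet> b))"
        by (intro dbound_mult Suc.prems(2) dbound_coord b)
      then show "dbound (2 * k) I (- real DIM('a) - real n) (\<lambda>i x. - \<i> * (F i x * complex_of_real (x \<bullet> b)))"
        by (intro dbound_cmult) (rule dbound_weaken, assumption, simp)
    qed
    then show "dbound n I (- real k) (\<lambda>i \<xi>. fourier (\<lambda>x. - \<i> * complex_of_real (b \<bullet> x) * F i x) \<xi>)"
      by (simp only: eq)
  qed
qed

lemma fourier_schwartz: "f \<in> schwartz \<Longrightarrow> fourier f \<in> schwartz"
  for f :: "'a::euclidean_space \<Rightarrow> complex"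
proof -
  assume f: "f \<in> schwartz"
  show ?thesis
    unfolding schwartz_iff_dbound
  proof (intro allI)
    fix n w
    obtain k :: nat where k: "- w \<le> real k" using real_arch_simple by blast
    have "dbound n (UNIV :: unit set) (- real k) (\<lambda>i. fourier f)"
      by (rule fourier_dbound) (use f schwartzD in auto)
    then show "dbound n UNIV w (single (fourier f))"
      by (rule dbound_weaken) (use k in simp)
  qed
qed

lemma gauge_norm_scale:
  assumes f: "f \<in> schwartz" and t: "t > 0"
  shows "gauge_norm n k (\<lambda>x. complex_of_real t * f x) = t * gauge_norm n k f"
proof (rule antisym)
  show "gauge_norm n k (\<lambda>x. complex_of_real t * f x) \<le> t * gauge_norm n k f"
    using gauge_norm_cmult[OF f, of n k "complex_of_real t"] t by simp
  have "gauge_norm n k (\<lambda>x. complex_of_real (1 / t) * (complex_of_real t * f x)) \<le> (1 / t) * gauge_norm n k (\<lambda>x. complex_of_real t * f x)"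
    using gauge_norm_cmult[OF schwartz_cmult[OF f], of n k "complex_of_real (1 / t)" "complex_of_real t"] t
    by (simp only: norm_of_real abs_of_pos zero_less_divide_1_iff)
  moreover have "(\<lambda>x. complex_of_real (1 / t) * (complex_of_real t * f x)) = f"
    using t by simp
  ultimately show "t * gauge_norm n k f \<le> gauge_norm n k (\<lambda>x. complex_of_real t * f x)"
    using t by (simp only:) (simp add: field_simps)
qed

text \<open>\<open>fourier_dbound\<close> applied to the gauge unit ball as a family gives one
  constant for the whole ball, and homogeneity does the rest.\<close>

lemma fourier_gauge_bound:
  "\<exists>m l C. \<forall>f::'a::euclidean_space \<Rightarrow> complex. f \<in> schwartz \<longrightarrow>
    gauge_norm n k (fourier f) \<le> C * gauge_norm m l f"
proof -
  let ?m = "2 * k" and ?l = "DIM('a) + n"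
  let ?I = "{f\<in>schwartz. gauge_norm ?m ?l f \<le> 1} :: ('a \<Rightarrow> complex) set"
  have "dbound n ?I (- real k) (\<lambda>f. fourier f)"
    by (rule fourier_dbound) (use dbound_gauge_ball[of ?m ?l 1] in auto)
  then obtain C where C: "\<And>f. f \<in> ?I \<Longrightarrow> gauge_norm n k (fourier f) \<le> C"
    by (rule gauge_norm_bounded) blast
  have "gauge_norm n k (fourier f) \<le> C * gauge_norm ?m ?l f" if "f \<in> schwartz" for f :: "'a \<Rightarrow> complex"
  proof (rule homogeneous_gauge_bound[OF _ _ that])
    fix f :: "'a \<Rightarrow> complex" assume f: "f \<in> schwartz"
    show "gauge_norm n k (fourier f) \<le> C" if "gauge_norm ?m ?l f \<le> 1"
      using C f that by simp
    fix t :: real assume t: "t > 0"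
    have eq: "fourier (\<lambda>x. complex_of_real t * f x) = (\<lambda>x. complex_of_real t * fourier f x)"
      by (rule ext) (rule fourier_cmult)
    show "gauge_norm n k (fourier (\<lambda>x. complex_of_real t * f x)) = t * gauge_norm n k (fourier f)"
      unfolding eq by (rule gauge_norm_scale[OF fourier_schwartz[OF f] t])
  qed
  then show ?thesis by blast
qed

section \<open>Fourier inversion\<close>

lemma integral_lborel_affine:
  fixes f :: "'a::euclidean_space \<Rightarrow> complex"
  assumes [measurable]: "f \<in> borel_measurable borel" and "c > 0"
  shows "(LINT x|lborel. f x) = complex_of_real (c ^ DIM('a)) * (LINT v|lborel. f (t + c *\<^sub>R v))"
proof -
  have "(LINT x|lborel. f x) = (LINT x|density (distr lborel borel (\<lambda>v. t + c *\<^sub>R v)) (\<lambda>_. ennreal (c ^ DIM('a))). f x)"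
    using lborel_affine[of c t] \<open>c > 0\<close> by (simp add: abs_of_pos ennreal_power[symmetric])
  also have "\<dots> = (LINT x|distr lborel borel (\<lambda>v. t + c *\<^sub>R v). (c ^ DIM('a)) *\<^sub>R f x)"
    using \<open>c > 0\<close> by (intro integral_density) auto
  also have "\<dots> = (LINT v|lborel. (c ^ DIM('a)) *\<^sub>R f (t + c *\<^sub>R v))"
    by (subst integral_distr) auto
  finally show ?thesis by (simp add: scaleR_conv_of_real)
qed

lemma lborel_distr_reflect: "distr lborel borel uminus = (lborel :: 'a::euclidean_space measure)"
  by (subst lborel_affine[of "-1" 0]) (auto simp: density_1)

lemma integral_lborel_reflect:
  fixes f :: "'a::euclidean_space \<Rightarrow> complex"
  assumes [measurable]: "f \<in> borel_measurable borel"
  shows "(LINT x|lborel. f (- x)) = (LINT x|lborel. f x)"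
proof -
  have "(LINT x|lborel. f x) = (LINT x|distr lborel borel uminus. f x)"
    by (simp only: lborel_distr_reflect)
  also have "\<dots> = (LINT x|lborel. f (- x))"
    by (subst integral_distr) auto
  finally show ?thesis ..
qed

lemma integrable_lborel_tensor:
  fixes f :: "'a::euclidean_space \<Rightarrow> complex" and h :: "'b::euclidean_space \<Rightarrow> complex"
  assumes "integrable lborel f" "integrable lborel h"
  shows "integrable (lborel \<Otimes>\<^sub>M lborel) (\<lambda>(x, y). f x * h y)"
proof (rule lborel_pair.Fubini_integrable)
  have [measurable]: "f \<in> borel_measurable borel" "h \<in> borel_measurable borel"
    using assms by (auto dest: borel_measurable_integrable)
  show "(\<lambda>(x, y). f x * h y) \<in> borel_measurable (lborel \<Otimes>\<^sub>M lborel)" by measurable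
  show "integrable lborel (\<lambda>x. LINT y|lborel. cmod (case (x, y) of (x, y) \<Rightarrow> f x * h y))"
    using assms by (simp add: norm_mult)
  show "AE x in lborel. integrable lborel (\<lambda>y. case (x, y) of (x, y) \<Rightarrow> f x * h y)"
    using assms by simp
qed

text \<open>Fubini together with the symmetry of the kernel in its two arguments.\<close>

lemma fourier_multiplication:
  fixes f h :: "'a::euclidean_space \<Rightarrow> complex"
  assumes f: "f \<in> schwartz" and h: "h \<in> schwartz"
  shows "(LINT x|lborel. fourier f x * h x) = (LINT x|lborel. f x * fourier h x)"
proof -
  note [measurable] = schwartz_borel[OF f] schwartz_borel[OF h]
  let ?c = "complex_of_real (fconst TYPE('a))"
  have int: "integrable (lborel \<Otimes>\<^sub>M lborel) (\<lambda>(x, y). fker x y * (h x * f y))"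
    by (rule Bochner_Integration.integrable_bound[OF integrable_lborel_tensor[OF schwartz_integrable[OF h] schwartz_integrable[OF f]]])
       (auto simp: norm_mult)
  have "(LINT x|lborel. fourier f x * h x) = (LINT x|lborel. ?c * (LINT y|lborel. fker x y * (h x * f y)))"
    by (intro Bochner_Integration.integral_cong refl)
       (simp add: fourier_eq mult_ac flip: integral_mult_left_zero integral_mult_right_zero)
  also have "\<dots> = ?c * (LINT y|lborel. LINT x|lborel. fker x y * (h x * f y))"
    by (simp add: lborel_pair.Fubini_integral[OF int])
  also have "\<dots> = (LINT y|lborel. f y * fourier h y)"
    unfolding integral_mult_right_zero[symmetric]
    by (intro Bochner_Integration.integral_cong refl)
       (simp add: fourier_eq fker_commute mult_ac flip: integral_mult_left_zero integral_mult_right_zero)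
  finally show ?thesis .
qed

definition gaussian :: "'a::euclidean_space \<Rightarrow> complex" where
  "gaussian x = complex_of_real (exp (- (1/2) * (norm x)\<^sup>2))"

lemma gaussian_schwartz: "gaussian \<in> schwartz"
  unfolding schwartz_iff_dbound gaussian_def[abs_def] by (intro allI dbound_gauss) simp

lemma gaussian_1D:
  "integrable lborel (\<lambda>t. exp (- \<i> * complex_of_real (a * t)) * complex_of_real (exp (- (t\<^sup>2) / 2)))"
  "(LINT t|lborel. exp (- \<i> * complex_of_real (a * t)) * complex_of_real (exp (- (t\<^sup>2) / 2)))
    = complex_of_real (sqrt (2 * pi) * exp (- (a\<^sup>2) / 2))"
proof -
  have eq: "exp (- \<i> * complex_of_real (a * t)) * complex_of_real (exp (- (t\<^sup>2) / 2))
    = complex_of_real (sqrt (2 * pi)) * (std_normal_density t *\<^sub>R iexp (- a * t))" for t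
    by (simp add: std_normal_density_def scaleR_conv_of_real)
  have int: "integrable lborel (\<lambda>t. std_normal_density t *\<^sub>R iexp (- a * t))"
    by (rule Bochner_Integration.integrable_bound[OF integrable_normal_density[of 1 0]]) auto
  then show "integrable lborel (\<lambda>t. exp (- \<i> * complex_of_real (a * t)) * complex_of_real (exp (- (t\<^sup>2) / 2)))"
    unfolding eq by (rule integrable_mult_right)
  have "(LINT t|lborel. std_normal_density t *\<^sub>R iexp (- a * t)) = char std_normal_distribution (- a)"
    unfolding char_def by (subst integral_density) auto
  then show "(LINT t|lborel. exp (- \<i> * complex_of_real (a * t)) * complex_of_real (exp (- (t\<^sup>2) / 2)))
    = complex_of_real (sqrt (2 * pi) * exp (- (a\<^sup>2) / 2))"
    unfolding eq integral_mult_right_zero by (simp add: char_std_normal_distribution)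
qed

lemma exp_sum_Basis: "exp (\<Sum>b\<in>Basis. g b) = (\<Prod>b\<in>Basis. exp (g b))"
  for g :: "'a::euclidean_space \<Rightarrow> complex"
  by (rule exp_sum) simp

text \<open>Gaussian and kernel both factor over the coordinates. Each factor is the characteristic
  function of the standard normal law.\<close>

lemma fourier_gaussian: "fourier gaussian \<xi> = gaussian \<xi>"
  for \<xi> :: "'a::euclidean_space"
proof -
  have g: "gaussian x = (\<Prod>b\<in>Basis. complex_of_real (exp (- ((x \<bullet> b)\<^sup>2) / 2)))" for x :: 'a
  proof -
    have "- (1/2) * (norm x)\<^sup>2 = (\<Sum>b\<in>Basis. - ((x \<bullet> b)\<^sup>2) / 2)"
      unfolding power2_norm_eq_inner
      by (subst euclidean_inner) (simp add: power2_eq_square sum_negf sum_divide_distrib)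
    then show ?thesis
      unfolding gaussian_def by (simp only: exp_sum[OF finite_Basis] of_real_prod)
  qed
  have k: "fker \<xi> x = (\<Prod>b\<in>Basis. exp (- \<i> * complex_of_real ((\<xi> \<bullet> b) * (x \<bullet> b))))" for x
    unfolding fker_def exp_sum_Basis[symmetric] by (subst euclidean_inner) (simp add: sum_distrib_left)
  have "(LINT x|lborel. fker \<xi> x * gaussian x) = (LINT x|lborel. (\<Prod>b\<in>Basis.
      exp (- \<i> * complex_of_real ((\<xi> \<bullet> b) * (x \<bullet> b))) * complex_of_real (exp (- ((x \<bullet> b)\<^sup>2) / 2))))"
    by (simp only: g k prod.distrib)
  also have "\<dots> = (\<Prod>b\<in>Basis. complex_of_real (sqrt (2 * pi) * exp (- ((\<xi> \<bullet> b)\<^sup>2) / 2)))"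
    by (subst integral_lborel_prod[where f="\<lambda>b t. exp (- \<i> * complex_of_real ((\<xi> \<bullet> b) * t)) * complex_of_real (exp (- (t\<^sup>2) / 2))"])
       (simp_all only: gaussian_1D)
  also have "\<dots> = complex_of_real (sqrt (2 * pi) ^ DIM('a)) * gaussian \<xi>"
    by (simp add: g prod.distrib)
  also have "sqrt (2 * pi) ^ DIM('a) = (2 * pi) powr (real DIM('a) / 2)"
    by (simp add: powr_half_sqrt[symmetric] powr_power mult.commute)
  finally have "fourier gaussian \<xi> = complex_of_real (fconst TYPE('a) * (2 * pi) powr (real DIM('a) / 2)) * gaussian \<xi>"
    by (simp add: fourier_eq)
  then show ?thesis
    by (simp add: powr_add[symmetric])
qed

lemma fconst_inverse: "fconst TYPE('a::euclidean_space) * (2 * pi) powr (real DIM('a) / 2) = 1"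
  by (simp add: powr_add[symmetric])

lemma integral_gaussian:
  "(LINT x|lborel. gaussian (x::'a::euclidean_space)) = complex_of_real ((2 * pi) powr (real DIM('a) / 2))"
proof -
  have "complex_of_real (fconst TYPE('a)) * (LINT x|lborel. gaussian (x::'a)) = 1"
    using fourier_gaussian[of "0::'a"] by (simp add: fourier_eq gaussian_def)
  then have "complex_of_real ((2 * pi) powr (real DIM('a) / 2) * fconst TYPE('a)) * (LINT x|lborel. gaussian (x::'a)) = complex_of_real ((2 * pi) powr (real DIM('a) / 2))"
    by (simp only: of_real_mult mult.assoc) simp
  then show ?thesis by (simp only: mult.commute[of "(2 * pi) powr (real DIM('a) / 2)"] fconst_inverse) simp
qed

text \<open>A wide Gaussian inserted under the integral makes the factor beside
  \<open>fourier f\<close> a Schwartz function, so the multiplication formula applies and yields an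
  average of \<open>f\<close> against a narrow Gaussian at \<open>x\<close>. Both sides converge by
  dominated convergence as the width parameter \<open>e n\<close> tends to 0.\<close>

lemma fourier_inversion_integral:
  fixes f :: "'a::euclidean_space \<Rightarrow> complex"
  assumes f: "f \<in> schwartz"
  shows "(LINT \<xi>|lborel. fourier f \<xi> * fker (- x) \<xi>) = complex_of_real ((2 * pi) powr (real DIM('a) / 2)) * f x"
proof -
  note [measurable] = schwartz_borel[OF f] schwartz_borel[OF fourier_schwartz[OF f]] schwartz_borel[OF gaussian_schwartz]
  define e where "e n = 1 / real (Suc n)" for n
  have e: "e n > 0" for n by (simp add: e_def)
  have e0: "e \<longlonglongrightarrow> 0" unfolding e_def using LIMSEQ_Suc[OF lim_1_over_n] by simp
  let ?h = "\<lambda>n \<xi>. gaussian (e n *\<^sub>R \<xi>) * fker (- x) \<xi>"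
  have gs: "(\<lambda>\<xi>::'a. gaussian (e n *\<^sub>R \<xi>)) \<in> schwartz" for n
  proof -
    have "(\<lambda>\<xi>::'a. gaussian (e n *\<^sub>R \<xi>)) = (\<lambda>\<xi>. complex_of_real (exp (- ((e n)\<^sup>2 / 2) * (norm \<xi>)\<^sup>2)))"
      by (simp add: gaussian_def power_mult_distrib fun_eq_iff)
    moreover have "(\<lambda>\<xi>::'a. complex_of_real (exp (- ((e n)\<^sup>2 / 2) * (norm \<xi>)\<^sup>2))) \<in> schwartz"
      unfolding schwartz_iff_dbound by (intro allI dbound_gauss) (use e[of n] in simp)
    ultimately show ?thesis by simp
  qed
  \<comment> \<open>The transform of the damped character is a Gaussian of width \<open>e n\<close>
    about \<open>x\<close> with height \<open>e n ^ (- DIM('a))\<close>; the substitution y = x + e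
    v undoes both.\<close>
  have Fh: "complex_of_real (e n ^ DIM('a)) * fourier (?h n) (x + e n *\<^sub>R v) = gaussian v" for n v
  proof -
    have "(LINT \<xi>|lborel. fker v \<xi> * gaussian \<xi>)
        = complex_of_real (e n ^ DIM('a)) * (LINT \<xi>|lborel. fker v (0 + e n *\<^sub>R \<xi>) * gaussian (0 + e n *\<^sub>R \<xi>))"
      by (rule integral_lborel_affine) (auto simp: e)
    also have "(\<lambda>\<xi>. fker v (0 + e n *\<^sub>R \<xi>) * gaussian (0 + e n *\<^sub>R \<xi>)) = (\<lambda>\<xi>. fker (x + e n *\<^sub>R v) \<xi> * ?h n \<xi>)"
      by (simp add: fun_eq_iff fker_def exp_add[symmetric] inner_add_left algebra_simps)
    finally show ?thesis
      using fourier_gaussian[of v] by (simp add: fourier_eq mult_ac)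
  qed
  have "(LINT \<xi>|lborel. fourier f \<xi> * ?h n \<xi>) = (LINT v|lborel. f (x + e n *\<^sub>R v) * gaussian v)" for n
  proof -
    have [measurable]: "fourier (?h n) \<in> borel_measurable borel"
      by (intro schwartz_borel fourier_schwartz schwartz_fker gs)
    have "(LINT \<xi>|lborel. fourier f \<xi> * ?h n \<xi>) = (LINT y|lborel. f y * fourier (?h n) y)"
      by (intro fourier_multiplication f schwartz_fker gs)
    also have "\<dots> = complex_of_real (e n ^ DIM('a)) * (LINT v|lborel. f (x + e n *\<^sub>R v) * fourier (?h n) (x + e n *\<^sub>R v))"
      by (rule integral_lborel_affine) (auto simp: e)
    also have "\<dots> = (LINT v|lborel. f (x + e n *\<^sub>R v) * (complex_of_real (e n ^ DIM('a)) * fourier (?h n) (x + e n *\<^sub>R v)))"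
      unfolding integral_mult_right_zero[symmetric] by (simp only: mult.left_commute)
    also have "\<dots> = (LINT v|lborel. f (x + e n *\<^sub>R v) * gaussian v)"
      by (simp only: Fh)
    finally show ?thesis .
  qed
  moreover have "(\<lambda>n. LINT \<xi>|lborel. fourier f \<xi> * ?h n \<xi>) \<longlonglongrightarrow> (LINT \<xi>|lborel. fourier f \<xi> * fker (- x) \<xi>)"
  proof (rule integral_dominated_convergence[where w="\<lambda>\<xi>. cmod (fourier f \<xi>)"])
    show "integrable lborel (\<lambda>\<xi>. cmod (fourier f \<xi>))"
      by (intro integrable_norm schwartz_integrable fourier_schwartz f)
    show "AE \<xi> in lborel. (\<lambda>n. fourier f \<xi> * ?h n \<xi>) \<longlonglongrightarrow> fourier f \<xi> * fker (- x) \<xi>"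
    proof (rule AE_I2)
      fix \<xi> :: 'a
      have "(\<lambda>n. fourier f \<xi> * ?h n \<xi>) \<longlonglongrightarrow> fourier f \<xi> * (complex_of_real (exp (- (1/2) * (norm (0 *\<^sub>R \<xi>))\<^sup>2)) * fker (- x) \<xi>)"
        unfolding gaussian_def by (intro tendsto_intros e0)
      then show "(\<lambda>n. fourier f \<xi> * ?h n \<xi>) \<longlonglongrightarrow> fourier f \<xi> * fker (- x) \<xi>" by simp
    qed
    show "AE \<xi> in lborel. cmod (fourier f \<xi> * ?h n \<xi>) \<le> cmod (fourier f \<xi>)" for n
      by (intro AE_I2) (auto simp: norm_mult gaussian_def intro!: mult_left_le)
  qed measurable
  moreover have "(\<lambda>n. LINT v|lborel. f (x + e n *\<^sub>R v) * gaussian v) \<longlonglongrightarrow> (LINT v::'a|lborel. f x * gaussian v)"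
  proof -
    obtain C where C: "C > 0" "\<And>x. cmod (f x) \<le> C * jap x powr 0"
      using schwartz_decay[OF f] by blast
    have C': "cmod (f y) \<le> C" for y using C(2)[of y] jap_pos[of y] by simp
    show ?thesis
    proof (rule integral_dominated_convergence[where w="\<lambda>v::'a. C * cmod (gaussian v)"])
      show "integrable lborel (\<lambda>v::'a. C * cmod (gaussian v))"
        by (intro integrable_mult_right integrable_norm schwartz_integrable gaussian_schwartz)
      show "AE v in lborel. (\<lambda>n. f (x + e n *\<^sub>R v) * gaussian v) \<longlonglongrightarrow> f x * gaussian v"
      proof (rule AE_I2)
        fix v :: 'a
        have "(\<lambda>n. x + e n *\<^sub>R v) \<longlonglongrightarrow> x + 0 *\<^sub>R v" by (intro tendsto_intros e0)
        then have "(\<lambda>n. x + e n *\<^sub>R v) \<longlonglongrightarrow> x" by simp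
        with schwartz_continuous[OF f, of UNIV] have "(\<lambda>n. f (x + e n *\<^sub>R v)) \<longlonglongrightarrow> f x"
          by (rule continuous_on_tendsto_compose) auto
        then show "(\<lambda>n. f (x + e n *\<^sub>R v) * gaussian v) \<longlonglongrightarrow> f x * gaussian v"
          by (intro tendsto_intros)
      qed
      show "AE v in lborel. cmod (f (x + e n *\<^sub>R v) * gaussian v) \<le> C * cmod (gaussian v)" for n
        using C' by (intro AE_I2) (auto simp: norm_mult intro!: mult_right_mono)
    qed measurable
  qed
  ultimately have "(LINT \<xi>|lborel. fourier f \<xi> * fker (- x) \<xi>) = (LINT v::'a|lborel. f x * gaussian v)"
    using LIMSEQ_unique by auto
  then show ?thesis by (simp add: integral_gaussian)
qed

theorem fourier_fourier:
  fixes f :: "'a::euclidean_space \<Rightarrow> complex"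
  assumes f: "f \<in> schwartz"
  shows "fourier (fourier f) = reflect f"
proof
  fix x :: 'a
  have "fourier (fourier f) x = complex_of_real (fconst TYPE('a)) * (LINT \<xi>|lborel. fourier f \<xi> * fker (- (- x)) \<xi>)"
    by (simp add: fourier_eq mult.commute)
  also have "\<dots> = complex_of_real (fconst TYPE('a) * (2 * pi) powr (real DIM('a) / 2)) * f (- x)"
    unfolding fourier_inversion_integral[OF f] by simp
  finally show "fourier (fourier f) x = reflect f x"
    by (simp only: fconst_inverse reflect_def) simp
qed

lemma reflect_schwartz: "f \<in> schwartz \<Longrightarrow> reflect f \<in> schwartz"
  using fourier_schwartz[OF fourier_schwartz, of f] by (simp add: fourier_fourier)

lemma reflect_reflect [simp]: "reflect (reflect f) = f"
  by (simp add: reflect_def)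

lemma fourier_reflect: "f \<in> schwartz \<Longrightarrow> fourier (reflect f) = reflect (fourier f)"
  using fourier_fourier[OF fourier_schwartz, of f] by (simp add: fourier_fourier)

text \<open>\<open>fourier_inv\<close> is an \<open>inv_into\<close> and is determined once the
  transform is injective. Injectivity follows because the fourth iterate of the transform is the
  identity.\<close>

lemma fourier_inv_eq:
  assumes f: "f \<in> schwartz"
  shows "fourier_inv f = reflect (fourier f)"
  unfolding fourier_inv_def
proof (rule inv_into_f_eq)
  have *: "fourier (fourier (fourier (fourier f))) = f" if "f \<in> schwartz" for f :: "'a \<Rightarrow> complex"
    using that by (simp add: fourier_fourier fourier_schwartz reflect_schwartz fourier_reflect)
  show "inj_on fourier (schwartz :: ('a \<Rightarrow> complex) set)"
    by (rule inj_on_inverseI[where g="\<lambda>f. fourier (fourier (fourier f))"]) (rule *)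
  show "reflect (fourier f) \<in> schwartz"
    by (intro reflect_schwartz fourier_schwartz f)
  show "fourier (reflect (fourier f)) = f"
    using f by (simp add: fourier_reflect fourier_schwartz fourier_fourier)
qed

lemma fourier_inv_schwartz: "f \<in> schwartz \<Longrightarrow> fourier_inv f \<in> schwartz"
  by (simp add: fourier_inv_eq reflect_schwartz fourier_schwartz)

lemma fourier_fourier_inv: "f \<in> schwartz \<Longrightarrow> fourier (fourier_inv f) = f"
  by (simp add: fourier_inv_eq fourier_reflect fourier_schwartz fourier_fourier)

section \<open>Conjugates, convolutions and tensor products\<close>

lemma dbound_cnj: "dbound n I w F \<Longrightarrow> dbound n I w (\<lambda>i x. cnj (F i x))"
proof (induction n arbitrary: F)
  case (Suc n)
  have "dbound 0 I w (\<lambda>i x. cnj (F i x))" using Suc.prems by auto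
  then show ?case
    by (rule dbound_SucI[OF _ has_derivative_cnj[OF dbound_SucD(1)[OF Suc.prems]]])
       (auto intro!: Suc.IH dbound_SucD(2)[OF Suc.prems])
qed auto

lemma schwartz_cnj: "f \<in> schwartz \<Longrightarrow> (\<lambda>x. cnj (f x)) \<in> schwartz"
  by (simp add: schwartz_iff_dbound dbound_cnj)

lemma cnj_fourier: "cnj (fourier f \<xi>) = fourier (\<lambda>x. cnj (f x)) (- \<xi>)"
proof -
  have "cnj (LINT x|lborel. fker \<xi> x * f x) = (LINT x|lborel. cnj (fker \<xi> x * f x))"
    by (rule Bochner_Integration.integral_cnj[symmetric])
  then show ?thesis by (simp add: fourier_eq cnj_fker)
qed

lemma reflect_cnj_fourier: "reflect (\<lambda>x. cnj (fourier f x)) = fourier (\<lambda>x. cnj (f x))"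
  by (simp add: reflect_def cnj_fourier fun_eq_iff)

text \<open>The map y \<mapsto> \<open>fourier h (x - y)\<close> is itself the transform of
  \<open>k\<close>, a reflected and modulated \<open>h\<close>. The multiplication formula then
  moves the transform onto \<open>fourier f\<close>, where it becomes a reflection that a change of
  sign removes. The remaining integral lacks the normalizing factor of \<open>fourier\<close>, hence
  the constant.\<close>

lemma convolve_fourier:
  fixes f h :: "'a::euclidean_space \<Rightarrow> complex"
  assumes f: "f \<in> schwartz" and h: "h \<in> schwartz"
  shows "convolve (fourier f) (fourier h)
    = (\<lambda>x. complex_of_real ((2 * pi) powr (real DIM('a) / 2)) * fourier (\<lambda>y. f y * h y) x)"
proof
  fix x :: 'a
  note [measurable] = schwartz_borel[OF f] schwartz_borel[OF h]
  define k where "k = reflect (\<lambda>z. h z * fker x z)"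
  have k: "k \<in> schwartz"
    unfolding k_def by (intro reflect_schwartz schwartz_fker h)
  have Fk: "fourier k y = fourier h (x - y)" for y
  proof -
    have "(LINT z|lborel. fker y z * k z) = (LINT z|lborel. fker y (- z) * (h z * fker x z))"
      using integral_lborel_reflect[of "\<lambda>z. fker y (- z) * (h z * fker x z)"]
      by (simp add: k_def reflect_def)
    also have "\<dots> = (LINT z|lborel. fker (x - y) z * h z)"
      using fker_add[of x "- y"] by (simp add: fker_minus_minus[symmetric] mult_ac)
    finally show ?thesis by (simp add: fourier_eq)
  qed
  have "convolve (fourier f) (fourier h) x = (LINT y|lborel. fourier f y * fourier k y)"
    by (simp add: convolve_def Fk)
  also have "\<dots> = (LINT y|lborel. fourier (fourier f) y * k y)"
    by (intro fourier_multiplication[symmetric] fourier_schwartz f k)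
  also have "\<dots> = (LINT y|lborel. (f (- y) * h (- y)) * fker x (- y))"
    by (simp add: fourier_fourier[OF f] k_def reflect_def mult_ac)
  also have "\<dots> = (LINT y|lborel. (f y * h y) * fker x y)"
    by (rule integral_lborel_reflect) measurable
  also have "\<dots> = complex_of_real ((2 * pi) powr (real DIM('a) / 2) * fconst TYPE('a)) * (LINT y|lborel. (f y * h y) * fker x y)"
    by (simp only: mult.commute[of "(2 * pi) powr (real DIM('a) / 2)"] fconst_inverse) simp
  also have "\<dots> = complex_of_real ((2 * pi) powr (real DIM('a) / 2)) * fourier (\<lambda>y. f y * h y) x"
    by (simp add: fourier_eq mult_ac)
  finally show "convolve (fourier f) (fourier h) x = complex_of_real ((2 * pi) powr (real DIM('a) / 2)) * fourier (\<lambda>y. f y * h y) x" .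
qed

lemma fker_Pair: "fker (\<xi>, \<eta>) (x, y) = fker \<xi> x * fker \<eta> y"
  by (simp add: fker_def exp_add[symmetric] algebra_simps)

lemma fourier_tensor:
  fixes f :: "'a::euclidean_space \<Rightarrow> complex" and h :: "'b::euclidean_space \<Rightarrow> complex"
  assumes f: "f \<in> schwartz" and h: "h \<in> schwartz"
  shows "fourier (tensor f h) (\<xi>, \<eta>) = fourier f \<xi> * fourier h \<eta>"
proof -
  have int: "integrable (lborel \<Otimes>\<^sub>M lborel) (\<lambda>(x, y). (fker \<xi> x * f x) * (fker \<eta> y * h y))"
    by (intro integrable_lborel_tensor integrable_fker schwartz_integrable f h)
  have "(LINT p|lborel. fker (\<xi>, \<eta>) p * tensor f h p)
     = (LINT p|(lborel \<Otimes>\<^sub>M lborel). (case p of (x, y) \<Rightarrow> (fker \<xi> x * f x) * (fker \<eta> y * h y)))"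
    by (simp add: lborel_prod)
       (intro Bochner_Integration.integral_cong refl, auto simp: tensor_def fker_Pair)
  also have "\<dots> = (LINT x|lborel. LINT y|lborel. (fker \<xi> x * f x) * (fker \<eta> y * h y))"
    by (subst lborel_pair.integral_fst'[OF int, symmetric]) simp
  also have "\<dots> = (LINT x|lborel. fker \<xi> x * f x) * (LINT y|lborel. fker \<eta> y * h y)"
    by simp
  finally have *: "(LINT p|lborel. fker (\<xi>, \<eta>) p * tensor f h p)
    = (LINT x|lborel. fker \<xi> x * f x) * (LINT y|lborel. fker \<eta> y * h y)" .
  have "fconst TYPE('a \<times> 'b) = fconst TYPE('a) * fconst TYPE('b)"
    by (simp add: powr_add[symmetric] diff_divide_distrib)
  then show ?thesis
    unfolding fourier_eq * by (simp only: of_real_mult mult_ac)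
qed

section \<open>Square-integrable random variables\<close>

lemma square_integrable_iff_nn:
  "square_integrable P Y \<longleftrightarrow> Y \<in> borel_measurable P \<and> (\<integral>\<^sup>+ \<omega>. ennreal ((cmod (Y \<omega>))\<^sup>2) \<partial>P) < \<infinity>"
proof -
  have "integrable P (\<lambda>\<omega>. (cmod (Y \<omega>))\<^sup>2) \<longleftrightarrow> (\<integral>\<^sup>+ \<omega>. ennreal ((cmod (Y \<omega>))\<^sup>2) \<partial>P) < \<infinity>"
    if "Y \<in> borel_measurable P"
    using that by (subst integrable_iff_bounded) auto
  then show ?thesis by (auto simp: square_integrable_def)
qed

lemma nn_integral_square:
  "square_integrable P Y \<Longrightarrow> (\<integral>\<^sup>+ \<omega>. ennreal ((cmod (Y \<omega>))\<^sup>2) \<partial>P) = ennreal ((l2_norm P Y)\<^sup>2)"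
  by (subst nn_integral_eq_integral) (auto simp: square_integrable_def l2_norm_def)

lemma l2_norm_nonneg: "0 \<le> l2_norm P Y"
  by (simp add: l2_norm_def)

lemma l2_norm_square: "(l2_norm P Y)\<^sup>2 = (LINT \<omega>|P. (cmod (Y \<omega>))\<^sup>2)"
  by (simp add: l2_norm_def)

lemma square_integrable_cmult: "square_integrable P Y \<Longrightarrow> square_integrable P (\<lambda>\<omega>. c * Y \<omega>)"
  by (auto simp: square_integrable_def norm_mult power_mult_distrib)

lemma square_integrable_add:
  assumes "square_integrable P Y" "square_integrable P Z"
  shows "square_integrable P (\<lambda>\<omega>. Y \<omega> + Z \<omega>)"
proof -
  have [measurable]: "Y \<in> borel_measurable P" "Z \<in> borel_measurable P"
    using assms by (auto simp: square_integrable_def)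
  have "integrable P (\<lambda>\<omega>. (cmod (Y \<omega> + Z \<omega>))\<^sup>2)"
  proof (rule Bochner_Integration.integrable_bound)
    show "integrable P (\<lambda>\<omega>. 2 * (cmod (Y \<omega>))\<^sup>2 + 2 * (cmod (Z \<omega>))\<^sup>2)"
      using assms by (auto simp: square_integrable_def)
    show "AE \<omega> in P. norm ((cmod (Y \<omega> + Z \<omega>))\<^sup>2) \<le> norm (2 * (cmod (Y \<omega>))\<^sup>2 + 2 * (cmod (Z \<omega>))\<^sup>2)"
    proof (rule AE_I2)
      fix \<omega>
      have "(cmod (Y \<omega> + Z \<omega>))\<^sup>2 \<le> (cmod (Y \<omega>) + cmod (Z \<omega>))\<^sup>2"
        by (intro power_mono norm_triangle_ineq) auto
      also have "\<dots> \<le> 2 * (cmod (Y \<omega>))\<^sup>2 + 2 * (cmod (Z \<omega>))\<^sup>2"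
        using sum_squares_bound[of "cmod (Y \<omega>)" "cmod (Z \<omega>)"] by (simp add: power2_sum)
      finally show "norm ((cmod (Y \<omega> + Z \<omega>))\<^sup>2) \<le> norm (2 * (cmod (Y \<omega>))\<^sup>2 + 2 * (cmod (Z \<omega>))\<^sup>2)"
        by simp
    qed
  qed measurable
  then show ?thesis by (simp add: square_integrable_def)
qed

lemma square_integrable_diff:
  "square_integrable P Y \<Longrightarrow> square_integrable P Z \<Longrightarrow> square_integrable P (\<lambda>\<omega>. Y \<omega> - Z \<omega>)"
  using square_integrable_add[of P Y "\<lambda>\<omega>. -1 * Z \<omega>"] square_integrable_cmult[of P Z "-1"] by simp

lemma ennreal_power2_le_imp_le:
  assumes "x\<^sup>2 \<le> (ennreal a)\<^sup>2" "0 \<le> a"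
  shows "x \<le> ennreal a"
proof (cases x)
  case (real y)
  then have "y\<^sup>2 \<le> a\<^sup>2" using assms by (simp add: ennreal_power)
  then show ?thesis using real assms(2) by (auto intro: ennreal_leI power2_le_imp_le)
next
  case top
  then show ?thesis using assms by (simp add: ennreal_power ennreal_top_mult power2_eq_square top_unique flip: ennreal_mult)
qed

lemma l2_Cauchy_Schwarz:
  assumes "square_integrable P Y" "square_integrable P Z"
  shows "integrable P (\<lambda>\<omega>. cmod (Y \<omega>) * cmod (Z \<omega>))"
    and "(LINT \<omega>|P. cmod (Y \<omega>) * cmod (Z \<omega>)) \<le> l2_norm P Y * l2_norm P Z"
proof -
  have [measurable]: "Y \<in> borel_measurable P" "Z \<in> borel_measurable P"
    using assms by (auto simp: square_integrable_def)
  have "(\<integral>\<^sup>+ \<omega>. ennreal (cmod (Y \<omega>)) * ennreal (cmod (Z \<omega>)) \<partial>P)\<^sup>2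
      \<le> (\<integral>\<^sup>+ \<omega>. (ennreal (cmod (Y \<omega>)))\<^sup>2 \<partial>P) * (\<integral>\<^sup>+ \<omega>. (ennreal (cmod (Z \<omega>)))\<^sup>2 \<partial>P)"
    by (rule Cauchy_Schwarz_nn_integral) measurable
  also have "\<dots> = (ennreal (l2_norm P Y * l2_norm P Z))\<^sup>2"
    using assms by (simp add: ennreal_power nn_integral_square ennreal_mult' l2_norm_nonneg power_mult_distrib)
  finally have *: "(\<integral>\<^sup>+ \<omega>. ennreal (cmod (Y \<omega>) * cmod (Z \<omega>)) \<partial>P) \<le> ennreal (l2_norm P Y * l2_norm P Z)"
    unfolding ennreal_mult'[OF norm_ge_zero, symmetric] by (rule ennreal_power2_le_imp_le) (simp add: l2_norm_nonneg)
  show int: "integrable P (\<lambda>\<omega>. cmod (Y \<omega>) * cmod (Z \<omega>))"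
    by (subst integrable_iff_bounded) (use * in \<open>auto intro: le_less_trans\<close>)
  show "(LINT \<omega>|P. cmod (Y \<omega>) * cmod (Z \<omega>)) \<le> l2_norm P Y * l2_norm P Z"
    using * by (subst (asm) nn_integral_eq_integral[OF int]) (auto simp: l2_norm_nonneg)
qed

lemma borel_cnj [measurable]: "cnj \<in> borel_measurable borel"
  by (intro borel_measurable_continuous_onI continuous_intros)

lemma integrable_mult_cnj:
  assumes "square_integrable P Y" "square_integrable P Z"
  shows "integrable P (\<lambda>\<omega>. Y \<omega> * cnj (Z \<omega>))"
    and "cmod (LINT \<omega>|P. Y \<omega> * cnj (Z \<omega>)) \<le> l2_norm P Y * l2_norm P Z"
proof -
  have [measurable]: "Y \<in> borel_measurable P" "Z \<in> borel_measurable P"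
    using assms by (auto simp: square_integrable_def)
  show "integrable P (\<lambda>\<omega>. Y \<omega> * cnj (Z \<omega>))"
    by (rule Bochner_Integration.integrable_bound[OF l2_Cauchy_Schwarz(1)[OF assms]]) (auto simp: norm_mult)
  have "cmod (LINT \<omega>|P. Y \<omega> * cnj (Z \<omega>)) \<le> (LINT \<omega>|P. cmod (Y \<omega> * cnj (Z \<omega>)))"
    by (rule integral_norm_bound)
  then show "cmod (LINT \<omega>|P. Y \<omega> * cnj (Z \<omega>)) \<le> l2_norm P Y * l2_norm P Z"
    using l2_Cauchy_Schwarz(2)[OF assms] by (simp add: norm_mult)
qed

lemma l2_norm_triangle:
  assumes "square_integrable P Y" "square_integrable P Z"
  shows "l2_norm P (\<lambda>\<omega>. Y \<omega> + Z \<omega>) \<le> l2_norm P Y + l2_norm P Z"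
proof -
  note int = assms[unfolded square_integrable_def, THEN conjunct2]
  have "(l2_norm P (\<lambda>\<omega>. Y \<omega> + Z \<omega>))\<^sup>2 \<le> (LINT \<omega>|P. (cmod (Y \<omega>))\<^sup>2 + (cmod (Z \<omega>))\<^sup>2 + 2 * (cmod (Y \<omega>) * cmod (Z \<omega>)))"
    unfolding l2_norm_square
  proof (rule Bochner_Integration.integral_mono)
    show "integrable P (\<lambda>\<omega>. (cmod (Y \<omega> + Z \<omega>))\<^sup>2)"
      using square_integrable_add[OF assms] by (simp add: square_integrable_def)
    show "integrable P (\<lambda>\<omega>. (cmod (Y \<omega>))\<^sup>2 + (cmod (Z \<omega>))\<^sup>2 + 2 * (cmod (Y \<omega>) * cmod (Z \<omega>)))"
      using int l2_Cauchy_Schwarz(1)[OF assms] by (intro Bochner_Integration.integrable_add integrable_mult_right)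
    fix \<omega>
    have "(cmod (Y \<omega> + Z \<omega>))\<^sup>2 \<le> (cmod (Y \<omega>) + cmod (Z \<omega>))\<^sup>2"
      by (intro power_mono norm_triangle_ineq) auto
    then show "(cmod (Y \<omega> + Z \<omega>))\<^sup>2 \<le> (cmod (Y \<omega>))\<^sup>2 + (cmod (Z \<omega>))\<^sup>2 + 2 * (cmod (Y \<omega>) * cmod (Z \<omega>))"
      by (simp add: power2_sum)
  qed
  also have "\<dots> = (l2_norm P Y)\<^sup>2 + (l2_norm P Z)\<^sup>2 + 2 * (LINT \<omega>|P. cmod (Y \<omega>) * cmod (Z \<omega>))"
    using int l2_Cauchy_Schwarz(1)[OF assms] by (simp add: l2_norm_square)
  also have "\<dots> \<le> (l2_norm P Y + l2_norm P Z)\<^sup>2"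
    using l2_Cauchy_Schwarz(2)[OF assms] by (simp add: power2_sum)
  finally show ?thesis
    by (rule power2_le_imp_le) (simp add: l2_norm_nonneg)
qed

lemma l2_norm_diff_triangle:
  assumes "square_integrable P X" "square_integrable P Y" "square_integrable P Z"
  shows "l2_norm P (\<lambda>\<omega>. X \<omega> - Z \<omega>) \<le> l2_norm P (\<lambda>\<omega>. X \<omega> - Y \<omega>) + l2_norm P (\<lambda>\<omega>. Y \<omega> - Z \<omega>)"
  using l2_norm_triangle[OF square_integrable_diff[OF assms(1,2)] square_integrable_diff[OF assms(2,3)]] by simp

lemma l2_norm_minus_commute: "l2_norm P (\<lambda>\<omega>. Y \<omega> - Z \<omega>) = l2_norm P (\<lambda>\<omega>. Z \<omega> - Y \<omega>)"
  by (simp add: l2_norm_def norm_minus_commute)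

lemma l2_norm_cmult: "l2_norm P (\<lambda>\<omega>. c * Y \<omega>) = cmod c * l2_norm P Y"
  by (simp add: l2_norm_def norm_mult power_mult_distrib real_sqrt_mult)

lemma l2_norm_cong_AE:
  assumes "Y \<in> borel_measurable P" "Z \<in> borel_measurable P" "AE \<omega> in P. Y \<omega> = Z \<omega>"
  shows "l2_norm P Y = l2_norm P Z"
  unfolding l2_norm_def using assms by (intro arg_cong[where f=sqrt] integral_cong_AE) auto

lemma square_integrable_cong_AE:
  assumes "square_integrable P Y" "Z \<in> borel_measurable P" "AE \<omega> in P. Y \<omega> = Z \<omega>"
  shows "square_integrable P Z"
proof -
  have "integrable P (\<lambda>\<omega>. (cmod (Z \<omega>))\<^sup>2) \<longleftrightarrow> integrable P (\<lambda>\<omega>. (cmod (Y \<omega>))\<^sup>2)"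
    using assms by (intro integrable_cong_AE) (auto simp: square_integrable_def)
  then show ?thesis using assms by (auto simp: square_integrable_def)
qed

lemma l2_norm_eq_0_AE:
  assumes "square_integrable P Y" "l2_norm P Y = 0"
  shows "AE \<omega> in P. Y \<omega> = 0"
proof -
  have "AE \<omega> in P. (cmod (Y \<omega>))\<^sup>2 = 0"
    using assms by (subst integral_nonneg_eq_0_iff_AE[symmetric]) (auto simp: square_integrable_def l2_norm_def)
  then show ?thesis by auto
qed

text \<open>The integral of a non-integrable function is 0 in HOL, so the \<open>l2_norm\<close> of
  a difference that is not square-integrable could vanish. The two integrability clauses exclude
  such spurious limits.\<close>

definition l2_limit :: "'w measure \<Rightarrow> (nat \<Rightarrow> 'w \<Rightarrow> complex) \<Rightarrow> ('w \<Rightarrow> complex) \<Rightarrow> bool" where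
  "l2_limit P Y Z \<longleftrightarrow> (\<forall>n. square_integrable P (Y n)) \<and> square_integrable P Z \<and>
     (\<lambda>n. l2_norm P (\<lambda>\<omega>. Y n \<omega> - Z \<omega>)) \<longlonglongrightarrow> 0"

lemma l2_limit_unique:
  assumes "l2_limit P Y Z" "l2_limit P Y Z'"
  shows "AE \<omega> in P. Z \<omega> = Z' \<omega>"
proof -
  have sq: "square_integrable P (Y n)" "square_integrable P Z" "square_integrable P Z'" for n
    using assms by (auto simp: l2_limit_def)
  have "l2_norm P (\<lambda>\<omega>. Z \<omega> - Z' \<omega>) \<le> l2_norm P (\<lambda>\<omega>. Y n \<omega> - Z \<omega>) + l2_norm P (\<lambda>\<omega>. Y n \<omega> - Z' \<omega>)" for n
    using l2_norm_diff_triangle[OF sq(2) sq(1)[of n] sq(3)] by (simp add: l2_norm_minus_commute)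
  moreover have "(\<lambda>n. l2_norm P (\<lambda>\<omega>. Y n \<omega> - Z \<omega>) + l2_norm P (\<lambda>\<omega>. Y n \<omega> - Z' \<omega>)) \<longlonglongrightarrow> 0 + 0"
    using assms by (intro tendsto_add) (auto simp: l2_limit_def)
  ultimately have "l2_norm P (\<lambda>\<omega>. Z \<omega> - Z' \<omega>) \<le> 0 + 0"
    by (intro LIMSEQ_le_const[of _ "0 + 0"]) auto
  then have "l2_norm P (\<lambda>\<omega>. Z \<omega> - Z' \<omega>) = 0"
    using l2_norm_nonneg[of P "\<lambda>\<omega>. Z \<omega> - Z' \<omega>"] by simp
  from l2_norm_eq_0_AE[OF square_integrable_diff[OF sq(2,3)] this] show ?thesis by auto
qed

lemma l2_limit_lincomb:
  assumes "l2_limit P Y Z" "l2_limit P Y' Z'"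
  shows "l2_limit P (\<lambda>n \<omega>. a * Y n \<omega> + b * Y' n \<omega>) (\<lambda>\<omega>. a * Z \<omega> + b * Z' \<omega>)"
  unfolding l2_limit_def
proof (intro conjI allI)
  have sq: "square_integrable P (Y n)" "square_integrable P Z" "square_integrable P (Y' n)" "square_integrable P Z'" for n
    using assms by (auto simp: l2_limit_def)
  show "square_integrable P (\<lambda>\<omega>. a * Y n \<omega> + b * Y' n \<omega>)" "square_integrable P (\<lambda>\<omega>. a * Z \<omega> + b * Z' \<omega>)" for n
    by (intro square_integrable_add square_integrable_cmult sq)+
  have eq: "(\<lambda>\<omega>. (a * Y n \<omega> + b * Y' n \<omega>) - (a * Z \<omega> + b * Z' \<omega>))
      = (\<lambda>\<omega>. a * (Y n \<omega> - Z \<omega>) + b * (Y' n \<omega> - Z' \<omega>))" for n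
    by (simp add: algebra_simps)
  have "l2_norm P (\<lambda>\<omega>. (a * Y n \<omega> + b * Y' n \<omega>) - (a * Z \<omega> + b * Z' \<omega>))
      \<le> cmod a * l2_norm P (\<lambda>\<omega>. Y n \<omega> - Z \<omega>) + cmod b * l2_norm P (\<lambda>\<omega>. Y' n \<omega> - Z' \<omega>)" for n
    using l2_norm_triangle[OF square_integrable_cmult[OF square_integrable_diff[OF sq(1)[of n] sq(2)], of a]
        square_integrable_cmult[OF square_integrable_diff[OF sq(3)[of n] sq(4)], of b]]
    by (simp only: eq l2_norm_cmult)
  then have le: "\<forall>n. norm (l2_norm P (\<lambda>\<omega>. (a * Y n \<omega> + b * Y' n \<omega>) - (a * Z \<omega> + b * Z' \<omega>)))
      \<le> cmod a * l2_norm P (\<lambda>\<omega>. Y n \<omega> - Z \<omega>) + cmod b * l2_norm P (\<lambda>\<omega>. Y' n \<omega> - Z' \<omega>)"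
    by (simp add: l2_norm_nonneg)
  have "(\<lambda>n. cmod a * l2_norm P (\<lambda>\<omega>. Y n \<omega> - Z \<omega>) + cmod b * l2_norm P (\<lambda>\<omega>. Y' n \<omega> - Z' \<omega>)) \<longlonglongrightarrow> cmod a * 0 + cmod b * 0"
    using assms by (intro tendsto_intros) (auto simp: l2_limit_def)
  then show "(\<lambda>n. l2_norm P (\<lambda>\<omega>. (a * Y n \<omega> + b * Y' n \<omega>) - (a * Z \<omega> + b * Z' \<omega>))) \<longlonglongrightarrow> 0"
    using Lim_null_comparison[OF always_eventually[OF le]] by simp
qed

lemma l2_limit_cong_AE:
  assumes "l2_limit P Y Z" "\<And>n. Y' n \<in> borel_measurable P" "\<And>n. AE \<omega> in P. Y n \<omega> = Y' n \<omega>"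
  shows "l2_limit P Y' Z"
  unfolding l2_limit_def
proof (intro conjI allI)
  have sq: "square_integrable P (Y n)" "square_integrable P Z" for n
    using assms by (auto simp: l2_limit_def)
  then have [measurable]: "Y n \<in> borel_measurable P" "Z \<in> borel_measurable P" for n
    by (auto simp: square_integrable_def)
  note [measurable] = assms(2)
  show "square_integrable P (Y' n)" for n
    by (rule square_integrable_cong_AE[OF sq(1) assms(2,3)])
  have "l2_norm P (\<lambda>\<omega>. Y' n \<omega> - Z \<omega>) = l2_norm P (\<lambda>\<omega>. Y n \<omega> - Z \<omega>)" for n
    using assms(3)[of n] by (intro l2_norm_cong_AE) auto
  then show "(\<lambda>n. l2_norm P (\<lambda>\<omega>. Y' n \<omega> - Z \<omega>)) \<longlonglongrightarrow> 0"
    using assms(1) by (simp add: l2_limit_def)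
qed (use assms in \<open>auto simp: l2_limit_def\<close>)

lemma l2_limit_norm_bounded:
  assumes "l2_limit P Y Z"
  shows "(\<lambda>n. l2_norm P (Y n)) \<longlonglongrightarrow> l2_norm P Z"
proof (rule LIM_zero_cancel, rule tendsto_rabs_zero_cancel, rule tendsto_sandwich[OF _ _ tendsto_const])
  have sq: "square_integrable P (Y n)" "square_integrable P Z" for n
    using assms by (auto simp: l2_limit_def)
  have "\<bar>l2_norm P (Y n) - l2_norm P Z\<bar> \<le> l2_norm P (\<lambda>\<omega>. Y n \<omega> - Z \<omega>)" for n
    using l2_norm_triangle[OF square_integrable_diff[OF sq(1)[of n] sq(2)] sq(2)]
      l2_norm_triangle[OF square_integrable_diff[OF sq(2) sq(1)[of n]] sq(1)[of n]]
      l2_norm_minus_commute[of P "Y n" Z] by simp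
  then show "\<forall>\<^sub>F n in sequentially. \<bar>l2_norm P (Y n) - l2_norm P Z\<bar> \<le> l2_norm P (\<lambda>\<omega>. Y n \<omega> - Z \<omega>)"
    by simp
qed (use assms in \<open>auto simp: l2_limit_def\<close>)

lemma l2_limit_inner:
  assumes "l2_limit P Y Z" "l2_limit P Y' Z'"
  shows "(\<lambda>n. LINT \<omega>|P. Y n \<omega> * cnj (Y' n \<omega>)) \<longlonglongrightarrow> (LINT \<omega>|P. Z \<omega> * cnj (Z' \<omega>))"
proof (rule LIM_zero_cancel, rule Lim_null_comparison)
  have sq: "square_integrable P (Y n)" "square_integrable P Z" "square_integrable P (Y' n)" "square_integrable P Z'" for n
    using assms by (auto simp: l2_limit_def)
  let ?d = "\<lambda>n \<omega>. Y n \<omega> - Z \<omega>" and ?d' = "\<lambda>n \<omega>. Y' n \<omega> - Z' \<omega>"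
  have sqd: "square_integrable P (?d n)" "square_integrable P (?d' n)" for n
    by (intro square_integrable_diff sq)+
  have "cmod ((LINT \<omega>|P. Y n \<omega> * cnj (Y' n \<omega>)) - (LINT \<omega>|P. Z \<omega> * cnj (Z' \<omega>)))
      \<le> l2_norm P (?d n) * l2_norm P (Y' n) + l2_norm P Z * l2_norm P (?d' n)" for n
  proof -
    have "(LINT \<omega>|P. Y n \<omega> * cnj (Y' n \<omega>)) - (LINT \<omega>|P. Z \<omega> * cnj (Z' \<omega>))
        = (LINT \<omega>|P. ?d n \<omega> * cnj (Y' n \<omega>)) + (LINT \<omega>|P. Z \<omega> * cnj (?d' n \<omega>))"
      using integrable_mult_cnj(1)[OF sq(1) sq(3)] integrable_mult_cnj(1)[OF sq(2) sq(4)]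
        integrable_mult_cnj(1)[OF sq(2) sq(3)]
      by (simp add: algebra_simps)
    also have "cmod \<dots> \<le> l2_norm P (?d n) * l2_norm P (Y' n) + l2_norm P Z * l2_norm P (?d' n)"
      by (intro norm_triangle_le add_mono integrable_mult_cnj(2) sq sqd)
    finally show ?thesis .
  qed
  then show "\<forall>\<^sub>F n in sequentially. cmod ((LINT \<omega>|P. Y n \<omega> * cnj (Y' n \<omega>)) - (LINT \<omega>|P. Z \<omega> * cnj (Z' \<omega>)))
      \<le> l2_norm P (?d n) * l2_norm P (Y' n) + l2_norm P Z * l2_norm P (?d' n)" by simp
  have "(\<lambda>n. l2_norm P (?d n) * l2_norm P (Y' n) + l2_norm P Z * l2_norm P (?d' n)) \<longlonglongrightarrow> 0 * l2_norm P Z' + l2_norm P Z * 0"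
    using assms l2_limit_norm_bounded[OF assms(2)] by (intro tendsto_intros) (auto simp: l2_limit_def)
  then show "(\<lambda>n. l2_norm P (?d n) * l2_norm P (Y' n) + l2_norm P Z * l2_norm P (?d' n)) \<longlonglongrightarrow> 0"
    by simp
qed

section \<open>Completeness of L2 over a probability space\<close>

context prob_space
begin

lemma square_integrable_const: "square_integrable M (\<lambda>\<omega>. c)"
  by (simp add: square_integrable_def)

lemma l2_norm_one: "l2_norm M (\<lambda>\<omega>. 1) = 1"
  by (simp add: l2_norm_def prob_space)

lemma square_integrable_integrable:
  assumes "square_integrable M Y"
  shows "integrable M Y" "(LINT \<omega>|M. cmod (Y \<omega>)) \<le> l2_norm M Y"
  using integrable_mult_cnj(1)[OF assms square_integrable_const[of 1]]
    l2_Cauchy_Schwarz(2)[OF assms square_integrable_const[of 1]] by (simp_all add: l2_norm_one)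

lemma l2_limit_expectation:
  assumes "l2_limit M Y Z"
  shows "(\<lambda>n. LINT \<omega>|M. Y n \<omega>) \<longlonglongrightarrow> (LINT \<omega>|M. Z \<omega>)"
proof -
  have "l2_limit M (\<lambda>n \<omega>. 1) (\<lambda>\<omega>. 1)"
    by (simp add: l2_limit_def square_integrable_const) (simp add: l2_norm_def)
  from l2_limit_inner[OF assms this] show ?thesis by simp
qed

text \<open>On a probability space the L2 Cauchy property implies the L1 one, which provides an
  almost surely convergent subsequence. Fatou's lemma along it turns the Cauchy estimate into an
  estimate of the distance to its limit.\<close>

theorem l2_complete:
  assumes sq: "\<And>n. square_integrable M (Y n)"
    and cauchy: "\<And>e. e > 0 \<Longrightarrow> \<exists>N. \<forall>i\<ge>N. \<forall>j\<ge>N. l2_norm M (\<lambda>\<omega>. Y i \<omega> - Y j \<omega>) < e"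
  obtains Z where "l2_limit M Y Z"
proof -
  have [measurable]: "Y n \<in> borel_measurable M" for n
    using sq[of n] by (simp add: square_integrable_def)
  have "\<exists>N. \<forall>i\<ge>N. \<forall>j\<ge>N. (LINT \<omega>|M. cmod (Y i \<omega> - Y j \<omega>)) < e" if "e > 0" for e
    using cauchy[OF that] square_integrable_integrable(2)[OF square_integrable_diff[OF sq sq]]
    by (meson le_less_trans)
  then obtain r where r: "strict_mono r" "AE \<omega> in M. Cauchy (\<lambda>i. Y (r i) \<omega>)"
    using cauchy_L1_AE_cauchy_subseq[of M Y] square_integrable_integrable(1)[OF sq] by blast
  \<comment> \<open>\<open>lim\<close> is measurable as it stands; its values at points of
    divergence are arbitrary but lie over a null set.\<close>
  define Z where "Z \<omega> = lim (\<lambda>i. Y (r i) \<omega>)" for \<omega>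
  have [measurable]: "Z \<in> borel_measurable M"
    unfolding Z_def[abs_def] by measurable
  have conv: "AE \<omega> in M. (\<lambda>i. Y (r i) \<omega>) \<longlonglongrightarrow> Z \<omega>"
    using r(2) by eventually_elim (simp add: Z_def Cauchy_convergent convergent_LIMSEQ_iff[symmetric])
  have bound: "(\<integral>\<^sup>+ \<omega>. ennreal ((cmod (Y n \<omega> - Z \<omega>))\<^sup>2) \<partial>M) \<le> ennreal (e\<^sup>2)"
    if N: "\<forall>i\<ge>N. \<forall>j\<ge>N. l2_norm M (\<lambda>\<omega>. Y i \<omega> - Y j \<omega>) < e" and n: "n \<ge> N" for N n e
  proof -
    have "(\<integral>\<^sup>+ \<omega>. ennreal ((cmod (Y n \<omega> - Z \<omega>))\<^sup>2) \<partial>M)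
        = (\<integral>\<^sup>+ \<omega>. liminf (\<lambda>i. ennreal ((cmod (Y n \<omega> - Y (r i) \<omega>))\<^sup>2)) \<partial>M)"
    proof (rule nn_integral_cong_AE)
      show "AE \<omega> in M. ennreal ((cmod (Y n \<omega> - Z \<omega>))\<^sup>2) = liminf (\<lambda>i. ennreal ((cmod (Y n \<omega> - Y (r i) \<omega>))\<^sup>2))"
        using conv
      proof eventually_elim
        case (elim \<omega>)
        have "(\<lambda>i. ennreal ((cmod (Y n \<omega> - Y (r i) \<omega>))\<^sup>2)) \<longlonglongrightarrow> ennreal ((cmod (Y n \<omega> - Z \<omega>))\<^sup>2)"
          by (intro tendsto_intros tendsto_ennrealI elim)
        from lim_imp_Liminf[OF _ this] show ?case by simp
      qed
    qed
    also have "\<dots> \<le> liminf (\<lambda>i. \<integral>\<^sup>+ \<omega>. ennreal ((cmod (Y n \<omega> - Y (r i) \<omega>))\<^sup>2) \<partial>M)"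
      by (rule nn_integral_liminf) measurable
    also have "\<dots> \<le> ennreal (e\<^sup>2)"
    proof (rule Liminf_le)
      show "\<forall>\<^sub>F i in sequentially. (\<integral>\<^sup>+ \<omega>. ennreal ((cmod (Y n \<omega> - Y (r i) \<omega>))\<^sup>2) \<partial>M) \<le> ennreal (e\<^sup>2)"
        using eventually_ge_at_top[of N]
      proof eventually_elim
        case (elim i)
        have "r i \<ge> N" using elim r(1) seq_suble le_trans by blast
        then have "l2_norm M (\<lambda>\<omega>. Y n \<omega> - Y (r i) \<omega>) \<le> e"
          using N n by (simp add: less_imp_le)
        then show ?case
          by (simp add: nn_integral_square square_integrable_diff sq power_mono l2_norm_nonneg ennreal_leI)
      qed
    qed simp
    finally show ?thesis .
  qed
  have sqd: "square_integrable M (\<lambda>\<omega>. Y n \<omega> - Z \<omega>)" if "\<forall>i\<ge>N. \<forall>j\<ge>N. l2_norm M (\<lambda>\<omega>. Y i \<omega> - Y j \<omega>) < e" "n \<ge> N" for n N e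
    unfolding square_integrable_iff_nn using bound[OF that] by (auto intro: le_less_trans)
  obtain N1 where N1: "\<forall>i\<ge>N1. \<forall>j\<ge>N1. l2_norm M (\<lambda>\<omega>. Y i \<omega> - Y j \<omega>) < 1"
    using cauchy[of 1] by auto
  have sqZ: "square_integrable M Z"
    using square_integrable_diff[OF sq[of N1] sqd[OF N1 order_refl]] by simp
  have "(\<lambda>n. l2_norm M (\<lambda>\<omega>. Y n \<omega> - Z \<omega>)) \<longlonglongrightarrow> 0"
  proof (rule LIMSEQ_I)
    fix e :: real assume "e > 0"
    then obtain N where N: "\<forall>i\<ge>N. \<forall>j\<ge>N. l2_norm M (\<lambda>\<omega>. Y i \<omega> - Y j \<omega>) < e / 2"
      using cauchy[of "e / 2"] by auto
    have "l2_norm M (\<lambda>\<omega>. Y n \<omega> - Z \<omega>) < e" if "n \<ge> N" for n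
    proof -
      have "ennreal ((l2_norm M (\<lambda>\<omega>. Y n \<omega> - Z \<omega>))\<^sup>2) \<le> ennreal ((e / 2)\<^sup>2)"
        using bound[OF N that] nn_integral_square[OF square_integrable_diff[OF sq sqZ]] by simp
      then have "(l2_norm M (\<lambda>\<omega>. Y n \<omega> - Z \<omega>))\<^sup>2 \<le> (e / 2)\<^sup>2"
        by (simp add: ennreal_le_iff)
      then have "l2_norm M (\<lambda>\<omega>. Y n \<omega> - Z \<omega>) \<le> e / 2"
        by (rule power2_le_imp_le) (use \<open>e > 0\<close> in simp)
      then show ?thesis using \<open>e > 0\<close> by simp
    qed
    then show "\<exists>N. \<forall>n\<ge>N. norm (l2_norm M (\<lambda>\<omega>. Y n \<omega> - Z \<omega>) - 0) < e"
      by (auto simp: l2_norm_nonneg abs_of_nonneg)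
  qed
  then show ?thesis using that sq sqZ by (auto simp: l2_limit_def)
qed

end

section \<open>Continuous rapidly decreasing functions\<close>

definition rapid :: "('a::euclidean_space \<Rightarrow> complex) \<Rightarrow> bool" where
  "rapid f \<longleftrightarrow> continuous_on UNIV f \<and> (\<forall>k::nat. \<exists>C. \<forall>x. jap x ^ k * cmod (f x) \<le> C)"

lemma rapid_E:
  assumes "rapid f"
  obtains C where "C > 0" "\<And>x. jap x ^ k * cmod (f x) \<le> C"
proof -
  obtain C where C: "\<And>x. jap x ^ k * cmod (f x) \<le> C" using assms by (auto simp: rapid_def)
  have "jap x ^ k * cmod (f x) \<le> \<bar>C\<bar> + 1" for x using C[of x] by linarith
  then show ?thesis using that[of "\<bar>C\<bar> + 1"] by auto
qed

lemma schwartz_rapid: "f \<in> schwartz \<Longrightarrow> rapid f"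
  unfolding rapid_def
proof (intro conjI allI)
  assume f: "f \<in> schwartz"
  show "continuous_on UNIV f" by (rule schwartz_continuous[OF f])
  fix k
  obtain C where "\<And>x. cmod (f x) \<le> C * jap x powr (- real k)" using schwartz_decay[OF f] by blast
  then show "\<exists>C. \<forall>x. jap x ^ k * cmod (f x) \<le> C" by (auto simp: jap_weight_iff)
qed

lemma rapid_mult:
  assumes f: "rapid f" and g: "continuous_on UNIV g" "\<And>x. cmod (g x) \<le> C * jap x ^ m"
  shows "rapid (\<lambda>x. g x * f x)"
  unfolding rapid_def
proof (intro conjI allI)
  show "continuous_on UNIV (\<lambda>x. g x * f x)"
    using f g(1) by (auto simp: rapid_def intro!: continuous_intros)
  fix k
  obtain D where D: "D > 0" "\<And>x. jap x ^ (k + m) * cmod (f x) \<le> D" using rapid_E[OF f] by blast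
  have "jap x ^ k * cmod (g x * f x) \<le> \<bar>C\<bar> * D" for x
  proof -
    have "jap x ^ k * cmod (g x * f x) = cmod (g x) * (jap x ^ k * cmod (f x))"
      by (simp add: norm_mult mult_ac)
    also have "\<dots> \<le> (\<bar>C\<bar> * jap x ^ m) * (jap x ^ k * cmod (f x))"
      using jap_pos[of x]
      by (intro mult_right_mono order_trans[OF g(2)] mult_nonneg_nonneg) auto
    also have "\<dots> = \<bar>C\<bar> * (jap x ^ (k + m) * cmod (f x))"
      by (simp add: power_add mult_ac)
    also have "\<dots> \<le> \<bar>C\<bar> * D" by (intro mult_left_mono D) auto
    finally show ?thesis .
  qed
  then show "\<exists>C. \<forall>x. jap x ^ k * cmod (g x * f x) \<le> C" by blast
qed

text \<open>A diagonal criterion: the n-th error is small in the n-th weight, and that weight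
  dominates any fixed power \<open>k\<close> as soon as n \<ge> k.\<close>

lemma rapid_limitI:
  assumes "\<And>n x. jap x ^ n * cmod (F n x - f x) \<le> 1 / real (Suc n)"
  shows "rapid_limit F f"
  unfolding rapid_limit_def jap_def[symmetric]
proof (intro allI uniform_limitI)
  fix k :: nat and e :: real assume "e > 0"
  then obtain N where N: "1 / real (Suc N) < e" using nat_approx_posE by blast
  show "\<forall>\<^sub>F n in sequentially. \<forall>x\<in>UNIV. dist (jap x ^ k *\<^sub>R F n x) (jap x ^ k *\<^sub>R f x) < e"
    using eventually_ge_at_top[of "max k N"]
  proof eventually_elim
    case (elim n)
    have "dist (jap x ^ k *\<^sub>R F n x) (jap x ^ k *\<^sub>R f x) < e" for x
    proof -
      have "dist (jap x ^ k *\<^sub>R F n x) (jap x ^ k *\<^sub>R f x) = jap x ^ k * cmod (F n x - f x)"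
        by (simp add: dist_norm scaleR_diff_right[symmetric] jap_power_abs)
      also have "\<dots> \<le> jap x ^ n * cmod (F n x - f x)"
        using jap_ge_1[of x] elim by (intro mult_right_mono power_increasing) auto
      also have "\<dots> \<le> 1 / real (Suc n)" by (rule assms)
      also have "\<dots> \<le> 1 / real (Suc N)" using elim by (simp add: frac_le)
      finally show ?thesis using N by simp
    qed
    then show ?case by simp
  qed
qed

lemma rapid_limitD:
  assumes "rapid_limit F f" "e > 0"
  shows "\<forall>\<^sub>F n in sequentially. \<forall>x. jap x ^ k * cmod (F n x - f x) \<le> e"
proof -
  have "\<forall>\<^sub>F n in sequentially. \<forall>x\<in>UNIV. dist (jap x ^ k *\<^sub>R F n x) (jap x ^ k *\<^sub>R f x) < e"
    using assms unfolding rapid_limit_def jap_def[symmetric] by (intro uniform_limitD) auto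
  then show ?thesis
    by eventually_elim (auto simp: dist_norm scaleR_diff_right[symmetric] jap_power_abs less_imp_le)
qed

lemma rapid_limit_lincomb:
  fixes F H :: "nat \<Rightarrow> 'a::euclidean_space \<Rightarrow> complex"
  assumes "rapid_limit F f" "rapid_limit H h"
  shows "rapid_limit (\<lambda>n x. a * F n x + b * H n x) (\<lambda>x. a * f x + b * h x)"
  unfolding rapid_limit_def jap_def[symmetric]
proof
  fix k
  have "uniform_limit UNIV (\<lambda>n x. a * (jap x ^ k *\<^sub>R F n x) + b * (jap x ^ k *\<^sub>R H n x))
     (\<lambda>x. a * (jap x ^ k *\<^sub>R f x) + b * (jap x ^ k *\<^sub>R h x)) sequentially"
    using assms unfolding rapid_limit_def jap_def[symmetric]
    by (intro uniform_limit_add bounded_linear.uniform_limit[OF bounded_linear_mult_right]) auto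
  then show "uniform_limit UNIV (\<lambda>n x. jap x ^ k *\<^sub>R (a * F n x + b * H n x)) (\<lambda>x. jap x ^ k *\<^sub>R (a * f x + b * h x)) sequentially"
    by (simp add: scaleR_add_right)
qed

text \<open>The map \<open>x \<mapsto> x / sqrt (1 + |x|\<^sup>2)\<close> identifies the space with the open unit ball; a decaying
  continuous function becomes a continuous function on the closed ball, to which
  Stone--Weierstrass applies.\<close>

definition ball_map :: "'a::euclidean_space \<Rightarrow> 'a" where
  "ball_map x = (1 / sqrt (jap x)) *\<^sub>R x"

lemma norm_ball_map: "(norm (ball_map x))\<^sup>2 = 1 - 1 / jap x"
  using jap_pos[of x]
  by (simp add: ball_map_def power_mult_distrib power_divide jap_def field_simps)

lemma ball_map_less_1: "norm (ball_map x) < 1"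
  by (rule power2_less_imp_less) (use norm_ball_map[of x] jap_pos[of x] in auto)

lemma ball_map_inverse: "(1 / sqrt (1 - (norm (ball_map x))\<^sup>2)) *\<^sub>R ball_map x = x"
  using jap_pos[of x] by (simp add: norm_ball_map) (simp add: ball_map_def real_sqrt_divide)

text \<open>A linear functional of \<open>ball_map x\<close> is \<open>jap x powr (- 1/2)\<close>
  times a combination of coordinates; sums and products follow by the algebra of bounds. A
  polynomial in \<open>ball_map\<close> thus becomes a Schwartz function after multiplication by a
  Gaussian.\<close>

lemma pdbound_ball_map_polynomial:
  assumes "real_polynomial_function q"
  shows "pdbound n I (\<lambda>i x. complex_of_real (q (ball_map x)))"
  using assms
proof induction
  case (linear q)
  have "q (ball_map x) = jap x powr (- 1/2) * (\<Sum>b\<in>Basis. (x \<bullet> b) * q b)" for x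
  proof -
    interpret bounded_linear q by fact
    have "q x = q (\<Sum>b\<in>Basis. (x \<bullet> b) *\<^sub>R b)" by (simp add: euclidean_representation)
    also have "\<dots> = (\<Sum>b\<in>Basis. (x \<bullet> b) * q b)" by (simp add: sum scaleR)
    finally show ?thesis
      using jap_pos[of x] by (simp add: ball_map_def scaleR powr_minus_divide powr_half_sqrt)
  qed
  then have eq: "complex_of_real (q (ball_map x)) = complex_of_real (jap x powr (- 1/2)) *
     (\<Sum>b\<in>Basis. complex_of_real (q b) * complex_of_real (x \<bullet> b))" for x
    by (simp add: mult_ac)
  have "pdbound n I (\<lambda>i x. \<Sum>b\<in>A. complex_of_real (q b) * complex_of_real (x \<bullet> b))" if "A \<subseteq> Basis" for A
  proof -
    have "finite A" using that finite_subset finite_Basis by blast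
    then show ?thesis using that
    proof induction
      case empty
      show ?case using dbound_const[of n I 0] by auto
    next
      case (insert b A)
      then show ?case by (auto intro!: pdbound_add pdbound_cmult pdbound_coord)
    qed
  qed
  then have "pdbound n I (\<lambda>i x. complex_of_real (jap x powr (- 1/2)) *
     (\<Sum>b\<in>Basis. complex_of_real (q b) * complex_of_real (x \<bullet> b)))"
    using dbound_jap_powr[of n I "- 1/2"] by (intro pdbound_mult) auto
  then show ?case by (simp only: eq)
next
  case (const c)
  show ?case using dbound_const by blast
next
  case (add f g)
  then show ?case using pdbound_add by fastforce
next
  case (mult f g)
  then show ?case using pdbound_mult by fastforce
qed

text \<open>\<open>G\<close> is \<open>f\<close> seen on the open ball and 0 on the sphere. At the
  point z belonging to x one has 1 - |z|^2 = 1 / \<open>jap x\<close>, so the decay of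
  \<open>f\<close> reads |G z| \<le> C (1 - |z|^2), and this is continuity at the sphere.\<close>

lemma continuous_on_extend_ball:
  fixes f :: "'a::euclidean_space \<Rightarrow> complex"
  assumes f: "continuous_on UNIV f" and bound: "\<And>x. jap x * cmod (f x) \<le> C"
  defines "G \<equiv> \<lambda>y. if norm y < 1 then f ((1 / sqrt (1 - (norm y)\<^sup>2)) *\<^sub>R y) else 0"
  shows "continuous_on (cball 0 1) G"
  unfolding continuous_on_eq_continuous_within
proof
  fix y :: 'a assume y: "y \<in> cball 0 1"
  have le: "cmod (G z) \<le> C * (1 - (norm z)\<^sup>2)" if "z \<in> cball 0 1" for z
  proof (cases "norm z < 1")
    case True
    let ?x = "(1 / sqrt (1 - (norm z)\<^sup>2)) *\<^sub>R z"
    have pos: "1 - (norm z)\<^sup>2 > 0" using True by (simp add: abs_square_less_1)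
    have "jap ?x = 1 / (1 - (norm z)\<^sup>2)"
      using pos by (simp add: jap_def power_mult_distrib power_divide field_simps)
    with bound[of ?x] pos True show ?thesis by (simp add: G_def field_simps)
  next
    case False
    then have "norm z = 1" using that by simp
    then show ?thesis by (simp add: G_def)
  qed
  have nz: "sqrt (1 - (norm z)\<^sup>2) \<noteq> 0" if "norm z < 1" for z :: 'a
    using that abs_square_less_1[of "norm z"] by simp
  show "continuous (at y within cball 0 1) G"
  proof (cases "norm y < 1")
    case True
    have "continuous_on (ball 0 1) (\<lambda>y. f ((1 / sqrt (1 - (norm y)\<^sup>2)) *\<^sub>R y))"
      by (intro continuous_on_compose2[OF f] continuous_intros) (use nz in auto)
    then have "continuous_on (ball 0 1) G"
      by (rule continuous_on_eq) (simp add: G_def)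
    then have "isCont G y"
      using True by (simp add: continuous_on_eq_continuous_at)
    then show ?thesis by (rule continuous_at_imp_continuous_at_within)
  next
    case False
    then have ny: "norm y = 1" using y by simp
    have "((\<lambda>z. C * (1 - (norm z)\<^sup>2)) \<longlongrightarrow> C * (1 - (norm y)\<^sup>2)) (at y within cball 0 1)"
      by (intro tendsto_intros)
    then have "((\<lambda>z. C * (1 - (norm z)\<^sup>2)) \<longlongrightarrow> 0) (at y within cball 0 1)"
      by (simp add: ny)
    moreover have "\<forall>\<^sub>F z in at y within cball 0 1. norm (G z) \<le> C * (1 - (norm z)\<^sup>2)"
      using le by (auto simp: eventually_at_filter)
    ultimately have "(G \<longlongrightarrow> 0) (at y within cball 0 1)"
      by (rule Lim_null_comparison[rotated])
    then show ?thesis by (simp add: continuous_within G_def ny)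
  qed
qed

text \<open>The approximant is a polynomial in \<open>ball_map\<close>, damped by a Gaussian w. The
  loss (1 - w) f is at most d \<open>jap\<close> |f|, which fixes d through the decay of
  \<open>f\<close>; then w \<le> A \<open>jap\<close>^(-N) fixes the accuracy e / (2 A) required of
  the polynomial. The parameters must be chosen in this order, each half of the error taking e /
  2.\<close>

lemma rapid_approx_eps:
  fixes f :: "'a::euclidean_space \<Rightarrow> complex"
  assumes f: "rapid f" and "e > 0"
  obtains h where "h \<in> schwartz" "\<And>x. jap x ^ N * cmod (h x - f x) \<le> e"
proof -
  obtain C1 where C1: "C1 > 0" "\<And>x. jap x ^ 1 * cmod (f x) \<le> C1" using rapid_E[OF f] by blast
  obtain C where C: "C > 0" "\<And>x. jap x ^ Suc N * cmod (f x) \<le> C" using rapid_E[OF f] by blast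
  define d where "d = e / (2 * C)"
  have d: "d > 0" using \<open>e > 0\<close> C by (simp add: d_def)
  let ?w = "\<lambda>x::'a. exp (- d * (norm x)\<^sup>2)"
  obtain A where A: "A > 0" "\<And>x::'a. ?w x \<le> A * jap x powr (- real N)"
    using gauss_decay[OF d] by blast
  define G where "G = (\<lambda>y. if norm y < 1 then f ((1 / sqrt (1 - (norm y)\<^sup>2)) *\<^sub>R y) else 0)"
  have "continuous_on (cball 0 1) G"
    unfolding G_def by (rule continuous_on_extend_ball) (use f C1(2) in \<open>auto simp: rapid_def\<close>)
  then obtain p where p: "polynomial_function p" "\<And>y. y \<in> cball 0 1 \<Longrightarrow> cmod (G y - p y) < e / (2 * A)"
    using Stone_Weierstrass_polynomial_function[of "cball 0 1" G "e / (2 * A)"] \<open>e > 0\<close> A(1) by auto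
  define h where "h x = complex_of_real (?w x) * p (ball_map x)" for x
  have "real_polynomial_function (Re \<circ> p)" "real_polynomial_function (Im \<circ> p)"
    using p(1) bounded_linear_Re bounded_linear_Im by (auto simp: polynomial_function_def)
  then have "pdbound n (UNIV :: unit set) (\<lambda>i x::'a. complex_of_real ((Re \<circ> p) (ball_map x))
      + \<i> * complex_of_real ((Im \<circ> p) (ball_map x)))" for n
    by (intro pdbound_add pdbound_cmult pdbound_ball_map_polynomial)
  then have "pdbound n UNIV (single (\<lambda>x::'a. p (ball_map x)))" for n
    by (simp add: complex_eq[symmetric])
  moreover have "(\<lambda>x::'a. complex_of_real (?w x)) \<in> schwartz"
    unfolding schwartz_iff_dbound by (intro allI dbound_gauss d)
  ultimately have "h \<in> schwartz"
    unfolding h_def by (intro schwartz_mult)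
  moreover have "jap x ^ N * cmod (h x - f x) \<le> e" for x
  proof -
    have Gf: "G (ball_map x) = f x"
      by (simp add: G_def ball_map_less_1 ball_map_inverse)
    have "cmod (G (ball_map x) - p (ball_map x)) < e / (2 * A)"
      by (rule p(2)) (use ball_map_less_1[of x] in simp)
    then have pf: "cmod (p (ball_map x) - f x) \<le> e / (2 * A)"
      by (simp add: Gf norm_minus_commute)
    have "h x - f x = complex_of_real (?w x) * (p (ball_map x) - f x) - complex_of_real (1 - ?w x) * f x"
      by (simp add: h_def algebra_simps)
    then have "cmod (h x - f x) \<le> cmod (complex_of_real (?w x) * (p (ball_map x) - f x)) + cmod (complex_of_real (1 - ?w x) * f x)"
      by (metis norm_triangle_ineq4)
    also have "\<dots> = ?w x * cmod (p (ball_map x) - f x) + \<bar>1 - ?w x\<bar> * cmod (f x)"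
      by (simp only: norm_mult norm_of_real abs_exp_cancel)
    finally have "jap x ^ N * cmod (h x - f x) \<le> jap x ^ N * (?w x * cmod (p (ball_map x) - f x) + \<bar>1 - ?w x\<bar> * cmod (f x))"
      using jap_pos[of x] by (intro mult_left_mono) auto
    also have "\<dots> = (jap x ^ N * ?w x) * cmod (p (ball_map x) - f x) + \<bar>1 - ?w x\<bar> * (jap x ^ N * cmod (f x))"
      by (simp add: algebra_simps)
    also have "\<dots> \<le> A * (e / (2 * A)) + (d * jap x) * (jap x ^ N * cmod (f x))"
    proof (intro add_mono mult_mono pf mult_right_mono)
      show "jap x ^ N * ?w x \<le> A" using A(2)[of x] by (simp add: jap_weight_iff)
      have "1 + (- d * (norm x)\<^sup>2) \<le> ?w x" by (rule exp_ge_add_one_self)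
      moreover have "?w x \<le> 1" using d by simp
      moreover have "d * (norm x)\<^sup>2 \<le> d * jap x" using d by (simp add: jap_def)
      ultimately show "\<bar>1 - ?w x\<bar> \<le> d * jap x" by (simp add: abs_le_iff)
    qed (use A(1) d jap_pos[of x] in auto)
    also have "\<dots> = e / 2 + d * (jap x ^ Suc N * cmod (f x))"
      using A(1) by simp
    also have "\<dots> \<le> e / 2 + d * C"
      using d by (intro add_left_mono mult_left_mono C) auto
    also have "\<dots> = e" using C(1) by (simp add: d_def)
    finally show ?thesis .
  qed
  ultimately show ?thesis using that by blast
qed

lemma rapid_approx:
  assumes "rapid f"
  obtains F where "\<And>n. F n \<in> schwartz" "rapid_limit F f"
proof -
  have "\<exists>h. h \<in> schwartz \<and> (\<forall>x. jap x ^ n * cmod (h x - f x) \<le> 1 / real (Suc n))" for n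
    using rapid_approx_eps[OF assms, of "1 / real (Suc n)" n] by (metis zero_less_divide_1_iff of_nat_0_less_iff zero_less_Suc)
  then obtain F where "\<And>n. F n \<in> schwartz" "\<And>n x. jap x ^ n * cmod (F n x - f x) \<le> 1 / real (Suc n)"
    by metis
  then show ?thesis using that rapid_limitI by blast
qed

text \<open>What remains of \<open>fourier_field U\<close> once order zero is known: an almost
  surely linear, centred field controlled by one weighted supremum norm. The extension to continuous
  functions uses nothing else.\<close>

locale sup_continuous_field = prob_space P for P :: "'w measure" +
  fixes M :: "('a::euclidean_space, 'w) random_field" and K :: real and N :: nat
  assumes M_square_integrable: "f \<in> schwartz \<Longrightarrow> square_integrable P (M f)"
    and M_linear: "f \<in> schwartz \<Longrightarrow> h \<in> schwartz \<Longrightarrow>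
      AE \<omega> in P. M (\<lambda>x. a * f x + b * h x) \<omega> = a * M f \<omega> + b * M h \<omega>"
    and M_bound: "f \<in> schwartz \<Longrightarrow> (\<And>x. jap x ^ N * cmod (f x) \<le> s) \<Longrightarrow> l2_norm P (M f) \<le> K * s"
    and M_mean: "f \<in> schwartz \<Longrightarrow> (LINT \<omega>|P. M f \<omega>) = 0"
    and K_pos: "K > 0"
begin

lemma M_diff_norm:
  assumes "f \<in> schwartz" "h \<in> schwartz"
  shows "l2_norm P (\<lambda>\<omega>. M f \<omega> - M h \<omega>) = l2_norm P (M (\<lambda>x. f x - h x))"
proof (rule l2_norm_cong_AE)
  have [measurable]: "M f \<in> borel_measurable P" "M h \<in> borel_measurable P"
    using assms M_square_integrable by (auto simp: square_integrable_def)
  show "(\<lambda>\<omega>. M f \<omega> - M h \<omega>) \<in> borel_measurable P" by measurable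
  show "M (\<lambda>x. f x - h x) \<in> borel_measurable P"
    using M_square_integrable[OF schwartz_diff[OF assms]] by (simp add: square_integrable_def)
  show "AE \<omega> in P. M f \<omega> - M h \<omega> = M (\<lambda>x. f x - h x) \<omega>"
    using M_linear[OF assms, of 1 "-1"] by auto
qed

text \<open>Two approximating sequences are compared at once. With equal sequences this is the
  Cauchy property; with different ones it shows that the limit does not depend on the approximation,
  as the choice in \<open>extend_field\<close> demands.\<close>

lemma M_rapid_Cauchy:
  assumes "\<And>n. F n \<in> schwartz" "\<And>n. H n \<in> schwartz" "rapid_limit F f" "rapid_limit H f" "e > 0"
  shows "\<exists>m. \<forall>i\<ge>m. \<forall>j\<ge>m. l2_norm P (\<lambda>\<omega>. M (F i) \<omega> - M (H j) \<omega>) < e"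
proof -
  define d where "d = e / (4 * K)"
  have d: "d > 0" using \<open>e > 0\<close> K_pos by (simp add: d_def)
  obtain m1 where m1: "\<And>i x. i \<ge> m1 \<Longrightarrow> jap x ^ N * cmod (F i x - f x) \<le> d"
    using rapid_limitD[OF assms(3) d, of N] by (auto simp: eventually_sequentially)
  obtain m2 where m2: "\<And>i x. i \<ge> m2 \<Longrightarrow> jap x ^ N * cmod (H i x - f x) \<le> d"
    using rapid_limitD[OF assms(4) d, of N] by (auto simp: eventually_sequentially)
  have "l2_norm P (\<lambda>\<omega>. M (F i) \<omega> - M (H j) \<omega>) < e" if "i \<ge> max m1 m2" "j \<ge> max m1 m2" for i j
  proof -
    have "jap x ^ N * cmod (F i x - H j x) \<le> 2 * d" for x
    proof -
      have "cmod (F i x - H j x) \<le> cmod (F i x - f x) + cmod (H j x - f x)"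
        using norm_triangle_ineq4[of "F i x - f x" "H j x - f x"] by simp
      then have "jap x ^ N * cmod (F i x - H j x) \<le> jap x ^ N * (cmod (F i x - f x) + cmod (H j x - f x))"
        using jap_pos[of x] by (intro mult_left_mono) auto
      then show ?thesis using m1[of i x] m2[of j x] that by (simp add: distrib_left)
    qed
    then have "l2_norm P (\<lambda>\<omega>. M (F i) \<omega> - M (H j) \<omega>) \<le> K * (2 * d)"
      unfolding M_diff_norm[OF assms(1,2)] by (intro M_bound schwartz_diff assms(1,2))
    also have "\<dots> = e / 2" using K_pos by (simp add: d_def)
    finally show ?thesis using \<open>e > 0\<close> by simp
  qed
  then show ?thesis by blast
qed

lemma extend_field_exists:
  assumes "rapid f"
  shows "\<exists>Y. square_integrable P Y \<and>
     (\<forall>F. (\<forall>n. F n \<in> schwartz) \<and> rapid_limit F f \<longrightarrow> (\<lambda>n. l2_norm P (\<lambda>\<omega>. M (F n) \<omega> - Y \<omega>)) \<longlonglongrightarrow> 0)"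
proof -
  obtain F where F: "\<And>n. F n \<in> schwartz" "rapid_limit F f" using rapid_approx[OF assms] by blast
  obtain Y where Y: "l2_limit P (\<lambda>n. M (F n)) Y"
    using l2_complete[of "\<lambda>n. M (F n)"] M_square_integrable[OF F(1)] M_rapid_Cauchy[OF F(1) F(1) F(2) F(2)] by blast
  then have sqY: "square_integrable P Y" by (simp add: l2_limit_def)
  have "(\<lambda>n. l2_norm P (\<lambda>\<omega>. M (H n) \<omega> - Y \<omega>)) \<longlonglongrightarrow> 0" if H: "\<And>n. H n \<in> schwartz" "rapid_limit H f" for H
  proof (rule Lim_null_comparison[OF always_eventually])
    show "\<forall>n. norm (l2_norm P (\<lambda>\<omega>. M (H n) \<omega> - Y \<omega>))
        \<le> l2_norm P (\<lambda>\<omega>. M (H n) \<omega> - M (F n) \<omega>) + l2_norm P (\<lambda>\<omega>. M (F n) \<omega> - Y \<omega>)"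
      using l2_norm_diff_triangle[OF M_square_integrable[OF H(1)] M_square_integrable[OF F(1)] sqY]
      by (simp add: l2_norm_nonneg)
    have "(\<lambda>n. l2_norm P (\<lambda>\<omega>. M (H n) \<omega> - M (F n) \<omega>)) \<longlonglongrightarrow> 0"
    proof (rule LIMSEQ_I)
      fix e :: real assume "e > 0"
      from M_rapid_Cauchy[OF H(1) F(1) H(2) F(2) this]
      show "\<exists>m. \<forall>n\<ge>m. norm (l2_norm P (\<lambda>\<omega>. M (H n) \<omega> - M (F n) \<omega>) - 0) < e"
        by (auto simp: l2_norm_nonneg)
    qed
    then have "(\<lambda>n. l2_norm P (\<lambda>\<omega>. M (H n) \<omega> - M (F n) \<omega>) + l2_norm P (\<lambda>\<omega>. M (F n) \<omega> - Y \<omega>)) \<longlonglongrightarrow> 0 + 0"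
      using Y by (intro tendsto_add) (auto simp: l2_limit_def)
    then show "(\<lambda>n. l2_norm P (\<lambda>\<omega>. M (H n) \<omega> - M (F n) \<omega>) + l2_norm P (\<lambda>\<omega>. M (F n) \<omega> - Y \<omega>)) \<longlonglongrightarrow> 0"
      by simp
  qed
  with sqY show ?thesis by blast
qed

text \<open>Existence has been shown, so the choice operator meets its specification. Later
  arguments see the extension only through this limit and its consequences.\<close>

lemma extend_field_limit:
  assumes "rapid f" "\<And>n. F n \<in> schwartz" "rapid_limit F f"
  shows "l2_limit P (\<lambda>n. M (F n)) (extend_field P M f)"
proof -
  have "square_integrable P (extend_field P M f) \<and>
     (\<forall>F. (\<forall>n. F n \<in> schwartz) \<and> rapid_limit F f \<longrightarrow> (\<lambda>n. l2_norm P (\<lambda>\<omega>. M (F n) \<omega> - extend_field P M f \<omega>)) \<longlonglongrightarrow> 0)"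
    unfolding extend_field_def by (rule someI_ex[OF extend_field_exists[OF assms(1)]])
  then show ?thesis
    using assms(2,3) M_square_integrable by (simp add: l2_limit_def)
qed

lemma extend_field_approx:
  assumes "rapid f"
  obtains F where "\<And>n. F n \<in> schwartz" "rapid_limit F f" "l2_limit P (\<lambda>n. M (F n)) (extend_field P M f)"
  using rapid_approx[OF assms] extend_field_limit[OF assms] by metis

lemma extend_field_square_integrable: "rapid f \<Longrightarrow> square_integrable P (extend_field P M f)"
  using extend_field_approx by (metis l2_limit_def)

lemma extend_field_linear:
  assumes "rapid f" "rapid h" "rapid (\<lambda>x. a * f x + b * h x)"
  shows "AE \<omega> in P. extend_field P M (\<lambda>x. a * f x + b * h x) \<omega> = a * extend_field P M f \<omega> + b * extend_field P M h \<omega>"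
proof -
  obtain F where F: "\<And>n. F n \<in> schwartz" "rapid_limit F f" "l2_limit P (\<lambda>n. M (F n)) (extend_field P M f)"
    using extend_field_approx[OF assms(1)] by blast
  obtain H where H: "\<And>n. H n \<in> schwartz" "rapid_limit H h" "l2_limit P (\<lambda>n. M (H n)) (extend_field P M h)"
    using extend_field_approx[OF assms(2)] by blast
  have S: "(\<lambda>x. a * F n x + b * H n x) \<in> schwartz" for n by (intro schwartz_lincomb F H)
  have "l2_limit P (\<lambda>n. M (\<lambda>x. a * F n x + b * H n x)) (extend_field P M (\<lambda>x. a * f x + b * h x))"
    by (intro extend_field_limit assms S rapid_limit_lincomb F H)
  moreover have "l2_limit P (\<lambda>n. M (\<lambda>x. a * F n x + b * H n x)) (\<lambda>\<omega>. a * extend_field P M f \<omega> + b * extend_field P M h \<omega>)"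
  proof (rule l2_limit_cong_AE[OF l2_limit_lincomb[OF F(3) H(3)]])
    show "M (\<lambda>x. a * F n x + b * H n x) \<in> borel_measurable P" for n
      using M_square_integrable[OF S] by (simp add: square_integrable_def)
    show "AE \<omega> in P. a * M (F n) \<omega> + b * M (H n) \<omega> = M (\<lambda>x. a * F n x + b * H n x) \<omega>" for n
      using M_linear[OF F(1)[of n] H(1)[of n], of a b] by auto
  qed
  ultimately show ?thesis by (rule l2_limit_unique)
qed

lemma extend_field_mean:
  assumes "rapid f"
  shows "(LINT \<omega>|P. extend_field P M f \<omega>) = 0"
proof -
  obtain F where F: "\<And>n. F n \<in> schwartz" "l2_limit P (\<lambda>n. M (F n)) (extend_field P M f)"
    using extend_field_approx[OF assms] by blast
  have "(\<lambda>n. LINT \<omega>|P. M (F n) \<omega>) \<longlonglongrightarrow> (LINT \<omega>|P. extend_field P M f \<omega>)"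
    by (rule l2_limit_expectation[OF F(2)])
  then have "(\<lambda>n::nat. 0) \<longlonglongrightarrow> (LINT \<omega>|P. extend_field P M f \<omega>)"
    by (simp add: M_mean F(1))
  then show ?thesis by (rule LIMSEQ_unique) (rule tendsto_const)
qed

lemma extend_field_bound:
  assumes f: "rapid f" and bound: "\<And>x. jap x ^ N * cmod (f x) \<le> s"
  shows "l2_norm P (extend_field P M f) \<le> K * s"
proof -
  obtain F where F: "\<And>n. F n \<in> schwartz" "rapid_limit F f" "l2_limit P (\<lambda>n. M (F n)) (extend_field P M f)"
    using extend_field_approx[OF f] by blast
  have "l2_norm P (extend_field P M f) \<le> K * s + e" if "e > 0" for e
  proof -
    have d: "e / K > 0" using that K_pos by simp
    have "\<forall>\<^sub>F n in sequentially. l2_norm P (M (F n)) \<le> K * s + e"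
      using rapid_limitD[OF F(2) d, of N]
    proof eventually_elim
      case (elim n)
      have "jap x ^ N * cmod (F n x) \<le> s + e / K" for x
      proof -
        have "cmod (F n x) \<le> cmod (F n x - f x) + cmod (f x)"
          using norm_triangle_ineq[of "F n x - f x" "f x"] by simp
        then have "jap x ^ N * cmod (F n x) \<le> jap x ^ N * (cmod (F n x - f x) + cmod (f x))"
          using jap_pos[of x] by (intro mult_left_mono) auto
        then show ?thesis using elim[rule_format, of x] bound[of x] by (simp add: distrib_left)
      qed
      from M_bound[OF F(1) this] show ?case using K_pos by (simp add: distrib_left)
    qed
    then show ?thesis
      by (rule tendsto_upperbound[OF l2_limit_norm_bounded[OF F(3)]]) simp
  qed
  then show ?thesis by (rule field_le_epsilon)
qed

end

section \<open>Positive tempered functionals\<close>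

lemma schwartz_gauss_mult:
  assumes "d > 0" "\<And>n. pdbound n UNIV (single h)"
  shows "(\<lambda>x. complex_of_real (exp (- d * (norm x)\<^sup>2)) * h x) \<in> schwartz"
proof (rule schwartz_mult[OF _ assms(2)])
  show "(\<lambda>x. complex_of_real (exp (- d * (norm x)\<^sup>2))) \<in> schwartz"
    unfolding schwartz_iff_dbound by (intro allI dbound_gauss assms)
qed

text \<open>A positive tempered functional has order zero. Positivity is only available on squares
  \<open>|\<chi>|\<^sup>2\<close> of Schwartz functions, so \<open>2 s\<^sup>2 (1 + |x|\<^sup>2)\<^sup>-\<^sup>2\<^sup>N - |f|\<^sup>2\<close> is damped by a Gaussian before its
  square root is taken; the damping is removed in the limit.\<close>

lemma positive_functional_sup_bound:
  fixes T :: "('a::euclidean_space \<Rightarrow> complex) \<Rightarrow> complex"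
  assumes lin: "schwartz_linear T"
    and bound: "\<And>f. f \<in> schwartz \<Longrightarrow> cmod (T f) \<le> C * gauge_norm n k f"
    and pos: "\<And>f. f \<in> schwartz \<Longrightarrow> 0 \<le> Re (T (\<lambda>x. f x * cnj (f x)))"
  shows "\<exists>A N. A > 0 \<and> (\<forall>f s. f \<in> schwartz \<longrightarrow> (\<forall>x. jap x ^ N * cmod (f x) \<le> s) \<longrightarrow>
      Re (T (\<lambda>x. f x * cnj (f x))) \<le> A * s\<^sup>2)"
proof -
  let ?I = "{0<..1::real}"
  let ?G = "\<lambda>d (x::'a). complex_of_real (exp (- d * (norm x)\<^sup>2))"
  have I: "0 < d" "d \<le> 1" if "d \<in> ?I" for d using that by auto
  have "pdbound n ?I ?G" by (rule pdbound_gauss) auto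
  then obtain w where w: "dbound n ?I w ?G" by blast
  \<comment> \<open>The Gaussians have weight \<open>w\<close> uniformly in the damping. With this
    \<open>N\<close> the factor of weight \<open>- 2 * real N\<close> brings the product down to
    weight \<open>- real k\<close>, the one seen by the gauge norm that bounds
    \<open>T\<close>.\<close>
  obtain N :: nat where N: "w + real k \<le> real N" using real_arch_simple by blast
  let ?W = "\<lambda>x::'a. complex_of_real (jap x powr (- 2 * real N))"
  have "dbound n ?I (w + (- 2 * real N)) (\<lambda>d x. ?G d x * ?W x)"
    by (intro dbound_mult w dbound_jap_powr)
  then have "dbound n ?I (- real k) (\<lambda>d x. ?G d x * ?W x)"
    by (rule dbound_weaken) (use N in linarith)
  then obtain B where B: "\<And>d. d \<in> ?I \<Longrightarrow> gauge_norm n k (\<lambda>x. ?G d x * ?W x) \<le> B"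
    by (rule gauge_norm_bounded) blast
  have pW: "pdbound m UNIV (single ?W)" for m
    using dbound_jap_powr[of m UNIV] by blast
  have GW: "(\<lambda>x. ?G d x * ?W x) \<in> schwartz" if "d \<in> ?I" for d
    using schwartz_gauss_mult[OF I(1)[OF that] pW] .
  define A where "A = 2 * (\<bar>C\<bar> * \<bar>B\<bar> + 1)"
  have TGW: "cmod (T (\<lambda>x. ?G d x * ?W x)) \<le> \<bar>C\<bar> * \<bar>B\<bar>" if "d \<in> ?I" for d
  proof -
    have "cmod (T (\<lambda>x. ?G d x * ?W x)) \<le> C * gauge_norm n k (\<lambda>x. ?G d x * ?W x)"
      by (rule bound[OF GW[OF that]])
    also have "\<dots> \<le> \<bar>C\<bar> * \<bar>B\<bar>"
      using B[OF that] gauge_norm_nonneg[OF GW[OF that], of n k] by (intro mult_mono) auto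
    finally show ?thesis .
  qed
  have main: "Re (T (\<lambda>x. f x * cnj (f x))) \<le> A * s\<^sup>2"
    if f: "f \<in> schwartz" and s: "\<And>x. jap x ^ N * cmod (f x) \<le> s" "s > 0" for f s
  proof -
    let ?f2 = "\<lambda>x. f x * cnj (f x)"
    have f2: "?f2 \<in> schwartz" by (intro schwartz_mult_schwartz f schwartz_cnj)
    \<comment> \<open>One copy of s^2 \<open>jap\<close>^(-2N) already dominates |f|^2. The second
      copy leaves \<open>h\<close> with the positive lower bound under which its root is smooth with
      polynomially bounded derivatives.\<close>
    define h where "h x = 2 * s\<^sup>2 * jap x powr (- 2 * real N) - (cmod (f x))\<^sup>2" for x
    have hC: "complex_of_real (h x) = complex_of_real (2 * s\<^sup>2) * ?W x + -1 * ?f2 x" for x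
      by (simp add: h_def complex_norm_square[symmetric])
    have ph: "pdbound m (UNIV :: unit set) (\<lambda>i x. complex_of_real (h x))" for m
      unfolding hC by (intro pdbound_add pdbound_cmult pW schwartz_pdbound f2)
    have lower: "s\<^sup>2 * jap x powr (- 2 * real N) \<le> h x" for x
    proof -
      have "cmod (f x) \<le> s * jap x powr (- real N)"
        using s(1)[of x] by (simp add: jap_weight_iff)
      then have "(cmod (f x))\<^sup>2 \<le> (s * jap x powr (- real N))\<^sup>2"
        by (intro power_mono) auto
      also have "\<dots> = s\<^sup>2 * jap x powr (- 2 * real N)"
        by (simp add: power_mult_distrib power2_eq_square powr_add[symmetric])
      finally show ?thesis by (simp add: h_def)
    qed
    have "s\<^sup>2 > 0" using s by simp
    have hpos: "h x > 0" for x
      using lower[of x] \<open>s\<^sup>2 > 0\<close> jap_pos[of x] by (smt (verit) mult_pos_pos powr_gt_zero)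
    have pr: "pdbound m (UNIV :: unit set) (\<lambda>i x. complex_of_real (1 / sqrt (h x)))" for m
      by (rule pdbound_rsqrt[OF ph \<open>s\<^sup>2 > 0\<close> lower])
    have le: "Re (T (\<lambda>x. ?G d x * ?f2 x)) \<le> A * s\<^sup>2" if d: "d \<in> ?I" for d
    proof -
      \<comment> \<open>h times its reciprocal root is the root of \<open>h\<close>, written so that
        the product rule and \<open>pdbound_rsqrt\<close> cover it. The Gaussian with parameter d/2
        squares to the one with parameter d.\<close>
      let ?x = "\<lambda>x. ?G (d / 2) x * (complex_of_real (h x) * complex_of_real (1 / sqrt (h x)))"
      have chi: "?x \<in> schwartz"
        by (intro schwartz_gauss_mult pdbound_mult ph pr) (use d in auto)
      have Gf2: "(\<lambda>x. ?G d x * ?f2 x) \<in> schwartz"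
        by (rule schwartz_gauss_mult) (use d schwartz_pdbound[OF f2] in auto)
      have "?x x * cnj (?x x) = complex_of_real (2 * s\<^sup>2) * (?G d x * ?W x) + -1 * (?G d x * ?f2 x)" for x
      proof -
        have hq: "h x * (1 / sqrt (h x)) = sqrt (h x)"
          using hpos[of x] by (simp add: real_div_sqrt)
        have x: "?x x = complex_of_real (exp (- (d / 2) * (norm x)\<^sup>2) * sqrt (h x))"
          by (simp only: hq flip: of_real_mult)
        have "exp (- (d / 2) * (norm x)\<^sup>2) * exp (- (d / 2) * (norm x)\<^sup>2) = exp (- d * (norm x)\<^sup>2)"
          by (simp add: exp_add[symmetric])
        then have sq: "(exp (- (d / 2) * (norm x)\<^sup>2) * sqrt (h x)) * (exp (- (d / 2) * (norm x)\<^sup>2) * sqrt (h x)) = exp (- d * (norm x)\<^sup>2) * h x"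
          using hpos[of x] by (simp add: mult_ac flip: mult.assoc)
        have "?x x * cnj (?x x) = complex_of_real (exp (- d * (norm x)\<^sup>2) * h x)"
          by (simp only: x complex_cnj_complex_of_real hq sq flip: of_real_mult)
        also have "\<dots> = ?G d x * (complex_of_real (2 * s\<^sup>2) * ?W x + -1 * ?f2 x)"
          by (simp only: of_real_mult hC)
        finally show ?thesis by (simp only: distrib_left mult_ac)
      qed
      then have "T (\<lambda>x. ?x x * cnj (?x x)) = T (\<lambda>x. complex_of_real (2 * s\<^sup>2) * (?G d x * ?W x) + -1 * (?G d x * ?f2 x))"
        by simp
      also have "\<dots> = complex_of_real (2 * s\<^sup>2) * T (\<lambda>x. ?G d x * ?W x) + -1 * T (\<lambda>x. ?G d x * ?f2 x)"
        by (rule schwartz_linearD(1)[OF lin GW[OF d] Gf2])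
      finally have "0 \<le> Re (complex_of_real (2 * s\<^sup>2) * T (\<lambda>x. ?G d x * ?W x) + -1 * T (\<lambda>x. ?G d x * ?f2 x))"
        using pos[OF chi] by simp
      then have "Re (T (\<lambda>x. ?G d x * ?f2 x)) \<le> 2 * s\<^sup>2 * Re (T (\<lambda>x. ?G d x * ?W x))"
        by simp
      also have "\<dots> \<le> 2 * s\<^sup>2 * (\<bar>C\<bar> * \<bar>B\<bar>)"
        using complex_Re_le_cmod[of "T (\<lambda>x. ?G d x * ?W x)"] TGW[OF d] by (intro mult_left_mono) auto
      also have "\<dots> \<le> A * s\<^sup>2"
        by (simp add: A_def algebra_simps)
      finally show ?thesis .
    qed
    \<comment> \<open>The undamped function differs from the damped one by d times
      \<open>?D d\<close> times |f|^2. The gauge norm of that product is bounded uniformly in d, so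
      the difference under \<open>T\<close> is of order d.\<close>
    let ?D = "\<lambda>d (x::'a). complex_of_real ((1 - exp (- d * (norm x)\<^sup>2)) / d)"
    have "pdbound n ?I ?D" by (rule pdbound_gauss_diff) auto
    then obtain v where v: "dbound n ?I v ?D" by blast
    have "dbound n ?I (v + (- real k - v)) (\<lambda>d x. ?D d x * ?f2 x)"
      by (intro dbound_mult v schwartzD f2)
    then obtain E where E: "\<And>d. d \<in> ?I \<Longrightarrow> gauge_norm n k (\<lambda>x. ?D d x * ?f2 x) \<le> E"
      by (simp only: add_diff_cancel_left' add.commute[of v] diff_add_cancel) (rule gauge_norm_bounded, blast+)
    have Df2: "(\<lambda>x. ?D d x * ?f2 x) \<in> schwartz" if d: "d \<in> ?I" for d
    proof -
      have "pdbound m (UNIV :: unit set) (\<lambda>i x. ?D d x)" for m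
        by (rule pdbound_gauss_diff) (use d in auto)
      from schwartz_mult[OF f2 this] show ?thesis by (simp only: mult.commute)
    qed
    have "Re (T ?f2) \<le> A * s\<^sup>2 + d * (\<bar>C\<bar> * \<bar>E\<bar>)" if d: "d \<in> ?I" for d
    proof -
      have Gf2: "(\<lambda>x. ?G d x * ?f2 x) \<in> schwartz"
        by (rule schwartz_gauss_mult) (use d schwartz_pdbound[OF f2] in auto)
      have "?f2 x = 1 * (?G d x * ?f2 x) + complex_of_real d * (?D d x * ?f2 x)" for x
        using d by (simp add: field_simps)
      then have "T ?f2 = T (\<lambda>x. 1 * (?G d x * ?f2 x) + complex_of_real d * (?D d x * ?f2 x))"
        by simp
      also have "\<dots> = 1 * T (\<lambda>x. ?G d x * ?f2 x) + complex_of_real d * T (\<lambda>x. ?D d x * ?f2 x)"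
        by (rule schwartz_linearD(1)[OF lin Gf2 Df2[OF d]])
      finally have "Re (T ?f2) = Re (T (\<lambda>x. ?G d x * ?f2 x)) + d * Re (T (\<lambda>x. ?D d x * ?f2 x))"
        by simp
      also have "\<dots> \<le> A * s\<^sup>2 + d * (\<bar>C\<bar> * \<bar>E\<bar>)"
      proof (intro add_mono le d mult_left_mono)
        have "Re (T (\<lambda>x. ?D d x * ?f2 x)) \<le> C * gauge_norm n k (\<lambda>x. ?D d x * ?f2 x)"
          using complex_Re_le_cmod bound[OF Df2[OF d]] by (rule order_trans)
        also have "\<dots> \<le> \<bar>C\<bar> * \<bar>E\<bar>"
          using E[OF d] gauge_norm_nonneg[OF Df2[OF d], of n k] by (intro mult_mono) auto
        finally show "Re (T (\<lambda>x. ?D d x * ?f2 x)) \<le> \<bar>C\<bar> * \<bar>E\<bar>" .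
      qed (use d in auto)
      finally show ?thesis .
    qed
    then have "\<forall>\<^sub>F d in at_right 0. Re (T ?f2) \<le> A * s\<^sup>2 + d * (\<bar>C\<bar> * \<bar>E\<bar>)"
      by (auto simp: eventually_at_right_field intro!: exI[of _ 1])
    moreover have "((\<lambda>d. A * s\<^sup>2 + d * (\<bar>C\<bar> * \<bar>E\<bar>)) \<longlongrightarrow> A * s\<^sup>2 + 0 * (\<bar>C\<bar> * \<bar>E\<bar>)) (at_right 0)"
      by (intro tendsto_intros)
    ultimately have "Re (T ?f2) \<le> A * s\<^sup>2 + 0 * (\<bar>C\<bar> * \<bar>E\<bar>)"
      by (intro tendsto_lowerbound[of _ _ "at_right 0"]) auto
    then show ?thesis by simp
  qed
  have "Re (T (\<lambda>x. f x * cnj (f x))) \<le> A * s\<^sup>2"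
    if f: "f \<in> schwartz" and s: "\<And>x. jap x ^ N * cmod (f x) \<le> s" for f s
  proof -
    have s0: "s \<ge> 0" using s[of 0] by (rule order_trans[rotated]) (simp add: jap_def)
    \<comment> \<open>The bound \<open>main\<close> requires s > 0; the value s = 0 is reached by
      letting s + e tend to s.\<close>
    have "Re (T (\<lambda>x. f x * cnj (f x))) \<le> A * (s + e)\<^sup>2" if "e > 0" for e
    proof (intro main f)
      show "jap x ^ N * cmod (f x) \<le> s + e" for x using s[of x] that by linarith
    qed (use s0 that in simp)
    then have "\<forall>\<^sub>F e in at_right 0. Re (T (\<lambda>x. f x * cnj (f x))) \<le> A * (s + e)\<^sup>2"
      by (auto simp: eventually_at_right_field intro!: exI[of _ 1])
    moreover have "((\<lambda>e. A * (s + e)\<^sup>2) \<longlongrightarrow> A * (s + 0)\<^sup>2) (at_right 0)"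
      by (intro tendsto_intros)
    ultimately have "Re (T (\<lambda>x. f x * cnj (f x))) \<le> A * (s + 0)\<^sup>2"
      by (intro tendsto_lowerbound[of _ _ "at_right 0"]) auto
    then show ?thesis by simp
  qed
  moreover have "A > 0" by (simp add: A_def add_nonneg_pos)
  ultimately show ?thesis by (intro exI[of _ A] exI[of _ N]) blast
qed

section \<open>Stationary fields and symbol operators\<close>

lemma slow_growing_E:
  assumes "slow_growing \<mu>"
  obtains N where "integrable \<mu> (\<lambda>x. 1 / jap x ^ N)"
proof -
  obtain N where N: "sets \<mu> = sets borel" "(\<integral>\<^sup>+ x. ennreal (1 / jap x ^ N) \<partial>\<mu>) < \<infinity>"
    using assms unfolding slow_growing_def jap_def[symmetric] by blast
  note [measurable_cong] = N(1)
  have "integrable \<mu> (\<lambda>x. 1 / jap x ^ N)"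
    using N(2) by (subst integrable_iff_bounded) (auto simp: jap_power_abs)
  then show ?thesis using that by blast
qed

lemma slow_growing_borel:
  "slow_growing \<mu> \<Longrightarrow> f \<in> borel_measurable borel \<Longrightarrow> f \<in> borel_measurable \<mu>"
  unfolding slow_growing_def using measurable_cong_sets by blast

lemma rapid_borel: "rapid f \<Longrightarrow> f \<in> borel_measurable borel"
  unfolding rapid_def by (intro borel_measurable_continuous_onI) simp

lemma slow_growing_integrable:
  assumes sg: "slow_growing \<mu>" and f: "f \<in> schwartz"
  shows "integrable \<mu> f"
proof -
  obtain N where N: "integrable \<mu> (\<lambda>x. 1 / jap x ^ N)" using slow_growing_E[OF sg] by blast
  obtain C where C: "C > 0" "\<And>x. jap x ^ N * cmod (f x) \<le> C" using rapid_E[OF schwartz_rapid[OF f]] by blast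
  show ?thesis
  proof (rule Bochner_Integration.integrable_bound[OF integrable_mult_right[OF N, of C]])
    show "f \<in> borel_measurable \<mu>" by (intro slow_growing_borel[OF sg] schwartz_borel f)
    show "AE x in \<mu>. norm (f x) \<le> norm (C * (1 / jap x ^ N))"
    proof (rule AE_I2)
      fix x
      have "cmod (f x) \<le> C / jap x ^ N"
        using C(2)[of x] jap_pos[of x] by (simp add: field_simps)
      then show "norm (f x) \<le> norm (C * (1 / jap x ^ N))"
        using C(1) by (simp add: jap_power_abs abs_mult)
    qed
  qed
qed

lemma rapid_l2_bound:
  assumes sg: "slow_growing \<mu>"
  shows "\<exists>N B. B > 0 \<and> (\<forall>f s. rapid f \<longrightarrow> square_integrable \<mu> f \<and>
    ((\<forall>x. jap x ^ N * cmod (f x) \<le> s) \<longrightarrow> l2_norm \<mu> f \<le> B * s))"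
proof -
  obtain N where N: "integrable \<mu> (\<lambda>x. 1 / jap x ^ N)" using slow_growing_E[OF sg] by blast
  define J where "J = (LINT x|\<mu>. 1 / jap x ^ N)"
  have J: "J \<ge> 0" unfolding J_def by (intro Bochner_Integration.integral_nonneg) (simp add: jap_pos less_imp_le)
  have pt: "(cmod (f x))\<^sup>2 \<le> s\<^sup>2 * (1 / jap x ^ N)" if "\<And>x. jap x ^ N * cmod (f x) \<le> s" for f :: "'a \<Rightarrow> complex" and s x
  proof -
    have "cmod (f x) \<le> s / jap x ^ N"
      using that[of x] jap_pos[of x] by (simp add: field_simps)
    then have "(cmod (f x))\<^sup>2 \<le> (s / jap x ^ N)\<^sup>2"
      by (intro power_mono) auto
    also have "\<dots> = s\<^sup>2 * ((1 / jap x ^ N) * (1 / jap x ^ N))"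
      by (simp add: power2_eq_square)
    also have "\<dots> \<le> s\<^sup>2 * ((1 / jap x ^ N) * 1)"
      using jap_ge_1[of x] jap_pos[of x] by (intro mult_left_mono) (auto simp: one_le_power)
    finally show ?thesis by simp
  qed
  have sq: "square_integrable \<mu> f" if f: "rapid f" for f
  proof -
    obtain C where C: "C > 0" "\<And>x. jap x ^ N * cmod (f x) \<le> C" using rapid_E[OF f] by blast
    have [measurable]: "f \<in> borel_measurable \<mu>" by (intro slow_growing_borel[OF sg] rapid_borel f)
    have "integrable \<mu> (\<lambda>x. (cmod (f x))\<^sup>2)"
    proof (rule Bochner_Integration.integrable_bound[OF integrable_mult_right[OF N, of "C\<^sup>2"]])
      show "AE x in \<mu>. norm ((cmod (f x))\<^sup>2) \<le> norm (C\<^sup>2 * (1 / jap x ^ N))"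
        using pt[OF C(2)] by (intro AE_I2) (simp add: jap_power_abs)
    qed measurable
    then show ?thesis by (simp add: square_integrable_def)
  qed
  have "l2_norm \<mu> f \<le> (sqrt J + 1) * s" if f: "rapid f" "\<And>x. jap x ^ N * cmod (f x) \<le> s" for f s
  proof -
    have s: "s \<ge> 0" using f(2)[of 0] by (rule order_trans[rotated]) (simp add: jap_def)
    have "(LINT x|\<mu>. (cmod (f x))\<^sup>2) \<le> (LINT x|\<mu>. s\<^sup>2 * (1 / jap x ^ N))"
      using sq[OF f(1)] pt[OF f(2)] by (intro Bochner_Integration.integral_mono integrable_mult_right N) (auto simp: square_integrable_def)
    also have "\<dots> = s\<^sup>2 * J" unfolding J_def by (rule integral_mult_right_zero)
    finally have "l2_norm \<mu> f \<le> sqrt (s\<^sup>2 * J)"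
      unfolding l2_norm_def by (rule real_sqrt_le_mono)
    also have "\<dots> = sqrt J * s" using s by (simp add: real_sqrt_mult)
    also have "\<dots> \<le> (sqrt J + 1) * s" using s by (simp add: distrib_right)
    finally show ?thesis .
  qed
  moreover have "sqrt J + 1 > 0" using J by (simp add: add_nonneg_pos)
  ultimately show ?thesis using sq by (intro exI[of _ N] exI[of _ "sqrt J + 1"]) simp
qed

lemma rapid_diff: "rapid f \<Longrightarrow> rapid h \<Longrightarrow> rapid (\<lambda>x. f x - h x)"
  unfolding rapid_def
proof (intro conjI allI)
  fix k
  assume "continuous_on UNIV f \<and> (\<forall>k. \<exists>C. \<forall>x. jap x ^ k * cmod (f x) \<le> C)"
    and "continuous_on UNIV h \<and> (\<forall>k. \<exists>C. \<forall>x. jap x ^ k * cmod (h x) \<le> C)"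
  then obtain C D where C: "\<And>x. jap x ^ k * cmod (f x) \<le> C" and D: "\<And>x. jap x ^ k * cmod (h x) \<le> D"
    by meson
  have "jap x ^ k * cmod (f x - h x) \<le> C + D" for x
  proof -
    have "jap x ^ k * cmod (f x - h x) \<le> jap x ^ k * (cmod (f x) + cmod (h x))"
      using jap_pos[of x] by (intro mult_left_mono norm_triangle_ineq4) auto
    then show ?thesis using C[of x] D[of x] by (simp add: distrib_left)
  qed
  then show "\<exists>C. \<forall>x. jap x ^ k * cmod (f x - h x) \<le> C" by blast
qed (auto intro: continuous_intros)

text \<open>The sequences that define the extension of a field also converge in L2 of any
  slow-growing measure. Comparing the two limits yields covariances of extended fields.\<close>

lemma rapid_limit_l2_limit:
  assumes sg: "slow_growing \<mu>" and f: "rapid f" and F: "\<And>n. F n \<in> schwartz" "rapid_limit F f"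
  shows "l2_limit \<mu> F f"
proof -
  from rapid_l2_bound[OF sg] obtain N B where B: "B > 0"
    and B': "\<forall>f s. rapid f \<longrightarrow> square_integrable \<mu> f \<and>
      ((\<forall>x. jap x ^ N * cmod (f x) \<le> s) \<longrightarrow> l2_norm \<mu> f \<le> B * s)"
    by (elim exE conjE)
  have "(\<lambda>n. l2_norm \<mu> (\<lambda>x. F n x - f x)) \<longlonglongrightarrow> 0"
  proof (rule LIMSEQ_I)
    fix e :: real assume e: "e > 0"
    have "e / (2 * B) > 0" using e B by simp
    from rapid_limitD[OF F(2) this, of N]
    obtain m where m: "\<And>n x. n \<ge> m \<Longrightarrow> jap x ^ N * cmod (F n x - f x) \<le> e / (2 * B)"
      by (auto simp: eventually_sequentially)
    have "l2_norm \<mu> (\<lambda>x. F n x - f x) \<le> B * (e / (2 * B))" if "n \<ge> m" for n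
      using B'[rule_format, OF rapid_diff[OF schwartz_rapid[OF F(1)] f], THEN conjunct2, rule_format, OF m[OF that]] .
    moreover have "B * (e / (2 * B)) < e" using e B by simp
    ultimately show "\<exists>m. \<forall>n\<ge>m. norm (l2_norm \<mu> (\<lambda>x. F n x - f x) - 0) < e"
      by (intro exI[of _ m]) (auto simp: l2_norm_nonneg intro: le_less_trans)
  qed
  moreover have "square_integrable \<mu> h" if "rapid h" for h
    using B' that by blast
  ultimately show ?thesis using f schwartz_rapid[OF F(1)] by (simp add: l2_limit_def)
qed

section \<open>Continuity of fields and covariances of their transforms\<close>

lemma gerf_square_integrable:
  assumes "gerf P Z" "f \<in> schwartz"
  shows "square_integrable P (Z f)"
proof -
  have "Z \<in> topspace schwartz_topology \<rightarrow> topspace (l2_topology P)"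
    using assms(1) by (simp add: gerf_def continuous_map_def)
  then have "Z f \<in> topspace (l2_topology P)"
    using assms(2) by (auto simp: topspace_schwartz_topology)
  then show ?thesis
    unfolding l2_topology_def topology_generated_by_topspace by blast
qed

text \<open>The increment of \<open>Z\<close> agrees with the value of \<open>Z\<close> at the
  difference only up to a null set, which \<open>l2_norm\<close> does not see. The gauge estimate at
  the difference therefore gives continuity at every point.\<close>

lemma continuous_map_l2I:
  assumes sq: "\<And>f. f \<in> schwartz \<Longrightarrow> square_integrable P (Z f)"
    and lin: "\<And>f h a b. f \<in> schwartz \<Longrightarrow> h \<in> schwartz \<Longrightarrow>
      AE \<omega> in P. Z (\<lambda>x. a * f x + b * h x) \<omega> = a * Z f \<omega> + b * Z h \<omega>"
    and bound: "\<And>f. f \<in> schwartz \<Longrightarrow> l2_norm P (Z f) \<le> C * gauge_norm n k f"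
  shows "continuous_map schwartz_topology (l2_topology P) Z"
  unfolding l2_topology_def
proof (rule continuous_on_generated_topo)
  fix V assume "V \<in> {{Y. square_integrable P Y \<and> l2_norm P (\<lambda>\<omega>. Y \<omega> - Y0 \<omega>) < e} | Y0 e.
        square_integrable P Y0 \<and> e > 0}"
  then obtain Y0 e where V: "V = {Y. square_integrable P Y \<and> l2_norm P (\<lambda>\<omega>. Y \<omega> - Y0 \<omega>) < e}"
    and Y0: "square_integrable P Y0" by blast
  show "openin schwartz_topology (Z -` V \<inter> topspace schwartz_topology)"
  proof (subst openin_subopen, intro ballI)
    fix f0 assume "f0 \<in> Z -` V \<inter> topspace schwartz_topology"
    then have f0: "f0 \<in> schwartz" "l2_norm P (\<lambda>\<omega>. Z f0 \<omega> - Y0 \<omega>) < e"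
      by (auto simp: V topspace_schwartz_topology)
    define d where "d = e - l2_norm P (\<lambda>\<omega>. Z f0 \<omega> - Y0 \<omega>)"
    have d: "d > 0" using f0 by (simp add: d_def)
    obtain U where U: "openin schwartz_topology U" "f0 \<in> U"
      "\<And>f. f \<in> U \<Longrightarrow> f \<in> schwartz \<and> gauge_norm n k (\<lambda>x. f x - f0 x) < d / (\<bar>C\<bar> + 1)"
      using gauge_ball_nhd[OF f0(1), of "d / (\<bar>C\<bar> + 1)" n k] d by auto
    have "Z f \<in> V" if "f \<in> U" for f
    proof -
      have f: "f \<in> schwartz" using U(3)[OF that] by blast
      have D: "(\<lambda>x. f x - f0 x) \<in> schwartz" by (intro schwartz_diff f f0)
      have [measurable]: "Z f \<in> borel_measurable P" "Z f0 \<in> borel_measurable P" "Z (\<lambda>x. f x - f0 x) \<in> borel_measurable P"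
        using sq[OF f] sq[OF f0(1)] sq[OF D] by (auto simp: square_integrable_def)
      have "l2_norm P (\<lambda>\<omega>. Z f \<omega> - Z f0 \<omega>) = l2_norm P (Z (\<lambda>x. f x - f0 x))"
        using lin[OF f f0(1), of 1 "-1"] by (intro l2_norm_cong_AE) auto
      also have "\<dots> \<le> C * gauge_norm n k (\<lambda>x. f x - f0 x)" by (rule bound[OF D])
      also have "\<dots> \<le> (\<bar>C\<bar> + 1) * gauge_norm n k (\<lambda>x. f x - f0 x)"
        by (intro mult_right_mono gauge_norm_nonneg D) auto
      also have "\<dots> < d"
        using U(3)[OF that] by (simp add: field_simps)
      finally have "l2_norm P (\<lambda>\<omega>. Z f \<omega> - Y0 \<omega>) < e"
        using l2_norm_diff_triangle[OF sq[OF f] sq[OF f0(1)] Y0] by (simp add: d_def)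
      then show ?thesis using sq[OF f] by (simp add: V)
    qed
    then show "\<exists>U. openin schwartz_topology U \<and> f0 \<in> U \<and> U \<subseteq> Z -` V \<inter> topspace schwartz_topology"
      using U by (auto simp: topspace_schwartz_topology)
  qed
next
  show "Z ` topspace schwartz_topology \<subseteq> \<Union>{{Y. square_integrable P Y \<and> l2_norm P (\<lambda>\<omega>. Y \<omega> - Y0 \<omega>) < e} | Y0 e.
        square_integrable P Y0 \<and> e > 0}"
  proof
    fix Y assume "Y \<in> Z ` topspace schwartz_topology"
    then have Y: "square_integrable P Y" using sq by (auto simp: topspace_schwartz_topology)
    moreover have "l2_norm P (\<lambda>\<omega>. Y \<omega> - Y \<omega>) < 1" by (simp add: l2_norm_def)
    ultimately show "Y \<in> \<Union>{{Y. square_integrable P Y \<and> l2_norm P (\<lambda>\<omega>. Y \<omega> - Y0 \<omega>) < e} | Y0 e.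
        square_integrable P Y0 \<and> e > 0}"
      by (intro UnionI[of "{Y'. square_integrable P Y' \<and> l2_norm P (\<lambda>\<omega>. Y' \<omega> - Y \<omega>) < 1}"])
         (auto intro!: exI[of _ Y] exI[of _ "1::real"])
  qed
qed

abbreviation spconst :: "'a::euclidean_space itself \<Rightarrow> complex" where
  "spconst _ \<equiv> complex_of_real ((2 * pi) powr (real DIM('a) / 2))"

text \<open>The reflected conjugate of a transform is the transform of the conjugate. The
  convolution in the definition of stationarity thus joins two transforms and becomes the transform
  of a pointwise product.\<close>

lemma stationary_covariance_fourier_field:
  fixes U :: "('a::euclidean_space, 'w) random_field"
  assumes U: "has_stationary_covariance Q U \<rho>" and f: "f \<in> schwartz" and h: "h \<in> schwartz"
  shows "(LINT \<omega>|Q. fourier_field U f \<omega> * cnj (fourier_field U h \<omega>))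
    = spconst TYPE('a) * \<rho> (fourier (\<lambda>x. f x * cnj (h x)))"
proof -
  obtain C where C: "has_covariance_distribution Q U C"
    "\<And>f h. f \<in> schwartz \<Longrightarrow> h \<in> schwartz \<Longrightarrow> C (tensor f (\<lambda>x. cnj (h x))) = \<rho> (convolve f (reflect (\<lambda>x. cnj (h x))))"
    using U unfolding has_stationary_covariance_def by blast
  have lin: "schwartz_linear \<rho>"
    using U by (simp add: has_stationary_covariance_def tempered_def schwartz_linear_def)
  have S: "fourier (\<lambda>x. f x * cnj (h x)) \<in> schwartz"
    by (intro fourier_schwartz schwartz_mult_schwartz schwartz_cnj f h)
  have "(LINT \<omega>|Q. U (fourier f) \<omega> * cnj (U (fourier h) \<omega>)) = \<rho> (convolve (fourier f) (reflect (\<lambda>x. cnj (fourier h x))))"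
    using C fourier_schwartz[OF f] fourier_schwartz[OF h] by (simp add: has_covariance_distribution_def)
  also have "\<dots> = \<rho> (\<lambda>x. spconst TYPE('a) * fourier (\<lambda>y. f y * cnj (h y)) x)"
    by (simp add: reflect_cnj_fourier convolve_fourier[OF f schwartz_cnj[OF h]])
  also have "\<dots> = spconst TYPE('a) * \<rho> (fourier (\<lambda>x. f x * cnj (h x)))"
    by (rule schwartz_linearD(4)[OF lin S S])
  finally show ?thesis by (simp add: fourier_field_def)
qed

lemma integral_mult_cnj_self: "(LINT \<omega>|P. Y \<omega> * cnj (Y \<omega>)) = complex_of_real ((l2_norm P Y)\<^sup>2)"
proof -
  have "(LINT \<omega>|P. Y \<omega> * cnj (Y \<omega>)) = (LINT \<omega>|P. complex_of_real ((cmod (Y \<omega>))\<^sup>2))"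
    by (simp only: complex_norm_square)
  then show ?thesis by (simp only: integral_complex_of_real l2_norm_square)
qed

lemma stationary_sup_continuous_field:
  fixes U :: "('a::euclidean_space, 'w) random_field"
  assumes gerf: "gerf Q U" and U: "has_stationary_covariance Q U \<rho>"
  obtains K N where "sup_continuous_field Q (fourier_field U) K N"
proof -
  have temp: "tempered \<rho>" using U by (simp add: has_stationary_covariance_def)
  then have lin: "schwartz_linear \<rho>" by (simp add: tempered_def schwartz_linear_def)
  from tempered_gauge_bound[OF temp]
  obtain n k C where C: "\<forall>f\<in>schwartz. cmod (\<rho> f) \<le> C * gauge_norm n k f"
    by (elim exE)
  from fourier_gauge_bound[of n k]
  obtain m l D where D: "\<forall>f::'a \<Rightarrow> complex. f \<in> schwartz \<longrightarrow> gauge_norm n k (fourier f) \<le> D * gauge_norm m l f"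
    by (elim exE)
  define T where "T f = spconst TYPE('a) * \<rho> (fourier f)" for f
  let ?c = "(2 * pi) powr (real DIM('a) / 2)"
  have sq: "square_integrable Q (fourier_field U f)" if "f \<in> schwartz" for f
    unfolding fourier_field_def by (intro gerf_square_integrable[OF gerf] fourier_schwartz that)
  have T_norm: "T (\<lambda>x. f x * cnj (f x)) = complex_of_real ((l2_norm Q (fourier_field U f))\<^sup>2)" if "f \<in> schwartz" for f
    using stationary_covariance_fourier_field[OF U that that] by (simp only: T_def integral_mult_cnj_self)
  have T_lin: "schwartz_linear T"
    unfolding schwartz_linear_def T_def
    by (auto simp: fourier_lincomb schwartz_linearD(1)[OF lin] fourier_schwartz algebra_simps)
  have T_bound: "cmod (T f) \<le> (?c * (\<bar>C\<bar> * D)) * gauge_norm m l f" if "f \<in> schwartz" for f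
  proof -
    have "cmod (T f) = ?c * cmod (\<rho> (fourier f))" by (simp add: T_def norm_mult)
    also have "\<dots> \<le> ?c * (C * gauge_norm n k (fourier f))"
      by (intro mult_left_mono C[rule_format] fourier_schwartz that) auto
    also have "\<dots> \<le> ?c * (\<bar>C\<bar> * (D * gauge_norm m l f))"
      by (intro mult_left_mono mult_mono D[rule_format] that gauge_norm_nonneg fourier_schwartz) auto
    finally show ?thesis by (simp add: mult_ac)
  qed
  have T_pos: "0 \<le> Re (T (\<lambda>x. f x * cnj (f x)))" if "f \<in> schwartz" for f
    using that by (simp add: T_norm)
  have "\<exists>A N. A > 0 \<and> (\<forall>f s. f \<in> schwartz \<longrightarrow> (\<forall>x. jap x ^ N * cmod (f x) \<le> s) \<longrightarrow>
      Re (T (\<lambda>x. f x * cnj (f x))) \<le> A * s\<^sup>2)"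
    by (rule positive_functional_sup_bound[OF T_lin T_bound T_pos])
  then obtain A N where A: "A > 0" "\<forall>f s. f \<in> schwartz \<longrightarrow> (\<forall>x. jap x ^ N * cmod (f x) \<le> s) \<longrightarrow>
      Re (T (\<lambda>x. f x * cnj (f x))) \<le> A * s\<^sup>2"
    by (elim exE conjE)
  have "sup_continuous_field Q (fourier_field U) (sqrt A) N"
  proof (intro sup_continuous_field.intro sup_continuous_field_axioms.intro)
    show "prob_space Q" using gerf by (simp add: gerf_def)
    show "square_integrable Q (fourier_field U f)" if "f \<in> schwartz" for f by (rule sq[OF that])
    show "AE \<omega> in Q. fourier_field U (\<lambda>x. a * f x + b * h x) \<omega> = a * fourier_field U f \<omega> + b * fourier_field U h \<omega>"
      if "f \<in> schwartz" "h \<in> schwartz" for f h a b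
      using gerf that by (simp add: gerf_def fourier_field_def fourier_lincomb fourier_schwartz)
    show "(LINT \<omega>|Q. fourier_field U f \<omega>) = 0" if "f \<in> schwartz" for f
      using gerf that by (simp add: gerf_def fourier_field_def fourier_schwartz)
    show "sqrt A > 0" using A(1) by simp
    fix f :: "'a \<Rightarrow> complex" and s assume f: "f \<in> schwartz" and s: "\<And>x. jap x ^ N * cmod (f x) \<le> s"
    have s0: "s \<ge> 0" using s[of 0] by (rule order_trans[rotated]) (simp add: jap_def)
    have "(l2_norm Q (fourier_field U f))\<^sup>2 \<le> A * s\<^sup>2"
      using A(2)[rule_format, OF f s] by (simp add: T_norm[OF f])
    also have "\<dots> = (sqrt A * s)\<^sup>2" using A(1) by (simp add: power_mult_distrib)
    finally show "l2_norm Q (fourier_field U f) \<le> sqrt A * s"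
      by (rule power2_le_imp_le) (use A(1) s0 in simp)
  qed
  then show ?thesis using that by blast
qed

lemma even_measure_integral:
  fixes f :: "'a::euclidean_space \<Rightarrow> complex"
  assumes "even_measure \<mu>" "sets \<mu> = sets borel" and [measurable]: "f \<in> borel_measurable borel"
  shows "(LINT x|\<mu>. f (- x)) = (LINT x|\<mu>. f x)"
proof -
  note [measurable_cong] = assms(2)
  have "(LINT x|\<mu>. f x) = (LINT x|distr \<mu> borel uminus. f x)"
    using assms(1) by (simp add: even_measure_def)
  also have "\<dots> = (LINT x|\<mu>. f (- x))"
    by (subst integral_distr) auto
  finally show ?thesis ..
qed

text \<open>Since \<open>\<rho>\<close> is the transform of \<open>\<mu>\<close>, the product is
  transformed twice, that is, reflected; evenness of \<open>\<mu>\<close> removes the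
  reflection.\<close>

lemma spectral_covariance_fourier_field:
  fixes U :: "('a::euclidean_space, 'w) random_field"
  assumes U: "has_spectral_measure Q U \<mu>" and f: "f \<in> schwartz" and h: "h \<in> schwartz"
  shows "(LINT \<omega>|Q. fourier_field U f \<omega> * cnj (fourier_field U h \<omega>))
    = spconst TYPE('a) * (LINT x|\<mu>. f x * cnj (h x))"
proof -
  obtain \<rho> where \<rho>: "has_stationary_covariance Q U \<rho>"
    "\<And>f. f \<in> schwartz \<Longrightarrow> \<rho> f = fourier_distribution (measure_distribution \<mu>) f"
    using U unfolding has_spectral_measure_def by blast
  have fh: "(\<lambda>x. f x * cnj (h x)) \<in> schwartz"
    by (intro schwartz_mult_schwartz schwartz_cnj f h)
  have "\<rho> (fourier (\<lambda>x. f x * cnj (h x))) = (LINT x|\<mu>. f (- x) * cnj (h (- x)))"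
    using fourier_fourier[OF fh]
    by (simp add: \<rho>(2) fourier_schwartz[OF fh] fourier_distribution_def measure_distribution_def reflect_def)
  also have "\<dots> = (LINT x|\<mu>. f x * cnj (h x))"
    using U by (intro even_measure_integral schwartz_borel[OF fh])
      (auto simp: has_spectral_measure_def spectral_measure_def slow_growing_def)
  finally show ?thesis
    using stationary_covariance_fourier_field[OF \<rho>(1) f h] by simp
qed

lemma spectral_covariance:
  fixes U :: "('a::euclidean_space, 'w) random_field"
  assumes U: "has_spectral_measure Q U \<mu>" and f: "f \<in> schwartz" and h: "h \<in> schwartz"
  shows "(LINT \<omega>|Q. U f \<omega> * cnj (U h \<omega>)) = spconst TYPE('a) * (LINT x|\<mu>. fourier_inv f x * cnj (fourier_inv h x))"
  using spectral_covariance_fourier_field[OF U fourier_inv_schwartz[OF f] fourier_inv_schwartz[OF h]]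
  by (simp add: fourier_field_def fourier_fourier_inv f h)

section \<open>Symbol operators applied to stationary fields\<close>

lemma symbol_operator_eq:
  "symbol_operator Q g U f = extend_field Q (fourier_field U) (\<lambda>x. g x * fourier_inv f x)"
  by (simp add: symbol_operator_def fourier_inv_field_def mult_field_def)

lemma symbol_function_E:
  assumes "symbol_function g"
  obtains C m where "continuous_on UNIV g" "C > 0" "\<And>x. cmod (g x) \<le> C * jap x ^ m"
proof -
  obtain C m where C: "continuous_on UNIV g" "\<And>x. cmod (g x) \<le> C * jap x ^ m"
    using assms unfolding symbol_function_def jap_def[symmetric] by blast
  have "cmod (g x) \<le> (\<bar>C\<bar> + 1) * jap x ^ m" for x
    using jap_pos[of x] by (intro order_trans[OF C(2)] mult_right_mono) auto
  then show ?thesis using that[of "\<bar>C\<bar> + 1" m] C(1) by auto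
qed

lemma symbol_mult_rapid:
  assumes "symbol_function g" "rapid f"
  shows "rapid (\<lambda>x. g x * f x)"
  by (rule symbol_function_E[OF assms(1)]) (rule rapid_mult[OF assms(2)])

lemma gerf_symbol_operator:
  fixes U :: "('a::euclidean_space, 'w) random_field"
  assumes "sup_continuous_field Q (fourier_field U) K N" and g: "symbol_function g"
  shows "gerf Q (symbol_operator Q g U)"
proof -
  interpret sup_continuous_field Q "fourier_field U" K N by fact
  have gr: "rapid (\<lambda>x. g x * fourier_inv f x)" if "f \<in> schwartz" for f
    by (intro symbol_mult_rapid g schwartz_rapid fourier_inv_schwartz that)
  obtain C m where C: "C > 0" "\<And>x. cmod (g x) \<le> C * jap x ^ m"
    by (rule symbol_function_E[OF g]) (rule that)
  \<comment> \<open>\<open>N\<close> is the weight in the supremum bound of the field and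
    \<open>m\<close> the growth of \<open>g\<close>; their sum is the decay required of the
    transformed test function.\<close>
  from fourier_gauge_bound[of 0 "N + m"]
  obtain n k D where D: "\<forall>f::'a \<Rightarrow> complex. f \<in> schwartz \<longrightarrow> gauge_norm 0 (N + m) (fourier f) \<le> D * gauge_norm n k f"
    by (elim exE)
  have sq: "square_integrable Q (symbol_operator Q g U f)" if "f \<in> schwartz" for f
    unfolding symbol_operator_eq by (intro extend_field_square_integrable gr that)
  have lin: "AE \<omega> in Q. symbol_operator Q g U (\<lambda>x. a * f x + b * h x) \<omega>
      = a * symbol_operator Q g U f \<omega> + b * symbol_operator Q g U h \<omega>"
    if "f \<in> schwartz" "h \<in> schwartz" for f h a b
  proof -
    have eq: "(\<lambda>x. g x * fourier_inv (\<lambda>x. a * f x + b * h x) x)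
        = (\<lambda>x. a * (g x * fourier_inv f x) + b * (g x * fourier_inv h x))"
      using that by (simp add: fourier_inv_eq schwartz_lincomb fourier_lincomb reflect_def fun_eq_iff algebra_simps)
    show ?thesis
      unfolding symbol_operator_eq eq
      by (intro extend_field_linear gr that) (use gr[OF schwartz_lincomb[OF that, of a b]] eq in simp)
  qed
  have bound: "l2_norm Q (symbol_operator Q g U f) \<le> (K * C * D) * gauge_norm n k f" if f: "f \<in> schwartz" for f
  proof -
    have "jap x ^ N * cmod (g x * fourier_inv f x) \<le> C * (D * gauge_norm n k f)" for x
    proof -
      have "jap x ^ N * cmod (g x * fourier_inv f x) = cmod (g x) * (jap x ^ N * cmod (fourier f (- x)))"
        by (simp add: norm_mult fourier_inv_eq[OF f] reflect_def)
      also have "\<dots> \<le> (C * jap x ^ m) * (jap x ^ N * cmod (fourier f (- x)))"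
        using jap_pos[of x] by (intro mult_right_mono C) auto
      also have "\<dots> = C * (jap (- x) ^ (N + m) * cmod (partial_derivs [] (fourier f) (- x)))"
        by (simp add: power_add jap_minus mult_ac)
      also have "\<dots> \<le> C * gauge_norm 0 (N + m) (fourier f)"
        using C(1) by (intro mult_left_mono order_trans[OF seminorm_upper seminorm_le_gauge_norm] fourier_schwartz f) auto
      also have "\<dots> \<le> C * (D * gauge_norm n k f)"
        using C(1) by (intro mult_left_mono D[rule_format] f) auto
      finally show ?thesis .
    qed
    from extend_field_bound[OF gr[OF f] this] show ?thesis
      by (simp add: symbol_operator_eq mult_ac)
  qed
  show ?thesis
    unfolding gerf_def
  proof (intro conjI ballI allI)
    show "prob_space Q" by unfold_locales
    show "continuous_map schwartz_topology (l2_topology Q) (symbol_operator Q g U)"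
      by (rule continuous_map_l2I[OF sq lin bound])
    show "(LINT \<omega>|Q. symbol_operator Q g U f \<omega>) = 0" if "f \<in> schwartz" for f
      unfolding symbol_operator_eq by (intro extend_field_mean gr that)
  qed (rule lin)
qed

section \<open>Construction of a field with given spectral measure\<close>

lemma slow_growing_integral_bound:
  assumes sg: "slow_growing \<mu>"
  shows "\<exists>N B. B > 0 \<and> (\<forall>\<phi> s. \<phi> \<in> borel_measurable borel \<longrightarrow> (\<forall>x. jap x ^ N * cmod (\<phi> x) \<le> s) \<longrightarrow>
    integrable \<mu> \<phi> \<and> cmod (LINT x|\<mu>. \<phi> x) \<le> B * s)"
proof -
  obtain N where N: "integrable \<mu> (\<lambda>x. 1 / jap x ^ N)" using slow_growing_E[OF sg] by blast
  define J where "J = (LINT x|\<mu>. 1 / jap x ^ N)"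
  have J: "J \<ge> 0" unfolding J_def by (intro Bochner_Integration.integral_nonneg) (simp add: jap_pos less_imp_le)
  have "integrable \<mu> \<phi> \<and> cmod (LINT x|\<mu>. \<phi> x) \<le> (J + 1) * s"
    if \<phi>: "\<phi> \<in> borel_measurable borel" and s: "\<forall>x. jap x ^ N * cmod (\<phi> x) \<le> s" for \<phi> :: "'a \<Rightarrow> complex" and s
  proof
    have s0: "s \<ge> 0" using s[rule_format, of 0] by (rule order_trans[rotated]) (simp add: jap_def)
    have le: "cmod (\<phi> x) \<le> s * (1 / jap x ^ N)" for x
      using s[rule_format, of x] jap_pos[of x] by (simp add: field_simps)
    show int: "integrable \<mu> \<phi>"
    proof (rule Bochner_Integration.integrable_bound[OF integrable_mult_right[OF N, of s]])
      show "\<phi> \<in> borel_measurable \<mu>" by (rule slow_growing_borel[OF sg \<phi>])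
      show "AE x in \<mu>. norm (\<phi> x) \<le> norm (s * (1 / jap x ^ N))"
        using le s0 by (intro AE_I2) (simp add: abs_mult jap_power_abs)
    qed
    have "cmod (LINT x|\<mu>. \<phi> x) \<le> (LINT x|\<mu>. cmod (\<phi> x))" by (rule integral_norm_bound)
    also have "\<dots> \<le> (LINT x|\<mu>. s * (1 / jap x ^ N))"
      using le by (intro Bochner_Integration.integral_mono integrable_norm int integrable_mult_right N) auto
    also have "\<dots> = s * J" unfolding J_def by (rule integral_mult_right_zero)
    also have "\<dots> \<le> (J + 1) * s" using s0 by (simp add: algebra_simps)
    finally show "cmod (LINT x|\<mu>. \<phi> x) \<le> (J + 1) * s" .
  qed
  moreover have "J + 1 > 0" using J by simp
  ultimately show ?thesis by (intro exI[of _ N] exI[of _ "J + 1"]) blast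
qed

lemma fourier_pointwise_bound:
  fixes f :: "'a::euclidean_space \<Rightarrow> complex"
  assumes "f \<in> schwartz"
  shows "jap x ^ N * cmod (fourier f x) \<le> gauge_norm 0 N (fourier f)"
  using order_trans[OF seminorm_upper[OF fourier_schwartz[OF assms], of "[]" x N]
      seminorm_le_gauge_norm[OF fourier_schwartz[OF assms], of "[]" 0 N]] by simp

text \<open>The map \<open>\<iota>\<close> serves two purposes: the identity gives the stationary
  covariance \<open>\<rho>\<close>, and x \<mapsto> (x, -x) gives the covariance distribution on the
  product space, whose spectrum lies on the antidiagonal.\<close>

lemma fourier_measure_bound:
  fixes \<iota> :: "'b::euclidean_space \<Rightarrow> 'a::euclidean_space"
  assumes sg: "slow_growing \<mu>" and \<iota>: "continuous_on UNIV \<iota>" "\<And>x. jap x \<le> jap (\<iota> x)"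
  shows "\<exists>n k D. \<forall>f. f \<in> schwartz \<longrightarrow> integrable \<mu> (\<lambda>x. fourier f (\<iota> x)) \<and>
    cmod (LINT x|\<mu>. fourier f (\<iota> x)) \<le> D * gauge_norm n k f"
proof -
  from slow_growing_integral_bound[OF sg] obtain N B where B: "B > 0"
    and B': "\<forall>\<phi> s. \<phi> \<in> borel_measurable borel \<longrightarrow> (\<forall>x. jap x ^ N * cmod (\<phi> x) \<le> s) \<longrightarrow>
      integrable \<mu> \<phi> \<and> cmod (LINT x|\<mu>. \<phi> x) \<le> B * s"
    by (elim exE conjE)
  from fourier_gauge_bound[of 0 N]
  obtain n k D where D: "\<forall>f::'a \<Rightarrow> complex. f \<in> schwartz \<longrightarrow> gauge_norm 0 N (fourier f) \<le> D * gauge_norm n k f"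
    by (elim exE)
  have "integrable \<mu> (\<lambda>x. fourier f (\<iota> x)) \<and> cmod (LINT x|\<mu>. fourier f (\<iota> x)) \<le> (B * D) * gauge_norm n k f"
    if f: "f \<in> schwartz" for f
  proof -
    have meas: "(\<lambda>x. fourier f (\<iota> x)) \<in> borel_measurable borel"
      by (rule borel_measurable_continuous_onI, rule continuous_on_compose2[OF schwartz_continuous[OF fourier_schwartz[OF f], of UNIV] \<iota>(1)]) simp
    have bd: "\<forall>x. jap x ^ N * cmod (fourier f (\<iota> x)) \<le> gauge_norm 0 N (fourier f)"
    proof
      fix x
      have "jap x ^ N * cmod (fourier f (\<iota> x)) \<le> jap (\<iota> x) ^ N * cmod (fourier f (\<iota> x))"
        using \<iota>(2)[of x] jap_pos[of x] by (intro mult_right_mono power_mono) auto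
      also have "\<dots> \<le> gauge_norm 0 N (fourier f)" by (rule fourier_pointwise_bound[OF f])
      finally show "jap x ^ N * cmod (fourier f (\<iota> x)) \<le> gauge_norm 0 N (fourier f)" .
    qed
    note * = B'[rule_format, OF meas bd[rule_format]]
    have "B * gauge_norm 0 N (fourier f) \<le> B * (D * gauge_norm n k f)"
      using B D f by (intro mult_left_mono) auto
    then show ?thesis
      unfolding mult.assoc using * by linarith
  qed
  note key = this
  show ?thesis
    by (rule exI[of _ n], rule exI[of _ k], rule exI[of _ "B * D"], intro allI impI, rule key)
qed

text \<open>A covariance distribution has to be exhibited on the product space. It is
  \<open>spconst\<close> times the transform of the image of \<open>\<mu>\<close> on the
  antidiagonal, because the transform of f \<otimes> conj h at (x, -x) is \<open>fourier f x\<close>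
  times the conjugate of \<open>fourier h x\<close>.\<close>

lemma real_stationary_gerf_of_covariance:
  fixes U :: "('a::euclidean_space, 'w) random_field"
  assumes sp: "spectral_measure \<mu>" and prob: "prob_space Q"
    and lin: "\<And>f h a b \<omega>. f \<in> schwartz \<Longrightarrow> h \<in> schwartz \<Longrightarrow> U (\<lambda>x. a * f x + b * h x) \<omega> = a * U f \<omega> + b * U h \<omega>"
    and sq: "\<And>f. f \<in> schwartz \<Longrightarrow> square_integrable Q (U f)"
    and mean: "\<And>f. f \<in> schwartz \<Longrightarrow> (LINT \<omega>|Q. U f \<omega>) = 0"
    and real: "\<And>f \<omega>. f \<in> schwartz \<Longrightarrow> (\<And>x. f x \<in> \<real>) \<Longrightarrow> U f \<omega> \<in> \<real>"
    and cov: "\<And>f h. f \<in> schwartz \<Longrightarrow> h \<in> schwartz \<Longrightarrow> (LINT \<omega>|Q. U f \<omega> * cnj (U h \<omega>))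
      = spconst TYPE('a) * (LINT x|\<mu>. fourier f x * cnj (fourier h x))"
  shows "real_stationary_gerf Q U" "has_spectral_measure Q U \<mu>"
proof -
  let ?c = "(2 * pi) powr (real DIM('a) / 2)"
  have sg: "slow_growing \<mu>" and ev: "even_measure \<mu>" and sets: "sets \<mu> = sets borel"
    using sp by (auto simp: spectral_measure_def slow_growing_def)
  have even_int: "(LINT x|\<mu>. f (- x)) = (LINT x|\<mu>. f x)" if "f \<in> schwartz" for f
    by (rule even_measure_integral[OF ev sets schwartz_borel[OF that]])
  have gerf: "gerf Q U"
    unfolding gerf_def
  proof (intro conjI ballI allI prob mean)
    from rapid_l2_bound[OF sg] obtain N B where B: "B > 0"
      and B': "\<forall>f s. rapid f \<longrightarrow> square_integrable \<mu> f \<and>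
        ((\<forall>x. jap x ^ N * cmod (f x) \<le> s) \<longrightarrow> l2_norm \<mu> f \<le> B * s)"
      by (elim exE conjE)
    from fourier_gauge_bound[of 0 N]
    obtain n k D where D: "\<forall>f::'a \<Rightarrow> complex. f \<in> schwartz \<longrightarrow> gauge_norm 0 N (fourier f) \<le> D * gauge_norm n k f"
      by (elim exE)
    have bound: "l2_norm Q (U f) \<le> (sqrt ?c * B * D) * gauge_norm n k f" if f: "f \<in> schwartz" for f
    proof -
      have "complex_of_real ((l2_norm Q (U f))\<^sup>2) = spconst TYPE('a) * complex_of_real ((l2_norm \<mu> (fourier f))\<^sup>2)"
        using cov[OF f f] by (simp only: integral_mult_cnj_self)
      then have "(l2_norm Q (U f))\<^sup>2 = ?c * (l2_norm \<mu> (fourier f))\<^sup>2"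
        by (simp only: of_real_mult[symmetric] of_real_eq_iff)
      then have "l2_norm Q (U f) = sqrt ?c * l2_norm \<mu> (fourier f)"
        by (metis l2_norm_nonneg real_sqrt_abs abs_of_nonneg real_sqrt_mult)
      also have "\<dots> \<le> sqrt ?c * (B * gauge_norm 0 N (fourier f))"
        using B'[rule_format, OF schwartz_rapid[OF fourier_schwartz[OF f]], THEN conjunct2, rule_format, OF fourier_pointwise_bound[OF f]]
        by (intro mult_left_mono) auto
      also have "\<dots> \<le> sqrt ?c * (B * (D * gauge_norm n k f))"
        using B D f by (intro mult_left_mono) auto
      finally show ?thesis by (simp add: mult_ac)
    qed
    show "continuous_map schwartz_topology (l2_topology Q) U"
      by (rule continuous_map_l2I[OF sq _ bound]) (use lin in auto)
  qed (use lin in auto)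
  then have rgerf: "real_gerf Q U" using real by (auto simp: real_gerf_def)
  define \<rho> where "\<rho> f = (LINT x|\<mu>. fourier f x)" for f :: "'a \<Rightarrow> complex"
  define C where "C \<Phi> = spconst TYPE('a) * (LINT x|\<mu>. fourier \<Phi> (x, - x))" for \<Phi> :: "'a \<times> 'a \<Rightarrow> complex"
  from fourier_measure_bound[OF sg, of "\<lambda>x::'a. x"]
  obtain n k D where \<rho>_bd: "\<forall>f::'a \<Rightarrow> complex. f \<in> schwartz \<longrightarrow> integrable \<mu> (fourier f) \<and>
      cmod (LINT x|\<mu>. fourier f x) \<le> D * gauge_norm n k f"
    by (auto simp: continuous_on_id)
  have \<rho>_temp: "tempered \<rho>"
  proof (rule temperedI)
    show "schwartz_linear \<rho>"
      unfolding schwartz_linear_def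
    proof (intro ballI allI)
      fix f h :: "'a \<Rightarrow> complex" and a b assume fh: "f \<in> schwartz" "h \<in> schwartz"
      then show "\<rho> (\<lambda>x. a * f x + b * h x) = a * \<rho> f + b * \<rho> h"
        using \<rho>_bd by (simp add: \<rho>_def fourier_lincomb)
    qed
    show "cmod (\<rho> f) \<le> D * gauge_norm n k f" if "f \<in> schwartz" for f
      using \<rho>_bd that by (simp add: \<rho>_def)
  qed
  have japP: "jap (x::'a) \<le> jap (x, - x)" for x
    by (simp add: jap_def norm_Pair)
  have contP: "continuous_on UNIV (\<lambda>x::'a. (x, - x))"
    by (intro continuous_intros)
  from fourier_measure_bound[OF sg contP japP]
  obtain n' k' D' where C_bd: "\<forall>f::'a \<times> 'a \<Rightarrow> complex. f \<in> schwartz \<longrightarrow> integrable \<mu> (\<lambda>x. fourier f (x, - x)) \<and>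
      cmod (LINT x|\<mu>. fourier f (x, - x)) \<le> D' * gauge_norm n' k' f"
    by (elim exE)
  have C_temp: "tempered C"
  proof (rule temperedI)
    show "schwartz_linear C"
      unfolding schwartz_linear_def
    proof (intro ballI allI)
      fix f h :: "'a \<times> 'a \<Rightarrow> complex" and a b assume fh: "f \<in> schwartz" "h \<in> schwartz"
      then show "C (\<lambda>x. a * f x + b * h x) = a * C f + b * C h"
        using C_bd by (simp add: C_def fourier_lincomb algebra_simps)
    qed
    show "cmod (C f) \<le> (?c * D') * gauge_norm n' k' f" if "f \<in> schwartz" for f
      using C_bd that by (simp add: C_def norm_mult mult.assoc mult_left_mono)
  qed
  have C_tensor: "C (tensor f (\<lambda>x. cnj (h x))) = spconst TYPE('a) * (LINT x|\<mu>. fourier f x * cnj (fourier h x))"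
    if "f \<in> schwartz" "h \<in> schwartz" for f h
    by (simp add: C_def fourier_tensor[OF that(1) schwartz_cnj[OF that(2)]] cnj_fourier)
  have hasC: "has_covariance_distribution Q U C"
    unfolding has_covariance_distribution_def using gerf C_temp by (auto simp: C_tensor cov)
  have conv: "C (tensor f (\<lambda>x. cnj (h x))) = \<rho> (convolve f (reflect (\<lambda>x. cnj (h x))))"
    if f: "f \<in> schwartz" and h: "h \<in> schwartz" for f h
  proof -
    \<comment> \<open>Writing both functions as transforms brings their convolution under
      \<open>convolve_fourier\<close>; the two reflections that appear on either side then
      match.\<close>
    define a b where "a = fourier_inv f" and "b = fourier_inv h"
    have ab: "a \<in> schwartz" "b \<in> schwartz" "f = fourier a" "h = fourier b"
      using f h by (simp_all add: a_def b_def fourier_inv_schwartz fourier_fourier_inv)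
    have S: "(\<lambda>x. a x * cnj (b x)) \<in> schwartz"
      by (intro schwartz_mult_schwartz schwartz_cnj ab)
    have "convolve f (reflect (\<lambda>x. cnj (h x))) = (\<lambda>x. spconst TYPE('a) * fourier (\<lambda>y. a y * cnj (b y)) x)"
      unfolding ab(3,4) reflect_cnj_fourier by (rule convolve_fourier[OF ab(1) schwartz_cnj[OF ab(2)]])
    then have "\<rho> (convolve f (reflect (\<lambda>x. cnj (h x)))) = spconst TYPE('a) * (LINT x|\<mu>. fourier (fourier (\<lambda>y. a y * cnj (b y))) x)"
      by (simp add: \<rho>_def fourier_cmult)
    also have "\<dots> = spconst TYPE('a) * (LINT x|\<mu>. a (- x) * cnj (b (- x)))"
      by (simp add: fourier_fourier[OF S] reflect_def)
    also have "\<dots> = C (tensor f (\<lambda>x. cnj (h x)))"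
      unfolding C_tensor[OF f h] unfolding ab(3,4) by (simp add: fourier_fourier ab(1,2) reflect_def)
    finally show ?thesis ..
  qed
  have real\<rho>: "real_valued_distribution \<rho>"
    unfolding real_valued_distribution_def
  proof (intro ballI impI)
    fix f :: "'a \<Rightarrow> complex" assume f: "f \<in> schwartz" and r: "\<forall>x. f x \<in> \<real>"
    then have "(\<lambda>x. cnj (f x)) = f" by (auto simp: Reals_cnj_iff)
    then have "cnj (fourier f x) = fourier f (- x)" for x by (simp add: cnj_fourier)
    then have "cnj (\<rho> f) = \<rho> f"
      using even_int[OF fourier_schwartz[OF f]]
      by (simp add: \<rho>_def Bochner_Integration.integral_cnj[symmetric] del: Bochner_Integration.integral_cnj)
    then show "\<rho> f \<in> \<real>" by (simp add: Reals_cnj_iff)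
  qed
  have even\<rho>: "even_distribution \<rho>"
    unfolding even_distribution_def \<rho>_def
  proof
    fix f :: "'a \<Rightarrow> complex" assume f: "f \<in> schwartz"
    show "(LINT x|\<mu>. fourier (reflect f) x) = (LINT x|\<mu>. fourier f x)"
      using even_int[OF fourier_schwartz[OF f]] by (simp add: fourier_reflect[OF f]) (simp add: reflect_def)
  qed
  have "has_stationary_covariance Q U \<rho>"
    unfolding has_stationary_covariance_def using \<rho>_temp real\<rho> even\<rho> hasC conv by blast
  then show "real_stationary_gerf Q U" "has_spectral_measure Q U \<mu>"
    using rgerf sp
    by (auto simp: real_stationary_gerf_def has_spectral_measure_def fourier_distribution_def measure_distribution_def \<rho>_def)
qed

text \<open>A slow-growing measure may be infinite. Dividing by Z \<open>jap\<close>^N makes it a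
  probability, and the same factor reappears in the integrand as compensation.\<close>

lemma slow_growing_normalize:
  fixes \<mu> :: "'a::euclidean_space measure"
  assumes sg: "slow_growing \<mu>"
  obtains \<nu> Z N where "prob_space \<nu>" "sets \<nu> = sets borel" "Z \<ge> 0"
    "\<And>h :: 'a \<Rightarrow> complex. h \<in> borel_measurable borel \<Longrightarrow> integrable \<mu> h \<Longrightarrow>
      integrable \<nu> (\<lambda>x. complex_of_real (Z * jap x ^ N) * h x) \<and>
      (LINT x|\<nu>. complex_of_real (Z * jap x ^ N) * h x) = (LINT x|\<mu>. h x)"
proof -
  have sets: "sets \<mu> = sets borel" using sg by (simp add: slow_growing_def)
  note [measurable_cong] = sets
  have space: "space \<mu> = UNIV" using sets_eq_imp_space_eq[OF sets] by simp
  obtain N where N: "integrable \<mu> (\<lambda>x. 1 / jap x ^ N)" using slow_growing_E[OF sg] by blast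
  define Z where "Z = (LINT x|\<mu>. 1 / jap x ^ N)"
  have Z: "Z \<ge> 0" unfolding Z_def by (intro Bochner_Integration.integral_nonneg) (simp add: jap_pos less_imp_le)
  show ?thesis
  proof (cases "Z = 0")
    case True
    have "AE x in \<mu>. 1 / jap x ^ N = 0"
      using True N by (subst integral_nonneg_eq_0_iff_AE[symmetric]) (auto simp: Z_def jap_pos less_imp_le)
    then have null: "AE x in \<mu>. False"
      by eventually_elim (metis divide_eq_0_iff jap_pos less_irrefl power_eq_0_iff zero_neq_one)
    have "(LINT x|\<mu>. h x) = 0" for h :: "'a \<Rightarrow> complex"
    proof (rule integral_eq_zero_AE)
      show "AE x in \<mu>. h x = 0" using null by eventually_elim simp
    qed
    \<comment> \<open>Here \<open>\<mu>\<close> is the zero measure. Any probability will do, since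
      the compensating factor 0 annihilates the integrand.\<close>
    then show ?thesis
      by (intro that[of "return borel 0" 0 N]) (auto simp: prob_space_return)
  next
    case False
    then have Z0: "Z > 0" using Z by simp
    define \<nu> where "\<nu> = density \<mu> (\<lambda>x. ennreal (1 / (Z * jap x ^ N)))"
    have nn: "0 \<le> 1 / (Z * jap x ^ N)" for x :: 'a using Z0 jap_pos[of x] by simp
    have eq: "(\<lambda>x. 1 / (Z * jap x ^ N)) = (\<lambda>x::'a. 1 / Z * (1 / jap x ^ N))" by simp
    have "(\<integral>\<^sup>+ x. ennreal (1 / (Z * jap x ^ N)) \<partial>\<mu>) = ennreal (LINT x|\<mu>. 1 / (Z * jap x ^ N))"
      by (rule nn_integral_eq_integral) (use nn in \<open>simp_all only: eq integrable_mult_right[OF N] AE_I2\<close>)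
    also have "(LINT x|\<mu>. 1 / (Z * jap x ^ N)) = 1"
      unfolding eq integral_mult_right_zero Z_def[symmetric] using Z0 by simp
    finally have "emeasure \<nu> (space \<nu>) = 1"
      by (simp add: \<nu>_def emeasure_density space cong: nn_integral_cong)
    then have prob: "prob_space \<nu>" by (rule prob_spaceI)
    have *: "(1 / (Z * jap x ^ N)) *\<^sub>R (complex_of_real (Z * jap x ^ N) * h x) = h x" for h and x :: 'a
      using Z0 jap_pos[of x] by (simp add: scaleR_conv_of_real)
    show ?thesis
    proof (rule that[OF prob _ Z])
      show "sets \<nu> = sets borel" by (simp add: \<nu>_def sets)
      fix h :: "'a \<Rightarrow> complex" assume [measurable]: "h \<in> borel_measurable borel" and int: "integrable \<mu> h"
      have m: "(\<lambda>x. complex_of_real (Z * jap x ^ N) * h x) \<in> borel_measurable \<mu>" by measurable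
      have mw: "(\<lambda>x. 1 / (Z * jap x ^ N)) \<in> borel_measurable \<mu>" by measurable
      have AE: "AE x in \<mu>. 0 \<le> 1 / (Z * jap x ^ N)" using nn by simp
      show "integrable \<nu> (\<lambda>x. complex_of_real (Z * jap x ^ N) * h x) \<and>
        (LINT x|\<nu>. complex_of_real (Z * jap x ^ N) * h x) = (LINT x|\<mu>. h x)"
        unfolding \<nu>_def integrable_density[OF m mw AE] integral_density[OF m mw AE]
        using int by (simp only: *)
    qed
  qed
qed

section \<open>Random phases and the sample space\<close>

definition phases :: "nat pmf" where
  "phases = pmf_of_set {..<4}"

lemma integral_phases: "(LINT k|measure_pmf phases. h k) = (h 0 + h 1 + h 2 + h 3) / 4"
  for h :: "nat \<Rightarrow> complex"
proof -
  have "{..<4::nat} \<noteq> {}" by (simp add: lessThan_empty_iff)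
  then have pmf: "pmf phases k = 1 / 4" if "k < 4" for k
    using that by (simp add: phases_def)
  have "(LINT k|measure_pmf phases. h k) = (\<Sum>k<4. pmf phases k *\<^sub>R h k)"
    by (rule integral_measure_pmf) (auto simp: phases_def lessThan_empty_iff)
  also have "\<dots> = (\<Sum>k<4. (1 / 4) *\<^sub>R h k)"
    by (intro sum.cong refl) (simp add: pmf)
  also have "\<dots> = (h 0 + h 1 + h 2 + h 3) / 4"
    by (simp add: eval_nat_numeral scaleR_conv_of_real add_divide_distrib)
  finally show ?thesis .
qed

text \<open>The sigma-algebra on the target is pulled back along the decoder \<open>D\<close>.
  Decoding and encoding are then measurable whatever structure the target type has, and
  \<open>D\<close> undoes \<open>J\<close>, so integrals do not change.\<close>

lemma transport_measure:
  fixes R :: "'r measure" and J :: "'r \<Rightarrow> 'p"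
  assumes R: "prob_space R" and DJ: "\<And>r. D (J r) = r" and space: "space R = UNIV"
  defines "Q \<equiv> distr R (vimage_algebra UNIV D R) J"
  shows "prob_space Q"
    and "\<And>Y :: 'r \<Rightarrow> complex. Y \<in> borel_measurable R \<Longrightarrow> (LINT q|Q. Y (D q)) = (LINT r|R. Y r)"
    and "\<And>Y :: 'r \<Rightarrow> complex. square_integrable R Y \<Longrightarrow> square_integrable Q (\<lambda>q. Y (D q))"
proof -
  have J[measurable]: "J \<in> measurable R (vimage_algebra UNIV D R)"
    by (rule measurable_vimage_algebra2) (simp_all add: DJ)
  have D[measurable]: "D \<in> measurable (vimage_algebra UNIV D R) R"
    by (rule measurable_vimage_algebra1) (simp add: space)
  show "prob_space Q"
    unfolding Q_def by (rule prob_space.prob_space_distr[OF R J])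
  show "(LINT q|Q. Y (D q)) = (LINT r|R. Y r)" if [measurable]: "Y \<in> borel_measurable R" for Y :: "'r \<Rightarrow> complex"
    unfolding Q_def by (subst integral_distr[OF J]) (simp_all add: DJ)
  show "square_integrable Q (\<lambda>q. Y (D q))" if Y: "square_integrable R Y" for Y :: "'r \<Rightarrow> complex"
  proof -
    have [measurable]: "Y \<in> borel_measurable R" using Y by (simp add: square_integrable_def)
    have "integrable Q (\<lambda>q. (cmod (Y (D q)))\<^sup>2)"
      unfolding Q_def by (subst integrable_distr_eq[OF J]) (use Y in \<open>simp_all add: DJ square_integrable_def\<close>)
    then show ?thesis by (simp add: square_integrable_def Q_def)
  qed
qed

text \<open>Sample points \<open>(\<xi>, k)\<close> are stored as evaluation at \<open>\<xi>\<close>, modified at the constant function \<open>1\<close>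
  to remember \<open>k\<close>.\<close>

definition encode_path :: "'a::euclidean_space \<times> nat \<Rightarrow> 'a path" where
  "encode_path r = (\<lambda>f. if f = (\<lambda>_. 1) then of_nat (snd r) else f (fst r))"

lemma inj_encode_path: "inj encode_path"
proof (rule injI)
  fix r s :: "'a \<times> nat"
  assume eq: "encode_path r = encode_path s"
  have "snd r = snd s"
    using fun_cong[OF eq, of "\<lambda>_. 1"] by (simp add: encode_path_def)
  moreover have "fst r = fst s"
  proof (rule euclidean_eqI)
    fix b :: 'a
    have "(\<lambda>x. complex_of_real (x \<bullet> b)) \<noteq> (\<lambda>_. 1)"
      by (rule notI, drule fun_cong[of _ _ 0]) simp
    then show "fst r \<bullet> b = fst s \<bullet> b"
      using fun_cong[OF eq, of "\<lambda>x. complex_of_real (x \<bullet> b)"] by (simp add: encode_path_def)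
  qed
  ultimately show "r = s" by (simp add: prod_eq_iff)
qed

text \<open>A random plane wave: the frequency \<open>\<xi>\<close> is drawn from the normalized spectral measure and the phase
  \<open>\<i>\<^sup>k\<close> is uniform on the fourth roots of unity, which have vanishing first and second moments.\<close>

definition plane_wave ::
  "('a::euclidean_space \<Rightarrow> real) \<Rightarrow> ('a, 'a \<times> nat) random_field" where
  "plane_wave w f = (\<lambda>(x, k). complex_of_real (w x) * (\<i> ^ k * fourier f x + cnj (\<i> ^ k) * fourier f (- x)))"

lemma i_powers: "\<i> ^ 0 = 1" "\<i> ^ 1 = \<i>" "\<i> ^ 2 = -1" "\<i> ^ 3 = -\<i>"
  by (simp_all add: power3_eq_cube)

text \<open>The cross terms carry i^(2k) or its inverse, whose average over four phases is 0; the
  diagonal terms carry no phase. Two phases, +1 and -1, would leave the cross terms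
  standing.\<close>

lemma phase_average:
  "(LINT k|measure_pmf phases. w * (\<i> ^ k * a + cnj (\<i> ^ k) * b)) = 0"
  "(LINT k|measure_pmf phases. (w * (\<i> ^ k * a + cnj (\<i> ^ k) * b)) * cnj (v * (\<i> ^ k * c + cnj (\<i> ^ k) * d)))
     = w * cnj v * (a * cnj c + b * cnj d)"
  unfolding integral_phases i_powers by (simp_all add: algebra_simps)

theorem exists_field_with_spectral_measure:
  fixes \<mu> :: "'a::euclidean_space measure"
  assumes sp: "spectral_measure \<mu>"
  obtains Q :: "'a path measure" and U where "real_stationary_gerf Q U" "has_spectral_measure Q U \<mu>"
proof -
  let ?c = "(2 * pi) powr (real DIM('a) / 2)"
  have sg: "slow_growing \<mu>" and ev: "even_measure \<mu>" and sets: "sets \<mu> = sets borel"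
    using sp by (auto simp: spectral_measure_def slow_growing_def)
  obtain \<nu> Z N where prob: "prob_space \<nu>" and sets\<nu>: "sets \<nu> = sets borel" and Z: "Z \<ge> 0"
    and norm: "\<And>h :: 'a \<Rightarrow> complex. h \<in> borel_measurable borel \<Longrightarrow> integrable \<mu> h \<Longrightarrow>
      integrable \<nu> (\<lambda>x. complex_of_real (Z * jap x ^ N) * h x) \<and>
      (LINT x|\<nu>. complex_of_real (Z * jap x ^ N) * h x) = (LINT x|\<mu>. h x)"
    by (rule slow_growing_normalize[OF sg]) (rule that)
  note [measurable_cong] = sets\<nu>
  have space\<nu>: "space \<nu> = UNIV" using sets_eq_imp_space_eq[OF sets\<nu>] by simp
  interpret \<nu>: prob_space \<nu> by (rule prob)
  interpret pair_prob_space \<nu> "measure_pmf phases" ..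
  define R where "R = \<nu> \<Otimes>\<^sub>M measure_pmf phases"
  \<comment> \<open>The factor Z \<open>jap\<close>^N undoes the normalization, and (2 pi)^(d/2) is
    the covariance constant. The 1/2 compensates the two diagonal terms, at x and -x, whose
    integrals against the even measure agree.\<close>
  define w where "w x = sqrt (?c * (Z * jap x ^ N) / 2)" for x :: 'a
  have w2: "complex_of_real (w x) * complex_of_real (w x) = spconst TYPE('a) / 2 * complex_of_real (Z * jap x ^ N)" for x
  proof -
    have "w x * w x = ?c / 2 * (Z * jap x ^ N)"
      using Z jap_pos[of x] by (simp add: w_def)
    then show ?thesis by (simp only: of_real_mult[symmetric]) simp
  qed
  have [measurable]: "w \<in> borel_measurable borel" unfolding w_def[abs_def] by measurable
  let ?V = "plane_wave w"
  have snd_meas: "(\<lambda>r. h (snd r)) \<in> borel_measurable R" for h :: "nat \<Rightarrow> complex"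
    unfolding R_def by (rule measurable_compose[OF measurable_snd]) simp
  have fst_meas: "(\<lambda>r. h (fst r)) \<in> borel_measurable R" if "h \<in> borel_measurable borel" for h :: "'a \<Rightarrow> complex"
    unfolding R_def by (rule measurable_compose[OF measurable_fst]) (use that in measurable)
  have V_meas: "?V f \<in> borel_measurable R" if f: "f \<in> schwartz" for f
  proof -
    note [measurable] = schwartz_borel[OF fourier_schwartz[OF f]]
    have "(\<lambda>r. complex_of_real (w (fst r)) * (\<i> ^ snd r * fourier f (fst r) + cnj (\<i> ^ snd r) * fourier f (- fst r))) \<in> borel_measurable R"
      by (intro borel_measurable_times borel_measurable_add snd_meas fst_meas[of "\<lambda>x. complex_of_real (w x)"]
          fst_meas[of "fourier f"] fst_meas[of "\<lambda>x. fourier f (- x)"]) measurable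
    then show ?thesis by (simp add: plane_wave_def case_prod_beta)
  qed
  have integrable_fst': "integrable R (\<lambda>r. h (fst r))" if "integrable \<nu> h" for h :: "'a \<Rightarrow> complex"
  proof -
    have "integrable (distr R \<nu> fst) h"
      unfolding R_def using that by (simp add: prob_space.distr_pair_fst[OF measure_pmf.prob_space_axioms])
    then show ?thesis
      by (subst (asm) integrable_distr_eq) (use that in \<open>auto simp: R_def\<close>)
  qed
  define S where "S f h x = fourier f x * cnj (fourier h x) + fourier f (- x) * cnj (fourier h (- x))" for f h and x :: 'a
  have S: "integrable \<nu> (\<lambda>x. complex_of_real (w x) * complex_of_real (w x) * S f h x)"
      "(LINT x|\<nu>. complex_of_real (w x) * complex_of_real (w x) * S f h x) = spconst TYPE('a) * (LINT x|\<mu>. fourier f x * cnj (fourier h x))"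
    if f: "f \<in> schwartz" and h: "h \<in> schwartz" for f h
  proof -
    have p: "(\<lambda>x. fourier f x * cnj (fourier h x)) \<in> schwartz"
      by (intro schwartz_mult_schwartz schwartz_cnj fourier_schwartz f h)
    from reflect_schwartz[OF p] have q: "(\<lambda>x. fourier f (- x) * cnj (fourier h (- x))) \<in> schwartz"
      by (simp add: reflect_def)
    have Sfh: "S f h \<in> schwartz"
      unfolding S_def by (intro schwartz_add p q)
    have "(LINT x|\<mu>. S f h x) = (LINT x|\<mu>. fourier f x * cnj (fourier h x)) + (LINT x|\<mu>. fourier f (- x) * cnj (fourier h (- x)))"
      unfolding S_def by (intro Bochner_Integration.integral_add slow_growing_integrable[OF sg] p q)
    also have "(LINT x|\<mu>. fourier f (- x) * cnj (fourier h (- x))) = (LINT x|\<mu>. fourier f x * cnj (fourier h x))"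
      by (rule even_measure_integral[OF ev sets schwartz_borel[OF p]])
    finally have S2: "(LINT x|\<mu>. S f h x) = 2 * (LINT x|\<mu>. fourier f x * cnj (fourier h x))" by simp
    note nS = norm[OF schwartz_borel[OF Sfh] slow_growing_integrable[OF sg Sfh]]
    have eq: "(\<lambda>x. complex_of_real (w x) * complex_of_real (w x) * S f h x)
      = (\<lambda>x. spconst TYPE('a) / 2 * (complex_of_real (Z * jap x ^ N) * S f h x))"
      by (simp only: w2 mult.assoc)
    show "integrable \<nu> (\<lambda>x. complex_of_real (w x) * complex_of_real (w x) * S f h x)"
      unfolding eq using nS by (intro integrable_mult_right) simp
    show "(LINT x|\<nu>. complex_of_real (w x) * complex_of_real (w x) * S f h x) = spconst TYPE('a) * (LINT x|\<mu>. fourier f x * cnj (fourier h x))"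
      unfolding eq integral_mult_right_zero conjunct2[OF nS] S2 by simp
  qed
  have V_sq: "square_integrable R (?V f)" if f: "f \<in> schwartz" for f
  proof -
    note [measurable] = V_meas[OF f]
    have "integrable R (\<lambda>r. (cmod (?V f r))\<^sup>2)"
    proof (rule Bochner_Integration.integrable_bound)
      show "integrable R (\<lambda>r. 2 * (complex_of_real (w (fst r)) * complex_of_real (w (fst r)) * S f f (fst r)))"
        by (intro integrable_mult_right integrable_fst'[OF S(1)[OF f f]])
      show "AE r in R. norm ((cmod (?V f r))\<^sup>2) \<le> norm (2 * (complex_of_real (w (fst r)) * complex_of_real (w (fst r)) * S f f (fst r)))"
      proof (rule AE_I2)
        fix r :: "'a \<times> nat"
        obtain x k where r: "r = (x, k)" by (cases r)
        let ?a = "cmod (fourier f x)" and ?b = "cmod (fourier f (- x))"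
        have "cmod (?V f r) \<le> \<bar>w x\<bar> * (?a + ?b)"
          unfolding r plane_wave_def
          by (auto simp: norm_mult norm_power intro!: mult_left_mono norm_triangle_le)
        then have "(cmod (?V f r))\<^sup>2 \<le> (\<bar>w x\<bar> * (?a + ?b))\<^sup>2"
          by (intro power_mono) auto
        also have "\<dots> = (w x * w x) * (?a + ?b)\<^sup>2"
          by (simp add: power_mult_distrib power2_eq_square)
        also have "\<dots> \<le> (w x * w x) * (2 * (?a\<^sup>2 + ?b\<^sup>2))"
          using sum_squares_bound[of ?a ?b] by (intro mult_left_mono) (auto simp: power2_sum)
        also have "\<dots> = norm (2 * (complex_of_real (w x) * complex_of_real (w x) * S f f x))"
        proof -
          have "S f f x = complex_of_real (?a\<^sup>2 + ?b\<^sup>2)"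
            by (simp only: S_def of_real_add complex_norm_square)
          then have "2 * (complex_of_real (w x) * complex_of_real (w x) * S f f x) = complex_of_real (2 * (w x * w x * (?a\<^sup>2 + ?b\<^sup>2)))"
            by simp
          then show ?thesis
            by (simp only: norm_of_real) (simp add: abs_mult)
        qed
        finally show "norm ((cmod (?V f r))\<^sup>2) \<le> norm (2 * (complex_of_real (w (fst r)) * complex_of_real (w (fst r)) * S f f (fst r)))"
          by (simp add: r)
      qed
    qed measurable
    then show ?thesis using V_meas[OF f] by (simp add: square_integrable_def)
  qed
  have prob_R: "prob_space R" unfolding R_def by unfold_locales
  have Fubini: "(LINT r|R. H r) = (LINT x|\<nu>. LINT k|measure_pmf phases. H (x, k))" if "integrable R H" for H :: "'a \<times> nat \<Rightarrow> complex"
    using integral_fst'[of H] that by (simp add: R_def)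
  have V_mean: "(LINT r|R. ?V f r) = 0" if f: "f \<in> schwartz" for f
    by (subst Fubini[OF prob_space.square_integrable_integrable(1)[OF prob_R V_sq[OF f]]])
       (simp only: plane_wave_def prod.case phase_average(1) Bochner_Integration.integral_zero)
  have V_cov: "(LINT r|R. ?V f r * cnj (?V h r)) = spconst TYPE('a) * (LINT x|\<mu>. fourier f x * cnj (fourier h x))"
    if f: "f \<in> schwartz" and h: "h \<in> schwartz" for f h
  proof -
    have "(LINT r|R. ?V f r * cnj (?V h r)) = (LINT x|\<nu>. LINT k|measure_pmf phases. ?V f (x, k) * cnj (?V h (x, k)))"
      by (rule Fubini[OF integrable_mult_cnj(1)[OF V_sq[OF f] V_sq[OF h]]])
    also have "\<dots> = (LINT x|\<nu>. complex_of_real (w x) * complex_of_real (w x) * S f h x)"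
      unfolding plane_wave_def prod.case phase_average(2) S_def by simp
    finally show ?thesis using S(2)[OF f h] by simp
  qed
  define D where "D = inv (encode_path :: 'a \<times> nat \<Rightarrow> 'a path)"
  have DJ: "D (encode_path r) = r" for r by (simp add: D_def inj_encode_path)
  have spaceR: "space R = UNIV" by (simp add: R_def space_pair_measure space\<nu>)
  define Q where "Q = distr R (vimage_algebra UNIV D R) encode_path"
  note T = transport_measure[where R=R and D=D and J=encode_path, OF prob_R DJ spaceR, folded Q_def]
  define U where "U f q = ?V f (D q)" for f q
  show ?thesis
  proof (rule that)
    have lin: "U (\<lambda>x. a * f x + b * h x) q = a * U f q + b * U h q" if "f \<in> schwartz" "h \<in> schwartz" for f h a b q
      by (simp add: U_def plane_wave_def case_prod_beta fourier_lincomb[OF that] algebra_simps)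
    have sq: "square_integrable Q (U f)" if "f \<in> schwartz" for f
      using T(3)[OF V_sq[OF that]] by (simp add: U_def[abs_def])
    have mean: "(LINT q|Q. U f q) = 0" if "f \<in> schwartz" for f
      using T(2)[OF V_meas[OF that]] V_mean[OF that] by (simp add: U_def)
    \<comment> \<open>For real f the transform at -x is conjugate to that at x, so the plane wave is
      a sum of two conjugates times a real weight.\<close>
    have real: "U f q \<in> \<real>" if f: "f \<in> schwartz" and r: "\<And>x. f x \<in> \<real>" for f q
    proof -
      have "(\<lambda>x. cnj (f x)) = f" using r by (auto simp: Reals_cnj_iff)
      then have "fourier f (- x) = cnj (fourier f x)" for x by (simp add: cnj_fourier)
      then show ?thesis
        by (auto simp: U_def plane_wave_def Reals_cnj_iff split: prod.split)
    qed
    have cov: "(LINT q|Q. U f q * cnj (U h q)) = spconst TYPE('a) * (LINT x|\<mu>. fourier f x * cnj (fourier h x))"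
      if f: "f \<in> schwartz" and h: "h \<in> schwartz" for f h
    proof -
      note [measurable] = V_meas[OF f] V_meas[OF h]
      have "(\<lambda>r. ?V f r * cnj (?V h r)) \<in> borel_measurable R" by measurable
      from T(2)[OF this] V_cov[OF f h] show ?thesis by (simp add: U_def)
    qed
    note real_stationary_gerf_of_covariance[OF sp T(1) lin sq mean real cov]
    then show "real_stationary_gerf Q U" "has_spectral_measure Q U \<mu>" by blast+
  qed
qed

section \<open>Division of spectral measures\<close>

text \<open>At \<open>a = 0\<close> both sides are infinite because \<open>b\<close> is positive, in
  accordance with 1/0 = \<infinity> in the integrability condition.\<close>

lemma ennreal_inverse_mult:
  assumes "0 \<le> a" "0 < b"
  shows "inverse (ennreal (a * b)) = inverse (ennreal a) * ennreal (1 / b)"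
proof (cases "a = 0")
  case True
  then show ?thesis using assms by (simp add: ennreal_top_mult)
next
  case False
  then show ?thesis using assms by (simp add: inverse_ennreal ennreal_mult'[symmetric] divide_inverse)
qed

lemma ennreal_inverse_cancel: "0 < a \<Longrightarrow> inverse (ennreal a) * ennreal a = 1"
  by (simp add: inverse_ennreal ennreal_mult'[symmetric])

lemma symbol_function_borel: "symbol_function g \<Longrightarrow> g \<in> borel_measurable borel"
  unfolding symbol_function_def by (rule borel_measurable_continuous_onI) (elim conjE)

lemma symbol_function_even:
  assumes "symbol_function g"
  shows "cmod (g (- x)) = cmod (g x)"
proof -
  have "g x = cnj (g (- x))"
    using assms unfolding symbol_function_def by (elim conjE) (rule spec)
  then show ?thesis by simp
qed

lemma symbol_integrable_iff:
  "symbol_integrable \<mu> g \<longleftrightarrow> (\<exists>N::nat. (\<integral>\<^sup>+ \<xi>. inverse (ennreal ((cmod (g \<xi>))\<^sup>2)) * ennreal (1 / jap \<xi> ^ N) \<partial>\<mu>) < \<infinity>)"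
  unfolding symbol_integrable_def jap_def[symmetric] by (simp add: ennreal_inverse_mult jap_pos)

lemma divide_measure_spectral:
  assumes sp: "spectral_measure \<mu>" and g: "symbol_function g" and int: "symbol_integrable \<mu> g"
  shows "spectral_measure (divide_measure \<mu> g)"
proof -
  have sets: "sets \<mu> = sets borel" using sp by (simp add: spectral_measure_def slow_growing_def)
  note [measurable_cong] = sets
  note [measurable] = symbol_function_borel[OF g]
  have "slow_growing (divide_measure \<mu> g)"
    unfolding slow_growing_def jap_def[symmetric]
  proof
    show "sets (divide_measure \<mu> g) = sets borel" by (simp add: divide_measure_def sets)
    obtain N where N: "(\<integral>\<^sup>+ \<xi>. inverse (ennreal ((cmod (g \<xi>))\<^sup>2)) * ennreal (1 / jap \<xi> ^ N) \<partial>\<mu>) < \<infinity>"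
      using int by (auto simp: symbol_integrable_iff)
    have "(\<integral>\<^sup>+ x. ennreal (1 / jap x ^ N) \<partial>divide_measure \<mu> g) < \<infinity>"
      unfolding divide_measure_def by (subst nn_integral_density) (use N in auto)
    then show "\<exists>N. (\<integral>\<^sup>+ x. ennreal (1 / jap x ^ N) \<partial>divide_measure \<mu> g) < \<infinity>" by blast
  qed
  moreover have "even_measure (divide_measure \<mu> g)"
  proof -
    let ?w = "\<lambda>\<xi>. inverse (ennreal ((cmod (g \<xi>))\<^sup>2))"
    have ev: "distr \<mu> borel uminus = \<mu>" using sp by (simp add: spectral_measure_def even_measure_def)
    have "density \<mu> ?w = density (distr \<mu> borel uminus) ?w" by (simp add: ev)
    also have "\<dots> = distr (density \<mu> (\<lambda>x. ?w (- x))) borel uminus"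
      by (rule density_distr) measurable
    finally show ?thesis
      unfolding even_measure_def divide_measure_def by (simp add: symbol_function_even[OF g])
  qed
  ultimately show ?thesis by (simp add: spectral_measure_def)
qed

text \<open>The integrand is infinite at every zero of \<open>g\<close>, so a finite integral makes
  the zero set null.\<close>

lemma symbol_integrable_AE_nonzero:
  assumes sets: "sets \<mu> = sets borel" and g: "symbol_function g" and int: "symbol_integrable \<mu> g"
  shows "AE \<xi> in \<mu>. g \<xi> \<noteq> 0"
proof -
  note [measurable_cong] = sets
  note [measurable] = symbol_function_borel[OF g]
  obtain N where N: "(\<integral>\<^sup>+ \<xi>. inverse (ennreal ((cmod (g \<xi>))\<^sup>2)) * ennreal (1 / jap \<xi> ^ N) \<partial>\<mu>) < \<infinity>"
    using int by (auto simp: symbol_integrable_iff)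
  have "AE \<xi> in \<mu>. inverse (ennreal ((cmod (g \<xi>))\<^sup>2)) * ennreal (1 / jap \<xi> ^ N) \<noteq> \<infinity>"
    by (rule nn_integral_noteq_infinite) (use N in auto)
  then show ?thesis
  proof eventually_elim
    case (elim \<xi>)
    show ?case
    proof
      assume "g \<xi> = 0"
      then show False using elim jap_pos[of \<xi>] by (simp add: ennreal_top_mult)
    qed
  qed
qed

lemma density_divide_measure:
  assumes sets: "sets \<mu> = sets borel" and g: "symbol_function g" and nz: "AE \<xi> in \<mu>. g \<xi> \<noteq> 0"
  shows "density (divide_measure \<mu> g) (\<lambda>\<xi>. ennreal ((cmod (g \<xi>))\<^sup>2)) = \<mu>"
proof -
  note [measurable_cong] = sets
  note [measurable] = symbol_function_borel[OF g]
  have "density (divide_measure \<mu> g) (\<lambda>\<xi>. ennreal ((cmod (g \<xi>))\<^sup>2))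
      = density \<mu> (\<lambda>\<xi>. inverse (ennreal ((cmod (g \<xi>))\<^sup>2)) * ennreal ((cmod (g \<xi>))\<^sup>2))"
    unfolding divide_measure_def by (rule density_density_eq) measurable
  also have "\<dots> = density \<mu> (\<lambda>_. 1)"
  proof (rule density_cong)
    show "AE \<xi> in \<mu>. inverse (ennreal ((cmod (g \<xi>))\<^sup>2)) * ennreal ((cmod (g \<xi>))\<^sup>2) = 1"
      using nz by eventually_elim (simp add: ennreal_inverse_cancel)
  qed measurable
  finally show ?thesis by (simp add: density_1)
qed

lemma divide_measure_density:
  assumes sets: "sets \<nu> = sets borel" and g: "symbol_function g" and nz: "\<And>\<xi>. g \<xi> \<noteq> 0"
  shows "divide_measure (density \<nu> (\<lambda>\<xi>. ennreal ((cmod (g \<xi>))\<^sup>2))) g = \<nu>"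
proof -
  note [measurable_cong] = sets
  note [measurable] = symbol_function_borel[OF g]
  have "divide_measure (density \<nu> (\<lambda>\<xi>. ennreal ((cmod (g \<xi>))\<^sup>2))) g
      = density \<nu> (\<lambda>\<xi>. ennreal ((cmod (g \<xi>))\<^sup>2) * inverse (ennreal ((cmod (g \<xi>))\<^sup>2)))"
    unfolding divide_measure_def by (rule density_density_eq) measurable
  also have "\<dots> = density \<nu> (\<lambda>_. 1)"
    by (intro density_cong) (auto simp: mult.commute[of "ennreal _"] ennreal_inverse_cancel nz)
  finally show ?thesis by (simp add: density_1)
qed

text \<open>\<open>\<nu>\<close> is the sum of \<open>\<mu>\<close> and the unit mass at
  \<open>z\<close>. The integral formula follows from the one for sets by induction over
  non-negative Borel functions.\<close>

lemma add_dirac: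
  fixes \<mu> :: "'a::euclidean_space measure"
  assumes sets: "sets \<mu> = sets borel"
  obtains \<nu> where "sets \<nu> = sets borel"
    "\<And>A. A \<in> sets borel \<Longrightarrow> emeasure \<nu> A = emeasure \<mu> A + indicator A z"
    "\<And>f. f \<in> borel_measurable borel \<Longrightarrow> (\<integral>\<^sup>+ x. f x \<partial>\<nu>) = (\<integral>\<^sup>+ x. f x \<partial>\<mu>) + f z"
proof -
  define \<nu> where "\<nu> = measure_of UNIV (sets borel) (\<lambda>A. emeasure \<mu> A + emeasure (return borel z) A)"
  have sa: "sigma_algebra UNIV (sets (borel :: 'a measure))"
    using sets.sigma_algebra_axioms[of "borel :: 'a measure"] by simp
  have sets\<nu>: "sets \<nu> = sets borel"
    unfolding \<nu>_def using sigma_algebra.sigma_sets_eq[OF sa] by (simp add: sets_measure_of)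
  have em: "emeasure \<nu> A = emeasure \<mu> A + emeasure (return borel z) A" if A: "A \<in> sets borel" for A
    unfolding \<nu>_def
  proof (rule emeasure_measure_of_sigma[OF sa _ _ A])
    show "positive (sets borel) (\<lambda>A. emeasure \<mu> A + emeasure (return borel z) A)"
      by (simp add: positive_def)
    show "countably_additive (sets borel) (\<lambda>A. emeasure \<mu> A + emeasure (return borel z) A)"
    proof (rule countably_additiveI)
      fix A :: "nat \<Rightarrow> 'a set" assume A: "range A \<subseteq> sets borel" "disjoint_family A"
      show "(\<Sum>i. emeasure \<mu> (A i) + emeasure (return borel z) (A i)) = emeasure \<mu> (\<Union> (range A)) + emeasure (return borel z) (\<Union> (range A))"
      proof -
        have "(\<Sum>i. emeasure \<mu> (A i)) = emeasure \<mu> (\<Union> (range A))"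
          by (rule suminf_emeasure) (use A sets in auto)
        moreover have "(\<Sum>i. emeasure (return borel z) (A i)) = emeasure (return borel z) (\<Union> (range A))"
          by (rule suminf_emeasure) (use A in auto)
        ultimately show ?thesis by (simp only: suminf_add[OF summableI summableI, symmetric])
      qed
    qed
  qed
  have em': "emeasure \<nu> A = emeasure \<mu> A + indicator A z" if "A \<in> sets borel" for A
    using em[OF that] that by simp
  have "(\<integral>\<^sup>+ x. f x \<partial>\<nu>) = (\<integral>\<^sup>+ x. f x \<partial>\<mu>) + f z" if "f \<in> borel_measurable borel" for f
    using that
  proof (induction f rule: borel_measurable_induct)
    case (cong f g)
    then show ?case by (metis UNIV_I nn_integral_cong space_borel)
  next
    case (set A)
    then show ?case using sets sets\<nu> by (simp add: em')
  next
    case (mult u c)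
    then have "u \<in> borel_measurable \<mu>" "u \<in> borel_measurable \<nu>"
      using sets sets\<nu> measurable_cong_sets by blast+
    then show ?case using mult by (simp add: nn_integral_cmult distrib_left)
  next
    case (add u v)
    then have "u \<in> borel_measurable \<mu>" "u \<in> borel_measurable \<nu>" "v \<in> borel_measurable \<mu>" "v \<in> borel_measurable \<nu>"
      using sets sets\<nu> measurable_cong_sets by blast+
    then show ?case using add by (simp add: nn_integral_add algebra_simps)
  next
    case (seq U)
    then have m: "U i \<in> borel_measurable \<mu>" "U i \<in> borel_measurable \<nu>" for i
      using sets sets\<nu> measurable_cong_sets by blast+
    have "(\<integral>\<^sup>+ x. (SUP i. U i) x \<partial>\<nu>) = (SUP i. \<integral>\<^sup>+ x. U i x \<partial>\<nu>)"
      unfolding SUP_apply by (rule nn_integral_monotone_convergence_SUP[OF seq(3) m(2)])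
    also have "\<dots> = (SUP i. (\<integral>\<^sup>+ x. U i x \<partial>\<mu>) + U i z)"
      using seq by simp
    also have "\<dots> = (SUP i. \<integral>\<^sup>+ x. U i x \<partial>\<mu>) + (SUP i. U i z)"
    proof (rule ennreal_SUP_add)
      show "incseq (\<lambda>i. \<integral>\<^sup>+ x. U i x \<partial>\<mu>)"
        using seq(3) by (auto simp: incseq_def le_fun_def intro!: nn_integral_mono)
      show "incseq (\<lambda>i. U i z)" using seq(3) by (auto simp: incseq_def le_fun_def)
    qed
    also have "(SUP i. \<integral>\<^sup>+ x. U i x \<partial>\<mu>) = (\<integral>\<^sup>+ x. (SUP i. U i) x \<partial>\<mu>)"
      unfolding SUP_apply by (rule nn_integral_monotone_convergence_SUP[OF seq(3) m(1), symmetric])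
    finally show ?case by (simp only: SUP_apply)
  qed
  then show ?thesis using that sets\<nu> em' by blast
qed

lemma divide_measure_unique_iff:
  fixes \<mu> :: "'a::euclidean_space measure"
  assumes sp: "spectral_measure \<mu>" and g: "symbol_function g" and int: "symbol_integrable \<mu> g"
  shows "(\<forall>\<nu>. slow_growing \<nu> \<and> density \<nu> (\<lambda>\<xi>. ennreal ((cmod (g \<xi>))\<^sup>2)) = \<mu> \<longleftrightarrow> \<nu> = divide_measure \<mu> g)
    \<longleftrightarrow> (\<forall>\<xi>. cmod (g \<xi>) > 0)"
proof -
  note [measurable] = symbol_function_borel[OF g]
  let ?g2 = "\<lambda>\<xi>. ennreal ((cmod (g \<xi>))\<^sup>2)"
  let ?D = "divide_measure \<mu> g"
  have sets: "sets \<mu> = sets borel" using sp by (simp add: spectral_measure_def slow_growing_def)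
  have nz: "AE \<xi> in \<mu>. g \<xi> \<noteq> 0" by (rule symbol_integrable_AE_nonzero[OF sets g int])
  have D: "slow_growing ?D" "density ?D ?g2 = \<mu>"
    using divide_measure_spectral[OF sp g int] density_divide_measure[OF sets g nz] by (auto simp: spectral_measure_def)
  have setsD: "sets ?D = sets borel" using D(1) by (simp add: slow_growing_def)
  show ?thesis
  proof
    assume pos: "\<forall>\<xi>. cmod (g \<xi>) > 0"
    show "\<forall>\<nu>. slow_growing \<nu> \<and> density \<nu> ?g2 = \<mu> \<longleftrightarrow> \<nu> = ?D"
    proof (intro allI iffI)
      fix \<nu> assume \<nu>: "slow_growing \<nu> \<and> density \<nu> ?g2 = \<mu>"
      then have "divide_measure (density \<nu> ?g2) g = \<nu>"
        by (intro divide_measure_density g) (use pos in \<open>auto simp: slow_growing_def\<close>)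
      then show "\<nu> = ?D" using \<nu> by simp
    qed (use D in simp)
  next
    assume uniq: "\<forall>\<nu>. slow_growing \<nu> \<and> density \<nu> ?g2 = \<mu> \<longleftrightarrow> \<nu> = ?D"
    show "\<forall>\<xi>. cmod (g \<xi>) > 0"
    proof (rule ccontr)
      assume "\<not> (\<forall>\<xi>. cmod (g \<xi>) > 0)"
      then obtain z where z: "g z = 0" by auto
      obtain \<nu> where \<nu>: "sets \<nu> = sets borel"
        "\<And>A. A \<in> sets borel \<Longrightarrow> emeasure \<nu> A = emeasure ?D A + indicator A z"
        "\<And>f. f \<in> borel_measurable borel \<Longrightarrow> (\<integral>\<^sup>+ x. f x \<partial>\<nu>) = (\<integral>\<^sup>+ x. f x \<partial>?D) + f z"
        using add_dirac[OF setsD, of z] by metis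
      have "slow_growing \<nu>"
      proof -
        obtain N where N: "(\<integral>\<^sup>+ x. ennreal (1 / jap x ^ N) \<partial>?D) < \<infinity>"
          using D(1) unfolding slow_growing_def jap_def[symmetric] by blast
        have "(\<lambda>x::'a. ennreal (1 / jap x ^ N)) \<in> borel_measurable borel" by measurable
        from \<nu>(3)[OF this] N have "(\<integral>\<^sup>+ x. ennreal (1 / jap x ^ N) \<partial>\<nu>) < \<infinity>"
          by (simp add: ennreal_add_less_top)
        then show ?thesis using \<nu>(1) unfolding slow_growing_def jap_def[symmetric] by blast
      qed
      moreover have "density \<nu> ?g2 = \<mu>"
      proof -
        have "density \<nu> ?g2 = density ?D ?g2"
        proof (rule measure_eqI)
          fix A assume "A \<in> sets (density \<nu> ?g2)"
          then have A: "A \<in> sets borel" using \<nu>(1) by simp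
          have m: "(\<lambda>x. ?g2 x * indicator A x) \<in> borel_measurable borel" using A by measurable
          have gm: "?g2 \<in> borel_measurable borel" by measurable
          have gm': "?g2 \<in> borel_measurable \<nu>" "?g2 \<in> borel_measurable ?D"
            using gm measurable_cong_sets[OF \<nu>(1) refl] measurable_cong_sets[OF setsD refl] by blast+
          show "emeasure (density \<nu> ?g2) A = emeasure (density ?D ?g2) A"
            using A \<nu>(1) setsD \<nu>(3)[OF m] z by (simp add: emeasure_density[OF gm'(1)] emeasure_density[OF gm'(2)])
        qed (simp add: \<nu>(1) setsD)
        then show ?thesis by (simp add: D(2))
      qed
      ultimately have "\<nu> = ?D" using uniq by blast
      \<comment> \<open>The infinite weight at \<open>z\<close> sits on a \<open>\<mu>\<close>-null
        set, so the quotient measure has no mass there. Adding the unit mass therefore gives a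
        different measure.\<close>
      moreover have "emeasure ?D {z} = 0"
      proof -
        have "AE x in \<mu>. inverse (?g2 x) * indicator {z} x = 0"
          using nz by eventually_elim (use z in \<open>auto split: split_indicator\<close>)
        then have "(\<integral>\<^sup>+ x. inverse (?g2 x) * indicator {z} x \<partial>\<mu>) = 0"
          by (subst nn_integral_cong_AE[where v="\<lambda>_. 0"]) auto
        moreover have "(\<lambda>x. inverse (?g2 x)) \<in> borel_measurable \<mu>"
          unfolding measurable_cong_sets[OF sets refl] by measurable
        ultimately show ?thesis
          unfolding divide_measure_def by (subst emeasure_density) (auto simp: sets)
      qed
      ultimately show False using \<nu>(2)[of "{z}"] by simp
    qed
  qed
qed

section \<open>Solvability\<close>

lemma second_order_eqD:
  assumes "second_order_eq Q W P X" "f \<in> schwartz" "h \<in> schwartz"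
  shows "(LINT \<omega>|Q. W f \<omega> * cnj (W h \<omega>)) = (LINT \<omega>|P. X f \<omega> * cnj (X h \<omega>))"
  using assms by (auto simp: second_order_eq_def has_covariance_distribution_def)

text \<open>At the transform of a Schwartz \<open>\<psi>\<close> the second moment of X is a
  constant times the squared L2 norm of \<open>\<psi>\<close>, while that of the operator side is
  the one of the extended field at g \<psi>, which has the supremum bound. The passage to rapid
  \<psi> matters: the later test functions contain |g| and are merely continuous.\<close>

lemma symbol_operator_dominates:
  fixes U :: "('a::euclidean_space, 'w) random_field"
  assumes U: "real_stationary_gerf Q U" and eq: "second_order_eq Q (symbol_operator Q g U) P X"
    and X: "has_spectral_measure P X \<mu>" and g: "symbol_function g"
  shows "\<exists>K N. K > 0 \<and> (\<forall>\<psi> s. rapid \<psi> \<longrightarrow> (\<forall>x. jap x ^ N * cmod (g x * \<psi> x) \<le> s) \<longrightarrow> l2_norm \<mu> \<psi> \<le> K * s)"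
proof -
  let ?c = "(2 * pi) powr (real DIM('a) / 2)"
  have sg: "slow_growing \<mu>" using X by (simp add: has_spectral_measure_def spectral_measure_def)
  obtain \<rho> where gerf: "gerf Q U" and \<rho>: "has_stationary_covariance Q U \<rho>"
    using U by (auto simp: real_stationary_gerf_def real_gerf_def)
  obtain K N where "sup_continuous_field Q (fourier_field U) K N"
    by (rule stationary_sup_continuous_field[OF gerf \<rho>]) (rule that)
  then interpret sup_continuous_field Q "fourier_field U" K N .
  obtain C m where C: "C > 0" "\<And>x. cmod (g x) \<le> C * jap x ^ m"
    by (rule symbol_function_E[OF g]) (rule that)
  have schwartz_bound: "sqrt ?c * l2_norm \<mu> \<psi> \<le> K * s"
    if \<psi>: "\<psi> \<in> schwartz" and s: "\<And>x. jap x ^ N * cmod (g x * \<psi> x) \<le> s" for \<psi> s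
  proof -
    have inv: "fourier_inv (fourier \<psi>) = \<psi>"
      by (simp add: fourier_inv_eq fourier_schwartz \<psi> fourier_fourier)
    have "complex_of_real ((l2_norm Q (symbol_operator Q g U (fourier \<psi>)))\<^sup>2)
        = spconst TYPE('a) * complex_of_real ((l2_norm \<mu> \<psi>)\<^sup>2)"
      using second_order_eqD[OF eq fourier_schwartz[OF \<psi>] fourier_schwartz[OF \<psi>]]
        spectral_covariance[OF X fourier_schwartz[OF \<psi>] fourier_schwartz[OF \<psi>]]
      by (simp only: integral_mult_cnj_self inv)
    then have "(l2_norm Q (symbol_operator Q g U (fourier \<psi>)))\<^sup>2 = ?c * (l2_norm \<mu> \<psi>)\<^sup>2"
      by (simp only: of_real_mult[symmetric] of_real_eq_iff)
    then have "l2_norm Q (symbol_operator Q g U (fourier \<psi>)) = sqrt ?c * l2_norm \<mu> \<psi>"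
      by (metis l2_norm_nonneg real_sqrt_abs abs_of_nonneg real_sqrt_mult)
    moreover have "l2_norm Q (symbol_operator Q g U (fourier \<psi>)) \<le> K * s"
      unfolding symbol_operator_eq inv
      by (intro extend_field_bound symbol_mult_rapid g schwartz_rapid \<psi> s)
    ultimately show ?thesis by simp
  qed
  have "l2_norm \<mu> \<psi> \<le> (K / sqrt ?c) * s"
    if \<psi>: "rapid \<psi>" and s: "\<forall>x. jap x ^ N * cmod (g x * \<psi> x) \<le> s" for \<psi> s
  proof -
    obtain F where F: "\<And>n. F n \<in> schwartz" "rapid_limit F \<psi>"
      using rapid_approx[OF \<psi>] by metis
    have "sqrt ?c * l2_norm \<mu> \<psi> \<le> K * s + e" if "e > 0" for e
    proof -
      \<comment> \<open>Approximation in the weight \<open>N + m\<close> with this error leaves at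
        most e / K after multiplication by \<open>g\<close>, hence at most e after the constant
        \<open>K\<close>.\<close>
      have d: "e / (K * C) > 0" using that K_pos C(1) by simp
      have "\<forall>\<^sub>F n in sequentially. sqrt ?c * l2_norm \<mu> (F n) \<le> K * s + e"
        using rapid_limitD[OF F(2) d, of "N + m"]
      proof eventually_elim
        case (elim n)
        have "jap x ^ N * cmod (g x * F n x) \<le> s + e / K" for x
        proof -
          have "jap x ^ N * cmod (g x * (F n x - \<psi> x)) = cmod (g x) * (jap x ^ N * cmod (F n x - \<psi> x))"
            by (simp add: norm_mult mult_ac)
          also have "\<dots> \<le> (C * jap x ^ m) * (jap x ^ N * cmod (F n x - \<psi> x))"
            using jap_pos[of x] by (intro mult_right_mono C) auto
          also have "\<dots> = C * (jap x ^ (N + m) * cmod (F n x - \<psi> x))"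
            by (simp add: power_add mult_ac)
          also have "\<dots> \<le> C * (e / (K * C))"
            using elim C(1) by (intro mult_left_mono) auto
          finally have 1: "jap x ^ N * cmod (g x * (F n x - \<psi> x)) \<le> e / K"
            using C(1) by simp
          have "cmod (g x * F n x) \<le> cmod (g x * (F n x - \<psi> x)) + cmod (g x * \<psi> x)"
            using norm_triangle_ineq[of "g x * (F n x - \<psi> x)" "g x * \<psi> x"] by (simp add: algebra_simps)
          then have "jap x ^ N * cmod (g x * F n x) \<le> jap x ^ N * (cmod (g x * (F n x - \<psi> x)) + cmod (g x * \<psi> x))"
            using jap_pos[of x] by (intro mult_left_mono) auto
          also have "\<dots> \<le> s + e / K" using 1 s[rule_format, of x] by (simp add: distrib_left)
          finally show ?thesis .
        qed
        from schwartz_bound[OF F(1) this] show ?case using K_pos by (simp add: distrib_left)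
      qed
      moreover have "(\<lambda>n. sqrt ?c * l2_norm \<mu> (F n)) \<longlonglongrightarrow> sqrt ?c * l2_norm \<mu> \<psi>"
        by (intro tendsto_intros l2_limit_norm_bounded rapid_limit_l2_limit[OF sg \<psi> F])
      ultimately show ?thesis by (intro tendsto_upperbound) auto
    qed
    then have "sqrt ?c * l2_norm \<mu> \<psi> \<le> K * s" by (rule field_le_epsilon)
    then show ?thesis by (simp add: field_simps)
  qed
  note bound = this
  have "K / sqrt ?c > 0" using K_pos by simp
  moreover have "\<forall>\<psi> s. rapid \<psi> \<longrightarrow> (\<forall>x. jap x ^ N * cmod (g x * \<psi> x) \<le> s) \<longrightarrow> l2_norm \<mu> \<psi> \<le> (K / sqrt ?c) * s"
    by (intro allI impI) (rule bound)
  ultimately show ?thesis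
    by (intro exI conjI)
qed

lemma symbol_integrable_necessary:
  fixes U :: "('a::euclidean_space, 'w) random_field"
  assumes U: "real_stationary_gerf Q U" and eq: "second_order_eq Q (symbol_operator Q g U) P X"
    and X: "has_spectral_measure P X \<mu>" and g: "symbol_function g"
  shows "symbol_integrable \<mu> g"
proof -
  have sg: "slow_growing \<mu>" using X by (simp add: has_spectral_measure_def spectral_measure_def)
  have cont: "continuous_on UNIV g" using g unfolding symbol_function_def by (elim conjE)
  from symbol_operator_dominates[OF assms] obtain K N where K: "K > 0"
    and dom: "\<forall>\<psi> s. rapid \<psi> \<longrightarrow> (\<forall>x. jap x ^ N * cmod (g x * \<psi> x) \<le> s) \<longrightarrow> l2_norm \<mu> \<psi> \<le> K * s"
    by (elim exE conjE)
  define d where "d n = 1 / real (Suc n)" for n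
  have d: "d n > 0" for n by (simp add: d_def)
  have d0: "d \<longlonglongrightarrow> 0" unfolding d_def using LIMSEQ_Suc[OF lim_1_over_n] by simp
  \<comment> \<open>\<open>d n\<close> under the root keeps the denominator away from 0 at zeros of
    \<open>g\<close>, and the Gaussian supplies rapid decay. Since |g| is at most the root,
    \<open>jap\<close>^N |g \<psi>| \<le> 1 for all n, so \<open>K\<close> bounds every
    norm.\<close>
  define \<psi> where "\<psi> n x = complex_of_real (1 / (sqrt ((cmod (g x))\<^sup>2 + d n) * jap x ^ N)) * complex_of_real (exp (- d n * (norm x)\<^sup>2))" for n and x :: 'a
  have gd: "(cmod (g x))\<^sup>2 + d n > 0" for n x using d[of n] by (simp add: add_nonneg_pos)
  have "rapid (\<psi> n)" for n
    unfolding \<psi>_def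
  proof (rule rapid_mult)
    show "rapid (\<lambda>x::'a. complex_of_real (exp (- d n * (norm x)\<^sup>2)))"
      by (rule schwartz_rapid, unfold schwartz_iff_dbound) (intro allI dbound_gauss d)
    have nz: "sqrt ((cmod (g x))\<^sup>2 + d n) * jap x ^ N \<noteq> 0" for x
      using gd[of x n] jap_pos[of x] by simp
    show "continuous_on UNIV (\<lambda>x. complex_of_real (1 / (sqrt ((cmod (g x))\<^sup>2 + d n) * jap x ^ N)))"
      using nz by (intro continuous_intros cont) auto
    fix x :: 'a
    have "sqrt (d n) * 1 \<le> sqrt ((cmod (g x))\<^sup>2 + d n) * jap x ^ N"
      using d[of n] jap_ge_1[of x] by (intro mult_mono) (auto simp: one_le_power)
    then have "1 / (sqrt ((cmod (g x))\<^sup>2 + d n) * jap x ^ N) \<le> 1 / sqrt (d n)"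
      using d[of n] gd[of x n] jap_pos[of x] by (intro divide_left_mono mult_pos_pos) auto
    moreover have "0 \<le> 1 / (sqrt ((cmod (g x))\<^sup>2 + d n) * jap x ^ N)"
      using gd[of x n] jap_pos[of x] by simp
    ultimately show "cmod (complex_of_real (1 / (sqrt ((cmod (g x))\<^sup>2 + d n) * jap x ^ N))) \<le> (1 / sqrt (d n)) * jap x ^ 0"
      by (simp only: norm_of_real abs_of_nonneg) simp
  qed
  note \<psi>_rapid = this
  have norm_\<psi>: "cmod (\<psi> n x) = exp (- d n * (norm x)\<^sup>2) / (sqrt ((cmod (g x))\<^sup>2 + d n) * jap x ^ N)" for n x
    using gd[of x n] jap_pos[of x] by (simp add: \<psi>_def norm_mult norm_divide abs_of_pos norm_power)
  have "l2_norm \<mu> (\<psi> n) \<le> K * 1" for n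
  proof (rule dom[rule_format, OF \<psi>_rapid])
    fix x
    have "jap x ^ N * cmod (g x * \<psi> n x) = (cmod (g x) / sqrt ((cmod (g x))\<^sup>2 + d n)) * exp (- d n * (norm x)\<^sup>2)"
      using jap_pos[of x] by (simp add: norm_mult norm_\<psi>)
    also have "\<dots> \<le> 1 * 1"
    proof (rule mult_mono)
      have "cmod (g x) \<le> sqrt ((cmod (g x))\<^sup>2 + d n)"
        using d[of n] by (intro real_le_rsqrt) simp
      then show "cmod (g x) / sqrt ((cmod (g x))\<^sup>2 + d n) \<le> 1"
        using gd[of x n] by simp
    qed (use d[of n] in auto)
    finally show "jap x ^ N * cmod (g x * \<psi> n x) \<le> 1" by simp
  qed
  then have le: "(\<integral>\<^sup>+ x. ennreal ((cmod (\<psi> n x))\<^sup>2) \<partial>\<mu>) \<le> ennreal (K\<^sup>2)" for n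
    using rapid_l2_bound[OF sg] \<psi>_rapid K
    by (subst nn_integral_square) (auto intro!: ennreal_leI power_mono simp: l2_norm_nonneg)
  have meas: "(\<lambda>x. ennreal ((cmod (\<psi> n x))\<^sup>2)) \<in> borel_measurable \<mu>" for n
  proof -
    have [measurable]: "\<psi> n \<in> borel_measurable \<mu>"
      by (intro slow_growing_borel[OF sg] rapid_borel \<psi>_rapid)
    show ?thesis by measurable
  qed
  have lim: "(\<lambda>n. ennreal ((cmod (\<psi> n x))\<^sup>2)) \<longlonglongrightarrow> inverse (ennreal ((cmod (g x))\<^sup>2 * jap x ^ (2 * N)))" for x
  proof -
    let ?a = "\<lambda>n. ((cmod (g x))\<^sup>2 + d n) * jap x ^ (2 * N) * exp (2 * d n * (norm x)\<^sup>2)"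
    have "(cmod (\<psi> n x))\<^sup>2 = 1 / ?a n" for n
    proof -
      have "(exp (- d n * (norm x)\<^sup>2))\<^sup>2 = 1 / exp (2 * d n * (norm x)\<^sup>2)"
        by (simp add: power2_eq_square exp_add[symmetric] exp_minus[symmetric] divide_inverse)
      moreover have "(jap x ^ N)\<^sup>2 = jap x ^ (2 * N)"
        by (simp add: power_mult[symmetric] mult.commute)
      ultimately show ?thesis
        using gd[of x n] by (simp add: norm_\<psi> power_divide power_mult_distrib mult_ac)
    qed
    moreover have "?a n > 0" for n using gd[of x n] jap_pos[of x] by simp
    \<comment> \<open>At a zero of \<open>g\<close> the squares may tend to infinity. Passing to
      inverses in \<open>ennreal\<close> lets the reciprocals converge instead, and continuity of
      \<open>inverse\<close> there includes the value at 0.\<close>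
    ultimately have eq: "ennreal ((cmod (\<psi> n x))\<^sup>2) = inverse (ennreal (?a n))" for n
      by (simp add: inverse_ennreal divide_inverse)
    have "?a \<longlonglongrightarrow> ((cmod (g x))\<^sup>2 + 0) * jap x ^ (2 * N) * exp (2 * 0 * (norm x)\<^sup>2)"
      by (intro tendsto_intros d0)
    then have "(\<lambda>n. ennreal (?a n)) \<longlonglongrightarrow> ennreal ((cmod (g x))\<^sup>2 * jap x ^ (2 * N))"
      by (intro tendsto_ennrealI) simp
    then show ?thesis
      unfolding eq
      by (rule continuous_on_tendsto_compose[OF continuous_on_inverse_ennreal[OF continuous_on_id, of UNIV]]) simp_all
  qed
  have "(\<integral>\<^sup>+ x. inverse (ennreal ((cmod (g x))\<^sup>2 * jap x ^ (2 * N))) \<partial>\<mu>)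
      = (\<integral>\<^sup>+ x. liminf (\<lambda>n. ennreal ((cmod (\<psi> n x))\<^sup>2)) \<partial>\<mu>)"
    using lim_imp_Liminf[OF _ lim] by (intro nn_integral_cong) simp
  also have "\<dots> \<le> liminf (\<lambda>n. \<integral>\<^sup>+ x. ennreal ((cmod (\<psi> n x))\<^sup>2) \<partial>\<mu>)"
    by (rule nn_integral_liminf[OF meas])
  also have "\<dots> \<le> ennreal (K\<^sup>2)"
    by (rule Liminf_le) (simp_all add: le)
  also have "\<dots> < \<infinity>" by simp
  finally show ?thesis unfolding symbol_integrable_def jap_def[symmetric] by blast
qed

text \<open>The covariances of the approximating fields converge in two ways: in L2 of the sample
  space to the covariance of the operator side, and in L2 of the quotient measure to a spectral
  integral. Uniqueness of limits identifies the two.\<close>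

lemma symbol_operator_solves:
  fixes U :: "('a::euclidean_space, 'v) random_field" and X :: "('a, 'w) random_field"
  assumes X: "real_stationary_gerf P X" "has_spectral_measure P X \<mu>" and g: "symbol_function g"
    and int: "symbol_integrable \<mu> g"
    and U: "real_stationary_gerf Q U" "has_spectral_measure Q U (divide_measure \<mu> g)"
  shows "second_order_eq Q (symbol_operator Q g U) P X"
proof -
  let ?D = "divide_measure \<mu> g"
  have sets: "sets \<mu> = sets borel" and sp: "spectral_measure \<mu>"
    using X(2) by (auto simp: has_spectral_measure_def spectral_measure_def slow_growing_def)
  have sg: "slow_growing ?D" using U(2) by (simp add: has_spectral_measure_def spectral_measure_def)
  have setsD: "sets ?D = sets borel" using sg by (simp add: slow_growing_def)
  obtain \<rho> where gerf: "gerf Q U" and \<rho>: "has_stationary_covariance Q U \<rho>"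
    using U(1) by (auto simp: real_stationary_gerf_def real_gerf_def)
  obtain K N where sc: "sup_continuous_field Q (fourier_field U) K N"
    by (rule stationary_sup_continuous_field[OF gerf \<rho>]) (rule that)
  then interpret sup_continuous_field Q "fourier_field U" K N .
  obtain \<rho>' C where C: "has_covariance_distribution P X C"
    using X(1) by (auto simp: real_stationary_gerf_def has_stationary_covariance_def)
  have density: "density ?D (\<lambda>\<xi>. ennreal ((cmod (g \<xi>))\<^sup>2)) = \<mu>"
    by (rule density_divide_measure[OF sets g symbol_integrable_AE_nonzero[OF sets g int]])
  have cov: "(LINT \<omega>|Q. symbol_operator Q g U f \<omega> * cnj (symbol_operator Q g U h \<omega>)) = (LINT \<omega>|P. X f \<omega> * cnj (X h \<omega>))"
    if f: "f \<in> schwartz" and h: "h \<in> schwartz" for f h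
  proof -
    define a b where "a = fourier_inv f" and "b = fourier_inv h"
    have ab: "a \<in> schwartz" "b \<in> schwartz" by (simp_all add: a_def b_def fourier_inv_schwartz f h)
    have r: "rapid (\<lambda>x. g x * a x)" "rapid (\<lambda>x. g x * b x)"
      by (intro symbol_mult_rapid g schwartz_rapid ab)+
    obtain F where F: "\<And>n. F n \<in> schwartz" "rapid_limit F (\<lambda>x. g x * a x)"
      "l2_limit Q (\<lambda>n. fourier_field U (F n)) (extend_field Q (fourier_field U) (\<lambda>x. g x * a x))"
      using extend_field_approx[OF r(1)] by blast
    obtain H where H: "\<And>n. H n \<in> schwartz" "rapid_limit H (\<lambda>x. g x * b x)"
      "l2_limit Q (\<lambda>n. fourier_field U (H n)) (extend_field Q (fourier_field U) (\<lambda>x. g x * b x))"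
      using extend_field_approx[OF r(2)] by blast
    have "(\<lambda>n. LINT \<omega>|Q. fourier_field U (F n) \<omega> * cnj (fourier_field U (H n) \<omega>))
        \<longlonglongrightarrow> (LINT \<omega>|Q. symbol_operator Q g U f \<omega> * cnj (symbol_operator Q g U h \<omega>))"
      unfolding symbol_operator_eq a_def[symmetric] b_def[symmetric] by (rule l2_limit_inner[OF F(3) H(3)])
    then have "(\<lambda>n. spconst TYPE('a) * (LINT x|?D. F n x * cnj (H n x)))
        \<longlonglongrightarrow> (LINT \<omega>|Q. symbol_operator Q g U f \<omega> * cnj (symbol_operator Q g U h \<omega>))"
      by (simp only: spectral_covariance_fourier_field[OF U(2) F(1) H(1)])
    moreover have "(\<lambda>n. spconst TYPE('a) * (LINT x|?D. F n x * cnj (H n x)))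
        \<longlonglongrightarrow> spconst TYPE('a) * (LINT x|?D. (g x * a x) * cnj (g x * b x))"
      by (intro tendsto_intros l2_limit_inner rapid_limit_l2_limit[OF sg] r F(1,2) H(1,2))
    ultimately have "(LINT \<omega>|Q. symbol_operator Q g U f \<omega> * cnj (symbol_operator Q g U h \<omega>))
        = spconst TYPE('a) * (LINT x|?D. (g x * a x) * cnj (g x * b x))"
      by (rule LIMSEQ_unique)
    \<comment> \<open>The two factors \<open>g\<close> combine to |g|^2, a density that turns the
      quotient measure back into \<open>\<mu>\<close>.\<close>
    also have "(LINT x|?D. (g x * a x) * cnj (g x * b x)) = (LINT x|?D. (cmod (g x))\<^sup>2 *\<^sub>R (a x * cnj (b x)))"
      by (simp only: scaleR_conv_of_real complex_norm_square complex_cnj_mult mult_ac)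
    also have "\<dots> = (LINT x|density ?D (\<lambda>\<xi>. ennreal ((cmod (g \<xi>))\<^sup>2)). a x * cnj (b x))"
    proof (rule integral_density[symmetric])
      note [measurable_cong] = setsD
      note [measurable] = symbol_function_borel[OF g] schwartz_borel[OF ab(1)] schwartz_borel[OF ab(2)]
      show "(\<lambda>x. a x * cnj (b x)) \<in> borel_measurable ?D" by measurable
      show "(\<lambda>x. (cmod (g x))\<^sup>2) \<in> borel_measurable ?D" by measurable
    qed simp
    also have "spconst TYPE('a) * \<dots> = (LINT \<omega>|P. X f \<omega> * cnj (X h \<omega>))"
      unfolding density by (simp add: spectral_covariance[OF X(2) f h] a_def b_def)
    finally show ?thesis .
  qed
  have "has_covariance_distribution Q (symbol_operator Q g U) C"
    using C gerf_symbol_operator[OF sc g] cov by (simp add: has_covariance_distribution_def)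
  then show ?thesis using C by (auto simp: second_order_eq_def)
qed

text \<open>Existence over some probability space cannot quantify over sample types, so it is stated
  on \<open>'a path\<close>. The separate implication for an arbitrary type \<open>'v\<close> makes
  the condition necessary for solutions on any sample space.\<close>

theorem theorem1:
  fixes P :: "'w measure"
    and X :: "('a::euclidean_space, 'w) random_field"
    and \<mu>\<^sub>X :: "'a measure"
    and g :: "'a \<Rightarrow> complex"
  assumes "real_stationary_gerf P X"
    and "has_spectral_measure P X \<mu>\<^sub>X"
    and "symbol_function g"
  shows
    "((\<exists>(Q :: 'a path measure) U. real_stationary_gerf Q U \<and>
         second_order_eq Q (symbol_operator Q g U) P X) \<longleftrightarrow> symbol_integrable \<mu>\<^sub>X g) \<and>
     (\<forall>(Q :: 'v measure) U. real_stationary_gerf Q U \<and>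
         second_order_eq Q (symbol_operator Q g U) P X \<longrightarrow> symbol_integrable \<mu>\<^sub>X g) \<and>
     (symbol_integrable \<mu>\<^sub>X g \<longrightarrow>
        spectral_measure (divide_measure \<mu>\<^sub>X g) \<and>
        (\<forall>(Q :: 'v measure) U. real_stationary_gerf Q U \<and>
           has_spectral_measure Q U (divide_measure \<mu>\<^sub>X g) \<longrightarrow>
           second_order_eq Q (symbol_operator Q g U) P X) \<and>
        ((\<forall>\<mu>. slow_growing \<mu> \<and> density \<mu> (\<lambda>\<xi>. ennreal ((cmod (g \<xi>))\<^sup>2)) = \<mu>\<^sub>X \<longleftrightarrow>
              \<mu> = divide_measure \<mu>\<^sub>X g) \<longleftrightarrow>
         (\<forall>\<xi>. cmod (g \<xi>) > 0)))"
proof -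
  have sp: "spectral_measure \<mu>\<^sub>X" using assms(2) by (simp add: has_spectral_measure_def)
  have exists: "\<exists>(Q :: 'a path measure) U. real_stationary_gerf Q U \<and> second_order_eq Q (symbol_operator Q g U) P X"
    if int: "symbol_integrable \<mu>\<^sub>X g"
  proof -
    obtain Q :: "'a path measure" and U where U: "real_stationary_gerf Q U" "has_spectral_measure Q U (divide_measure \<mu>\<^sub>X g)"
      by (rule exists_field_with_spectral_measure[OF divide_measure_spectral[OF sp assms(3) int]]) (rule that)
    have "second_order_eq Q (symbol_operator Q g U) P X"
      by (rule symbol_operator_solves[OF assms int U])
    with U(1) show ?thesis by blast
  qed
  show ?thesis
  proof (intro conjI impI allI)
    show "(\<exists>(Q :: 'a path measure) U. real_stationary_gerf Q U \<and>
        second_order_eq Q (symbol_operator Q g U) P X) \<longleftrightarrow> symbol_integrable \<mu>\<^sub>X g"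
      using exists symbol_integrable_necessary[OF _ _ assms(2,3)] by blast
    show "symbol_integrable \<mu>\<^sub>X g"
      if "real_stationary_gerf Q U \<and> second_order_eq Q (symbol_operator Q g U) P X" for Q :: "'v measure" and U
      using that symbol_integrable_necessary[OF _ _ assms(2,3)] by blast
    assume int: "symbol_integrable \<mu>\<^sub>X g"
    show "spectral_measure (divide_measure \<mu>\<^sub>X g)"
      by (rule divide_measure_spectral[OF sp assms(3) int])
    show "second_order_eq Q (symbol_operator Q g U) P X"
      if "real_stationary_gerf Q U \<and> has_spectral_measure Q U (divide_measure \<mu>\<^sub>X g)" for Q :: "'v measure" and U
      using that by (intro symbol_operator_solves[OF assms int]) auto
    show "(\<forall>\<mu>. slow_growing \<mu> \<and> density \<mu> (\<lambda>\<xi>. ennreal ((cmod (g \<xi>))\<^sup>2)) = \<mu>\<^sub>X \<longleftrightarrow> \<mu> = divide_measure \<mu>\<^sub>X g)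
        \<longleftrightarrow> (\<forall>\<xi>. cmod (g \<xi>) > 0)"
      by (rule divide_measure_unique_iff[OF sp assms(3) int])
  qed
qed

end
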